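(* Let $\{x^k\}_{k\ge0}$ be the random sequence generated by the RBPDN method (described in the context) from $x^0\in\mathrm{dom}(F)$. Suppose that $g$ is Lipschitz differentiable in $\mathcal{S}(x^0)$ with a Lipschitz constant $L_g\ge0$ (that is, $g$ is differentiable in $\mathcal{S}(x^0)$ and $\nabla g$ is Lipschitz continuous there with constant $L_g$). Then $$\mathbf{E}[F(x^k)-F^*]\le\left[1-\frac{\tilde c_4^2p_{\min}^2(1-\omega_*^{-1}(\delta_0))}{2(1+\tilde c_4p_{\min}\omega_*^{-1}(\delta_0))}\right]^k(F(x^0)-F^* ),\qquad\forall k\ge0,$$ where $\delta_0=F(x^0)-F^*$ and $$\tilde c_4=\frac{\sqrt n\,c_1\sigma_f}{(1-\eta)(L_f+L_g)},$$ and $\mathcal{S}(x^0)$, $p_{\min}$, $c_1$, $\sigma_f$, $L_f$, $\omega_*^{-1}$ are as defined in the context.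
   Context: Problem and standing assumptions. Consider $F^*=\min_{x\in\mathbb{R}^N}\{F(x):=f(x)+g(x)\}$, where $f,g:\mathbb{R}^N\to\mathbb{R}\cup\{\infty\}$. The components of $x\in\mathbb{R}^N$ are partitioned into subvectors $x_1,\dots,x_n$ with $x_i\in\mathbb{R}^{N_i}$, and $g(x)=\sum_{i=1}^n g_i(x_i)$ with each $g_i:\mathbb{R}^{N_i}\to\mathbb{R}\cup\{\infty\}$ proper closed convex. The function $f$ is standard self-concordant: it is a closed convex function with open domain $\mathrm{dom}(f)$, three times continuously differentiable on $\mathrm{dom}(f)$, and $|\psi'''(0)|\le 2(\psi''(0))^{3/2}$ for all $x\in\mathrm{dom}(f)$, $u\in\mathbb{R}^N$, where $\psi(t)=f(x+tu)$. Also $\nabla^2 f$ is continuous and positive definite on $\mathrm{dom}(F)$, and the problem has a unique optimal solution $x^*$ (so $F^*=F(x^* )$). Notation. $\|\cdot\|$ is the Euclidean norm of a vector or spectral norm of a matrix. $\nabla_i f(x)$ is the subvector of $\nabla f(x)$, and $\nabla^2_{ii}f(x)$ the submatrix of $\nabla^2 f(x)$, corresponding to $x_i$. For $y,z\in\mathbb{R}^{N_i}$, $\|y\|_{x_i}:=\sqrt{\langle y,\nabla^2_{ii}f(x)y\rangle}$ and $\|z\|^*_{x_i}:=\sqrt{\langle z,(\nabla^2_{ii}f(x))^{-1}z\rangle}$. RBPDN method. Fix $x^0\in\mathrm{dom}(F)$, $\eta\in[0,1/4]$ and $p_1,\dots,p_n>0$ with $\sum_i p_i=1$. For each $x\in\mathrm{dom}(F)$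 and each $i$, $d_i(x)\in\mathbb{R}^{N_i}$ denotes an approximate solution of $\min_{d_i}\{f(x)+\langle\nabla_i f(x),d_i\rangle+\frac12\langle d_i,\nabla^2_{ii}f(x)d_i\rangle+g_i(x_i+d_i)\}$ in the sense that, for some $v_i$, $-v_i\in\nabla_i f(x)+\nabla^2_{ii}f(x)d_i(x)+\partial g_i(x_i+d_i(x))$ and $\|v_i\|^*_{x_i}\le\eta\|d_i(x)\|_{x_i}$. Put $\lambda_i(x):=\|d_i(x)\|_{x_i}$. At iteration $k\ge0$, pick $\iota\in\{1,\dots,n\}$ at random (independently of the past) with probability $p_\iota$, and set $x^{k+1}_j=x^k_j$ for $j\ne\iota$ and $x^{k+1}_\iota=x^k_\iota+d_\iota(x^k)/(1+\lambda_\iota(x^k))$. $\mathbf{E}$ is expectation over all random block choices. Constants. $\mathcal{S}(x^0):=\{x:F(x)\le F(x^0)\}$ (a compact set), $\sigma_f:=\min_{x\in\mathcal{S}(x^0)}\lambda_{\min}(\nabla^2 f(x))$ with $\lambda_{\min}$ the minimal eigenvalue, $L_f:=\max_{x\in\mathcal{S}(x^0)}\|\nabla^2 f(x)\|$, $H(x):=\mathrm{Diag}(\nabla^2_{11}f(x),\dots,\nabla^2_{nn}f(x))$ (block diagonal), $p_{\min}:=\min_i p_i$, $$c_1:=\frac{1-\eta}{\sqrt n\,\max_{x\in\mathcal{S}(x^0)}\left\{(1+\eta)\|H(x)^{1/2}(\nabla^2 f(x))^{-1/2}\|+\|H(x)^{-1/2}(\nabla^2 f(x))^{1/2}\|\right\}}.$$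 $\omega_*(t):=-t-\ln(1-t)$ and $\omega_*^{-1}:[0,\infty)\to[0,1)$ is the inverse of $\omega_*$ restricted to $[0,1)$. *)

theory Defs
  imports "HOL-Probability.Probability"
begin

(* Functions with values in R united with {\<infinity>} are ereal-valued functions that avoid -\<infinity>.
   Their derivatives are those of real_of_ereal o f; these are only used at interior points of
   the domain, since real_of_ereal sends \<infinity> to 0. *)

definition edom :: "('a \<Rightarrow> ereal) \<Rightarrow> 'a set" where
  "edom f = {x. f x < \<infinity>}"

definition epi :: "'a set \<Rightarrow> ('a \<Rightarrow> ereal) \<Rightarrow> ('a \<times> real) set" where
  "epi S f = {(x, t). x \<in> S \<and> f x \<le> ereal t}"

definition closed_convex_fun :: "'a::real_normed_vector set \<Rightarrow> ('a \<Rightarrow> ereal) \<Rightarrow> bool" where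
  "closed_convex_fun S f \<longleftrightarrow> closed (epi S f) \<and> convex (epi S f)"

definition proper_fun :: "'a set \<Rightarrow> ('a \<Rightarrow> ereal) \<Rightarrow> bool" where
  "proper_fun S f \<longleftrightarrow> (\<forall>x\<in>S. f x \<noteq> -\<infinity>) \<and> (\<exists>x\<in>S. f x < \<infinity>)"

definition partial_deriv :: "'n::finite \<Rightarrow> (real^'n \<Rightarrow> real) \<Rightarrow> real^'n \<Rightarrow> real" where
  "partial_deriv j h x = frechet_derivative h (at x) (axis j 1)"

definition egrad :: "(real^'n::finite \<Rightarrow> ereal) \<Rightarrow> real^'n \<Rightarrow> real^'n" where
  "egrad f x = (\<chi> j. partial_deriv j (\<lambda>y. real_of_ereal (f y)) x)"

definition ehess :: "(real^'n::finite \<Rightarrow> ereal) \<Rightarrow> real^'n \<Rightarrow> real^'n^'n" where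
  "ehess f x = jacobian (egrad f) (at x)"

(* k times continuously differentiable; meant for open S *)
primrec cont_diff_on :: "nat \<Rightarrow> (real^'n::finite \<Rightarrow> real) \<Rightarrow> (real^'n) set \<Rightarrow> bool" where
  "cont_diff_on 0 h S \<longleftrightarrow> continuous_on S h"
| "cont_diff_on (Suc k) h S \<longleftrightarrow>
     (\<forall>x\<in>S. h differentiable (at x)) \<and> (\<forall>j. cont_diff_on k (partial_deriv j h) S)"

definition ediff_at :: "(real^'n::finite \<Rightarrow> ereal) \<Rightarrow> real^'n \<Rightarrow> bool" where
  "ediff_at g x \<longleftrightarrow>
     x \<in> interior (edom g) \<and> (\<lambda>y. real_of_ereal (g y)) differentiable (at x)"

definition standard_self_concordant :: "(real^'n::finite \<Rightarrow> ereal) \<Rightarrow> bool" where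
  "standard_self_concordant f \<longleftrightarrow>
     closed_convex_fun UNIV f \<and> open (edom f) \<and>
     cont_diff_on 3 (\<lambda>y. real_of_ereal (f y)) (edom f) \<and>
     (\<forall>x\<in>edom f. \<forall>u.
        let \<psi> = (\<lambda>t::real. real_of_ereal (f (x + t *\<^sub>R u)))
        in \<bar>(deriv ^^ 3) \<psi> 0\<bar> \<le> 2 * ((deriv ^^ 2) \<psi> 0) powr (3/2))"

definition pos_def_matrix :: "real^'n^'n::finite \<Rightarrow> bool" where
  "pos_def_matrix A \<longleftrightarrow> transpose A = A \<and> (\<forall>v. v \<noteq> 0 \<longrightarrow> 0 < v \<bullet> (A *v v))"

definition pos_semidef_matrix :: "real^'n^'n::finite \<Rightarrow> bool" where
  "pos_semidef_matrix A \<longleftrightarrow> transpose A = A \<and> (\<forall>v. 0 \<le> v \<bullet> (A *v v))"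

definition matrix_sqrt :: "real^'n^'n::finite \<Rightarrow> real^'n^'n" where
  "matrix_sqrt A = (THE B. pos_semidef_matrix B \<and> B ** B = A)"

definition spectral_norm :: "real^'n^'n::finite \<Rightarrow> real" where
  "spectral_norm A = onorm (\<lambda>v. A *v v)"

definition min_eigenvalue :: "real^'n^'n::finite \<Rightarrow> real" where
  "min_eigenvalue A = Min {l. \<exists>v. v \<noteq> 0 \<and> A *v v = l *\<^sub>R v}"

(* A partition of the coordinates is a map blk from coordinates to block labels. The i-th
   subvector of x is represented in R^N itself, by setting all coordinates outside block i to 0;
   thus R^(N_i) is the coordinate subspace block_space blk i. Submatrices are padded likewise. *)

definition block_space :: "('n::finite \<Rightarrow> 'b) \<Rightarrow> 'b \<Rightarrow> (real^'n) set" where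
  "block_space blk i = {x. \<forall>j. blk j \<noteq> i \<longrightarrow> x $ j = 0}"

definition block_vec :: "('n::finite \<Rightarrow> 'b) \<Rightarrow> 'b \<Rightarrow> real^'n \<Rightarrow> real^'n" where
  "block_vec blk i x = (\<chi> j. if blk j = i then x $ j else 0)"

definition block_mat :: "('n::finite \<Rightarrow> 'b) \<Rightarrow> 'b \<Rightarrow> real^'n^'n \<Rightarrow> real^'n^'n" where
  "block_mat blk i A = (\<chi> j k. if blk j = i \<and> blk k = i then A $ j $ k else 0)"

(* inverse of the (i,i) submatrix of A; block_mat blk i (mat 1) is the identity matrix of block i *)
definition block_inv :: "('n::finite \<Rightarrow> 'b) \<Rightarrow> 'b \<Rightarrow> real^'n^'n \<Rightarrow> real^'n^'n" where
  "block_inv blk i A = (THE B. block_mat blk i B = B \<and>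
      block_mat blk i A ** B = block_mat blk i (mat 1) \<and>
      B ** block_mat blk i A = block_mat blk i (mat 1))"

definition block_diag :: "('n::finite \<Rightarrow> 'b) \<Rightarrow> real^'n^'n \<Rightarrow> real^'n^'n" where
  "block_diag blk A = (\<chi> j k. if blk j = blk k then A $ j $ k else 0)"

definition block_norm ::
  "('n::finite \<Rightarrow> 'b) \<Rightarrow> (real^'n \<Rightarrow> ereal) \<Rightarrow> real^'n \<Rightarrow> 'b \<Rightarrow> real^'n \<Rightarrow> real" where
  "block_norm blk f x i y = sqrt (y \<bullet> (block_mat blk i (ehess f x) *v y))"

definition block_dual_norm ::
  "('n::finite \<Rightarrow> 'b) \<Rightarrow> (real^'n \<Rightarrow> ereal) \<Rightarrow> real^'n \<Rightarrow> 'b \<Rightarrow> real^'n \<Rightarrow> real" where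
  "block_dual_norm blk f x i z = sqrt (z \<bullet> (block_inv blk i (ehess f x) *v z))"

(* convex subdifferential at y of a proper function h on the linear subspace V *)
definition subdiff :: "(real^'n::finite) set \<Rightarrow> (real^'n \<Rightarrow> ereal) \<Rightarrow> real^'n \<Rightarrow> (real^'n) set" where
  "subdiff V h y = {s \<in> V. \<forall>z\<in>V. h y + ereal (s \<bullet> (z - y)) \<le> h z}"

definition separable ::
  "('n::finite \<Rightarrow> 'b::finite) \<Rightarrow> ('b \<Rightarrow> real^'n \<Rightarrow> ereal) \<Rightarrow> real^'n \<Rightarrow> ereal" where
  "separable blk g x = (\<Sum>i\<in>UNIV. g i (block_vec blk i x))"

definition approx_block_solution ::
  "('n::finite \<Rightarrow> 'b) \<Rightarrow> (real^'n \<Rightarrow> ereal) \<Rightarrow> ('b \<Rightarrow> real^'n \<Rightarrow> ereal) \<Rightarrow> real \<Rightarrow>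
   'b \<Rightarrow> real^'n \<Rightarrow> real^'n \<Rightarrow> bool" where
  "approx_block_solution blk f g \<eta> i x d \<longleftrightarrow>
     d \<in> block_space blk i \<and>
     (\<exists>v\<in>block_space blk i.
        (\<exists>s\<in>subdiff (block_space blk i) (g i) (block_vec blk i x + d).
           - v = block_vec blk i (egrad f x) + block_mat blk i (ehess f x) *v d + s) \<and>
        block_dual_norm blk f x i v \<le> \<eta> * block_norm blk f x i d)"

(* js k is the block chosen at iteration k *)
primrec rbpdn_iterate ::
  "('n::finite \<Rightarrow> 'b) \<Rightarrow> (real^'n \<Rightarrow> ereal) \<Rightarrow> ('b \<Rightarrow> real^'n \<Rightarrow> real^'n) \<Rightarrow> real^'n \<Rightarrow>
   (nat \<Rightarrow> 'b) \<Rightarrow> nat \<Rightarrow> real^'n" where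
  "rbpdn_iterate blk f d x0 js 0 = x0"
| "rbpdn_iterate blk f d x0 js (Suc k) =
     (let x = rbpdn_iterate blk f d x0 js k; i = js k
      in x + (1 / (1 + block_norm blk f x i (d i x))) *\<^sub>R d i x)"

(* In the next three definitions S stands for the initial sublevel set, which is compact under
   the standing assumptions, so that the infimum and the suprema are attained. *)

definition sigma_const :: "(real^'n::finite \<Rightarrow> ereal) \<Rightarrow> (real^'n) set \<Rightarrow> real" where
  "sigma_const f S = (INF x\<in>S. min_eigenvalue (ehess f x))"

definition L_const :: "(real^'n::finite \<Rightarrow> ereal) \<Rightarrow> (real^'n) set \<Rightarrow> real" where
  "L_const f S = (SUP x\<in>S. spectral_norm (ehess f x))"

definition c1_const ::
  "('n::finite \<Rightarrow> 'b::finite) \<Rightarrow> (real^'n \<Rightarrow> ereal) \<Rightarrow> real \<Rightarrow> (real^'n) set \<Rightarrow> real" where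
  "c1_const blk f \<eta> S = (1 - \<eta>) /
     (sqrt (real CARD('b)) *
      (SUP x\<in>S. let A = ehess f x; H = block_diag blk A in
         (1 + \<eta>) * spectral_norm (matrix_sqrt H ** matrix_inv (matrix_sqrt A)) +
         spectral_norm (matrix_inv (matrix_sqrt H) ** matrix_sqrt A)))"

definition omega_star :: "real \<Rightarrow> real" where
  "omega_star t = - t - ln (1 - t)"

definition omega_star_inv :: "real \<Rightarrow> real" where
  "omega_star_inv = inv_into {0..<1} omega_star"

end

theory Submission
  imports Defs
begin

text \<open>
  Write \<open>\<delta>(x) = F(x) - F(xstar)\<close>, let \<open>A\<close> be the Hessian of \<open>f\<close> at a point \<open>x\<close> of the initial
  sublevel set \<open>S\<close>, \<open>H\<close> its block diagonal, \<open>\<lambda>_i\<close> the local norm of the \<open>i\<close>-th direction \<open>d_i\<close>,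
  \<open>d\<close> the sum of the \<open>d_i\<close>, and \<open>K\<close> the supremum in the denominator of \<open>c1\<close>, so that
  \<open>c4 = \<sigma> / (K (L + Lg))\<close> with \<open>\<sigma>\<close> and \<open>L\<close> the extreme curvatures of \<open>f\<close> on \<open>S\<close>.

  Decrease. Along \<open>d_i\<close>, self-concordance bounds the second derivative of \<open>f\<close> by
  \<open>\<lambda>_i^2 / (1 - t \<lambda>_i)^2\<close>, so a step of length \<open>1 / (1 + \<lambda>_i)\<close> stays in the domain and, together
  with the subgradient inequality for \<open>g_i\<close> and \<open>\<eta> \<le> 1/4\<close>, decreases \<open>F\<close> by at least
  \<open>\<lambda>_i^2 / (4 (1 + \<lambda>_i))\<close> (\<open>self_concordant_damped_step\<close>, \<open>step_decrease\<close>). As \<open>t^2 / (1 + t)\<close> is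
  convex and increasing, the expected decrease is at least \<open>z^2 / (4 (1 + z))\<close> for every
  nonnegative \<open>z\<close> below \<open>pmin\<close> times the sum of the \<open>\<lambda>_i\<close>.

  Error bound. It remains to bound that sum from below by \<open>c4 omega_star_inv(\<delta>(x))\<close>. The point
  \<open>x + d\<close> may lie outside \<open>S\<close>, where nothing is known about differentiability of \<open>g\<close>. Therefore
  \<open>x\<close> is compared directly with the minimiser: let \<open>e = xstar - x\<close> and let \<open>r\<close> be the
  increment of the gradient of \<open>f\<close> from \<open>x\<close> to \<open>xstar\<close>. Monotonicity of the subdifferential of
  \<open>g\<close> between \<open>x + d\<close> and \<open>xstar\<close> bounds \<open>r \<bullet> e\<close> by \<open>r \<bullet> d\<close> plus terms
  \<open>(1 + \<eta>) \<lambda>_i\<close> times the \<open>i\<close>-th local norm of \<open>e\<close> (\<open>monotonicity_inequality\<close>). The segment from \<open>x\<close>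
  to \<open>xstar\<close> lies in \<open>S\<close>, hence \<open>\<sigma> |e|^2 \<le> r \<bullet> e\<close> and \<open>|r|^2 \<le> L (r \<bullet> e)\<close>; both summands on
  the right are then controlled by \<open>sqrt (r \<bullet> e)\<close>, the two spectral norms in \<open>K\<close> entering
  through changes between the norms of \<open>A\<close> and \<open>H\<close>. The outcome is
  \<open>\<sigma> |e| \<le> K sqrt L (\<Sum>i. \<lambda>_i)\<close> (\<open>distance_le_decrements\<close>). On the other side \<open>F\<close> has an
  \<open>(L + Lg)\<close>-Lipschitz gradient along that segment, vanishing at \<open>xstar\<close>, so
  \<open>\<delta>(x) \<le> (L + Lg) |e|^2 / 2\<close> (\<open>F_gap_le_quadratic\<close>), and \<open>t^2 / 2 \<le> omega_star t\<close> turns this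
  into \<open>omega_star_inv(\<delta>(x)) \<le> sqrt (L + Lg) |e|\<close>. The two estimates combine because
  \<open>L \<le> L + Lg\<close> (\<open>gap_inverse_le_decrements\<close>).

  Rate. With \<open>t = omega_star_inv(\<delta>(x))\<close> and \<open>z = pmin c4 t\<close> the upper bound
  \<open>omega_star t \<le> t^2 / (2 (1 - t))\<close> shows that the expected decrease is at least a fixed
  multiple of \<open>\<delta>(x)\<close>; since \<open>t\<close> only shrinks along the iteration, the multiple may be evaluated
  at \<open>x0\<close> (\<open>expected_step_contraction\<close>). Independence of the choices lets these factors multiply
  (\<open>expectation_eq_expected_gap\<close>, \<open>expected_gap_le\<close>).

  The constants make sense because \<open>S\<close> is compact: \<open>F\<close> is lower semicontinuous and convex with a
  unique minimiser, hence grows at least linearly away from it (\<open>S_compact\<close>).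
\<close>

section \<open>Symmetric matrices and their square roots\<close>

lemma symmetric_inner:
  fixes A :: "real^'n^'n::finite"
  assumes "transpose A = A"
  shows "(A *v x) \<bullet> y = x \<bullet> (A *v y)"
  by (metis assms dot_lmul_matrix transpose_matrix_vector)

lemma inner_transpose:
  fixes A :: "real^'n^'n::finite"
  shows "(transpose A *v x) \<bullet> y = x \<bullet> (A *v y)"
  by (simp add: dot_lmul_matrix)

lemma symmetricI:
  fixes A :: "real^'n^'n::finite"
  assumes "\<And>x y. (A *v x) \<bullet> y = x \<bullet> (A *v y)"
  shows "transpose A = A"
proof -
  have "(transpose A *v x) \<bullet> y = (A *v x) \<bullet> y" for x y
    using assms by (simp add: dot_lmul_matrix)
  then show ?thesis
    by (metis matrix_eq vector_eq_rdot)
qed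

text \<open>A first-order condition: a nonnegative quadratic that vanishes at \<open>0\<close> has no linear term.\<close>

lemma quadratic_nonneg_imp_linear_zero:
  fixes b c :: real
  assumes "\<And>t. 0 \<le> 2 * t * b + t\<^sup>2 * c"
  shows "b = 0"
proof (rule ccontr)
  assume b: "b \<noteq> 0"
  define C where "C = \<bar>c\<bar> + 1"
  have "C > 0" by (simp add: C_def add_nonneg_pos)
  (* with C in place of c the minimum would be at - b / C *)
  have "0 \<le> 2 * (- b / C) * b + (- b / C)\<^sup>2 * c" using assms by blast
  also have "\<dots> \<le> 2 * (- b / C) * b + (- b / C)\<^sup>2 * C"
    by (intro add_left_mono mult_left_mono) (auto simp: C_def)
  also have "\<dots> = - (b\<^sup>2 / C)"
    using \<open>C > 0\<close> by (simp add: field_simps power2_eq_square)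
  finally show False using b \<open>C > 0\<close>
    by (smt (verit) divide_pos_pos zero_less_power2)
qed

text \<open>A minimiser of the Rayleigh quotient over an invariant subspace is an eigenvector: the first
  variation of \<open>w \<bullet> A w - l |w|^2\<close> at the minimiser, in the direction of its own residual
  \<open>A v - l v\<close>, is twice the squared norm of that residual. The restriction to a subspace is what
  allows eigenvectors to be split off one after another.\<close>

lemma rayleigh_minimum:
  fixes A :: "real^'n^'n::finite"
  assumes sym: "transpose A = A" and V: "subspace V" "V \<noteq> {0}"
    and inv: "\<And>v. v \<in> V \<Longrightarrow> A *v v \<in> V"
  obtains v l where "v \<in> V" "norm v = 1" "A *v v = l *\<^sub>R v"
    "\<And>w. w \<in> V \<Longrightarrow> l * (norm w)\<^sup>2 \<le> w \<bullet> (A *v w)"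
proof -
  let ?K = "V \<inter> sphere 0 1"
  have "closed V" using V(1) by (rule closed_subspace)
  then have comp: "compact ?K" by (intro closed_Int_compact) auto
  obtain u where u: "u \<in> V" "u \<noteq> 0" using V subspace_0 by blast
  then have "(1 / norm u) *\<^sub>R u \<in> ?K" using V(1) by (auto simp: subspace_scale)
  then have ne: "?K \<noteq> {}" by blast
  have "continuous_on ?K (\<lambda>v. v \<bullet> (A *v v))"
    by (intro continuous_intros linear_continuous_on) auto
  from continuous_attains_inf[OF comp ne this] obtain v where
    v: "v \<in> ?K" and min: "\<And>w. w \<in> ?K \<Longrightarrow> v \<bullet> (A *v v) \<le> w \<bullet> (A *v w)" by blast
  define l where "l = v \<bullet> (A *v v)"
  have ray: "l * (norm w)\<^sup>2 \<le> w \<bullet> (A *v w)" if "w \<in> V" for w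
  proof (cases "w = 0")
    case False
    have "(1 / norm w) *\<^sub>R w \<in> ?K" using that V(1) False by (auto simp: subspace_scale)
    from min[OF this] have "l \<le> (w \<bullet> (A *v w)) / (norm w)\<^sup>2"
      by (simp add: l_def matrix_vector_mult_scaleR power2_eq_square)
    then show ?thesis using False by (simp add: pos_le_divide_eq)
  qed simp
  have vv: "v \<in> V" "norm v = 1" "v \<bullet> v = 1" using v by (auto simp: dot_square_norm)
  define z where "z = A *v v - l *\<^sub>R v"
  have zV: "z \<in> V" unfolding z_def using vv inv V(1) by (simp add: subspace_diff subspace_scale)
  have "0 \<le> 2 * t * (z \<bullet> z) + t\<^sup>2 * (z \<bullet> (A *v z) - l * (z \<bullet> z))" for t
  proof -
    have "v + t *\<^sub>R z \<in> V" using vv zV V(1) by (simp add: subspace_add subspace_scale)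
    from ray[OF this]
    have "l * ((v + t *\<^sub>R z) \<bullet> (v + t *\<^sub>R z)) \<le> (v + t *\<^sub>R z) \<bullet> (A *v (v + t *\<^sub>R z))"
      by (simp add: dot_square_norm)
    moreover have "v \<bullet> (A *v z) = z \<bullet> (A *v v)"
      using symmetric_inner[OF sym, of v z] by (simp add: inner_commute)
    moreover have "z \<bullet> (A *v v) = z \<bullet> z + l * (z \<bullet> v)"
      by (simp add: z_def inner_diff_left inner_diff_right algebra_simps)
    ultimately show ?thesis
      by (simp add: inner_add_left inner_add_right matrix_vector_mult_scaleR algebra_simps
          power2_eq_square vv l_def[symmetric] inner_commute[of z v]
          matrix_vector_right_distrib)
  qed
  from quadratic_nonneg_imp_linear_zero[OF this] have "z = 0" by simp
  then have "A *v v = l *\<^sub>R v" by (simp add: z_def)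
  then show thesis using that vv ray by blast
qed

text \<open>The spectral theorem. An orthonormal set of eigenvectors of maximal size spans the space,
  since its orthogonal complement is invariant and would otherwise contain one more eigenvector.\<close>

lemma symmetric_eigenbasis:
  fixes A :: "real^'n^'n::finite"
  assumes sym: "transpose A = A"
  obtains B where "finite B" "pairwise orthogonal B" "\<And>b. b \<in> B \<Longrightarrow> norm b = 1"
    "span B = UNIV" "\<And>b. b \<in> B \<Longrightarrow> \<exists>l. A *v b = l *\<^sub>R b"
proof -
  define P where "P B \<longleftrightarrow> finite B \<and> pairwise orthogonal B \<and>
    (\<forall>b\<in>B. norm b = 1 \<and> (\<exists>l. A *v b = l *\<^sub>R b))" for B :: "(real^'n) set"
  have card: "card B \<le> CARD('n)" if "P B" for B
  proof -
    have "0 \<notin> B" using that by (auto simp: P_def)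
    then have "independent B" using that pairwise_orthogonal_independent by (auto simp: P_def)
    from independent_bound[OF this] show ?thesis by simp
  qed
  have "P {}" by (simp add: P_def pairwise_def)
  then obtain B where B: "P B" and max: "\<And>B'. P B' \<Longrightarrow> card B' \<le> card B"
    using ex_has_greatest_nat[of P "{}" card "CARD('n) + 1"] card by force
  define V where "V = {x. \<forall>b\<in>B. orthogonal x b}"
  have V: "subspace V"
    unfolding V_def subspace_def by (auto simp: orthogonal_def inner_add_left)
  have inv: "A *v v \<in> V" if "v \<in> V" for v
  proof -
    have "orthogonal (A *v v) b" if b: "b \<in> B" for b
    proof -
      obtain l where "A *v b = l *\<^sub>R b" using B b by (auto simp: P_def)
      then show ?thesis using \<open>v \<in> V\<close> b symmetric_inner[OF sym, of v b]
        by (simp add: V_def orthogonal_def)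
    qed
    then show ?thesis by (simp add: V_def)
  qed
  have "V = {0}"
  proof (rule ccontr)
    assume "V \<noteq> {0}"
    then obtain v l where v: "v \<in> V" "norm v = 1" "A *v v = l *\<^sub>R v"
      using rayleigh_minimum[OF sym V _ inv] by metis
    have "v \<notin> B" using v by (auto simp: V_def orthogonal_self)
    moreover have "P (insert v B)" using B v
      by (auto simp: P_def V_def pairwise_insert orthogonal_commute)
    ultimately show False using max[of "insert v B"] B by (simp add: P_def)
  qed
  have "x \<in> span B" for x
  proof -
    obtain y z where yz: "y \<in> span B" "\<And>w. w \<in> span B \<Longrightarrow> orthogonal z w" "x = y + z"
      using orthogonal_subspace_decomp_exists[of B x] by blast
    then have "z \<in> V" by (auto simp: V_def span_base)
    then show ?thesis using \<open>V = {0}\<close> yz by simp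
  qed
  then show thesis using that[of B] B by (auto simp: P_def)
qed

lemma matrix_eqI_on_spanning_set:
  fixes A A' :: "real^'n^'n::finite"
  assumes "span B = UNIV" "\<And>b. b \<in> B \<Longrightarrow> A *v b = A' *v b"
  shows "A = A'"
proof -
  have "A *v x = A' *v x" for x
    by (rule linear_eq_on_span[of "(*v) A" "(*v) A'" B]) (use assms in auto)
  then show ?thesis by (simp add: matrix_eq)
qed

lemma pos_def_imp_semidef: "pos_def_matrix A \<Longrightarrow> pos_semidef_matrix A"
  unfolding pos_def_matrix_def pos_semidef_matrix_def
  by (metis inner_zero_left less_eq_real_def)

lemma psd_sqrt_exists:
  fixes A :: "real^'n^'n::finite"
  assumes "pos_semidef_matrix A"
  obtains R where "pos_semidef_matrix R" "R ** R = A"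
proof -
  have sym: "transpose A = A" and psd: "\<And>v. 0 \<le> v \<bullet> (A *v v)"
    using assms by (auto simp: pos_semidef_matrix_def)
  obtain B where B: "finite B" "pairwise orthogonal B" "\<And>b. b \<in> B \<Longrightarrow> norm b = 1"
    "span B = UNIV" "\<And>b. b \<in> B \<Longrightarrow> \<exists>l. A *v b = l *\<^sub>R b"
    using symmetric_eigenbasis[OF sym] by blast
  obtain l where l: "\<And>b. b \<in> B \<Longrightarrow> A *v b = l b *\<^sub>R b" using B(5) by metis
  have l0: "l b \<ge> 0" if "b \<in> B" for b
    using psd[of b] l[OF that] B(3)[OF that] by (simp add: dot_square_norm)
  define h where "h x = (\<Sum>b\<in>B. (sqrt (l b) * (x \<bullet> b)) *\<^sub>R b)" for x :: "real^'n"
  have lin: "linear h" unfolding h_def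
    by (intro linearI) (simp_all add: inner_add_left algebra_simps sum.distrib scaleR_sum_right)
  define R where "R = matrix h"
  have R: "R *v x = h x" for x unfolding R_def using lin by (simp add: matrix_works)
  have hb: "h b = sqrt (l b) *\<^sub>R b" if "b \<in> B" for b
  proof -
    have "(sqrt (l c) * (b \<bullet> c)) *\<^sub>R c = (if c = b then sqrt (l b) *\<^sub>R b else 0)" if "c \<in> B" for c
      using B(2,3) that \<open>b \<in> B\<close> by (auto simp: dot_square_norm pairwise_def orthogonal_def)
    then show ?thesis unfolding h_def using B(1) that by (simp add: sum.delta cong: sum.cong)
  qed
  have sp: "x \<bullet> h y = (\<Sum>b\<in>B. sqrt (l b) * (x \<bullet> b) * (y \<bullet> b))" for x y
    by (simp add: h_def inner_sum_right mult_ac)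
  have "pos_semidef_matrix R" unfolding pos_semidef_matrix_def
  proof (intro conjI allI)
    show "transpose R = R" by (rule symmetricI) (simp add: R sp inner_commute[of "h _"] mult_ac)
    show "0 \<le> v \<bullet> (R *v v)" for v
      unfolding R sp using l0 by (intro sum_nonneg) (simp add: mult.assoc)
  qed
  moreover have "R ** R = A"
  proof (rule matrix_eqI_on_spanning_set[OF B(4)])
    fix b assume "b \<in> B"
    then show "(R ** R) *v b = A *v b"
      using l0 by (simp add: matrix_vector_mul_assoc[symmetric] R hb linear_scale[OF lin] l)
  qed
  ultimately show thesis using that by blast
qed

text \<open>In an eigenbasis of \<open>R\<close>, the equation \<open>R' (R' b) = l^2 b\<close> forces \<open>R' b = l b\<close> because \<open>R'\<close> has
  no negative eigenvalue.\<close>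

lemma psd_sqrt_unique:
  fixes R R' :: "real^'n^'n::finite"
  assumes R: "pos_semidef_matrix R" and R': "pos_semidef_matrix R'" and eq: "R ** R = R' ** R'"
  shows "R = R'"
proof -
  have sym: "transpose R = R" and psd: "\<And>v. 0 \<le> v \<bullet> (R *v v)"
    using R by (auto simp: pos_semidef_matrix_def)
  have sym': "transpose R' = R'" and psd': "\<And>v. 0 \<le> v \<bullet> (R' *v v)"
    using R' by (auto simp: pos_semidef_matrix_def)
  obtain B where B: "span B = UNIV" "\<And>b. b \<in> B \<Longrightarrow> norm b = 1" "\<And>b. b \<in> B \<Longrightarrow> \<exists>l. R *v b = l *\<^sub>R b"
    using symmetric_eigenbasis[OF sym] by metis
  show ?thesis
  proof (rule matrix_eqI_on_spanning_set[OF B(1)])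
    fix b assume b: "b \<in> B"
    obtain l where l: "R *v b = l *\<^sub>R b" using B(3)[OF b] by blast
    have l0: "l \<ge> 0" using psd[of b] l B(2)[OF b] by (simp add: dot_square_norm)
    have sq: "R' *v (R' *v b) = (l * l) *\<^sub>R b"
      using eq l by (metis matrix_vector_mul_assoc matrix_vector_mult_scaleR scaleR_scaleR)
    define z where "z = R' *v b - l *\<^sub>R b"
    have "z = 0"
    proof (cases "l = 0")
      case True
      have "(R' *v b) \<bullet> (R' *v b) = b \<bullet> (R' *v (R' *v b))" using symmetric_inner[OF sym'] by blast
      then show ?thesis using sq True by (simp add: z_def)
    next
      case False
      (* (R' + l) (R' - l) b = 0, and R' + l is positive definite *)
      have "R' *v z = - l *\<^sub>R z"
        by (simp add: z_def matrix_vector_mult_diff_distrib sq matrix_vector_mult_scaleR algebra_simps)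
      then have "0 \<le> - (l * (z \<bullet> z))" using psd'[of z] by simp
      moreover have "0 \<le> z \<bullet> z" by simp
      ultimately have "z \<bullet> z = 0" using False l0
        by (smt (verit, best) mult_pos_pos)
      then show ?thesis by simp
    qed
    then show "R *v b = R' *v b" using l by (simp add: z_def)
  qed
qed

lemma matrix_sqrt_works:
  fixes A :: "real^'n^'n::finite"
  assumes "pos_semidef_matrix A"
  shows "pos_semidef_matrix (matrix_sqrt A)" "matrix_sqrt A ** matrix_sqrt A = A"
proof -
  have "\<exists>!R. pos_semidef_matrix R \<and> R ** R = A"
    using psd_sqrt_exists[OF assms] psd_sqrt_unique by metis
  from theI'[OF this] show "pos_semidef_matrix (matrix_sqrt A)" "matrix_sqrt A ** matrix_sqrt A = A"
    unfolding matrix_sqrt_def by auto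
qed

lemma norm_matrix_sqrt:
  fixes A :: "real^'n^'n::finite"
  assumes "pos_semidef_matrix A"
  shows "(norm (matrix_sqrt A *v x))\<^sup>2 = x \<bullet> (A *v x)"
proof -
  have "transpose (matrix_sqrt A) = matrix_sqrt A"
    using matrix_sqrt_works(1)[OF assms] by (simp add: pos_semidef_matrix_def)
  from symmetric_inner[OF this, of x "matrix_sqrt A *v x"]
  show ?thesis by (simp add: dot_square_norm[symmetric] matrix_vector_mul_assoc matrix_sqrt_works(2)[OF assms])
qed

lemma invertible_if_kernel_trivial:
  fixes A :: "real^'n^'n::finite"
  assumes "\<And>x. A *v x = 0 \<Longrightarrow> x = 0"
  shows "invertible A"
  unfolding invertible_left_inverse matrix_left_invertible_ker using assms by blast

lemma matrix_inv_cancel: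
  fixes A :: "real^'n^'n::finite"
  assumes "invertible A"
  shows "A *v (matrix_inv A *v x) = x" "matrix_inv A *v (A *v x) = x"
  using assms unfolding matrix_vector_mul_assoc invertible_def matrix_inv_def
  by (metis (mono_tags, lifting) matrix_vector_mul_lid someI_ex)+

lemma invertible_matrix_sqrt:
  fixes A :: "real^'n^'n::finite"
  assumes "pos_def_matrix A"
  shows "invertible (matrix_sqrt A)"
proof (rule invertible_if_kernel_trivial)
  fix x assume "matrix_sqrt A *v x = 0"
  then have "x \<bullet> (A *v x) = 0"
    using norm_matrix_sqrt[OF pos_def_imp_semidef[OF assms], of x] by simp
  then show "x = 0" using assms unfolding pos_def_matrix_def by force
qed

text \<open>The ordinary inequality, applied to the images under the square root of \<open>A\<close>.\<close>

lemma psd_Cauchy_Schwarz: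
  fixes A :: "real^'n^'n::finite"
  assumes "pos_semidef_matrix A"
  shows "x \<bullet> (A *v y) \<le> sqrt (x \<bullet> (A *v x)) * sqrt (y \<bullet> (A *v y))"
proof -
  let ?R = "matrix_sqrt A"
  have "transpose ?R = ?R"
    using matrix_sqrt_works(1)[OF assms] by (simp add: pos_semidef_matrix_def)
  from symmetric_inner[OF this, of x "?R *v y"]
  have "x \<bullet> (A *v y) = (?R *v x) \<bullet> (?R *v y)"
    by (simp add: matrix_vector_mul_assoc matrix_sqrt_works(2)[OF assms])
  also have "\<dots> \<le> norm (?R *v x) * norm (?R *v y)" by (rule norm_cauchy_schwarz)
  finally have "x \<bullet> (A *v y) \<le> norm (?R *v x) * norm (?R *v y)" .
  moreover have "norm (?R *v z) = sqrt (z \<bullet> (A *v z))" for z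
    using norm_matrix_sqrt[OF assms, of z] by (metis norm_ge_zero real_sqrt_unique)
  ultimately show ?thesis by simp
qed

text \<open>\<open>min_eigenvalue\<close> is a minimum over the set of eigenvalues, which has to be shown finite and
  nonempty; the Rayleigh minimum over the whole space supplies an eigenvalue below all
  Rayleigh quotients.\<close>

lemma min_eigenvalue_le:
  fixes A :: "real^'n^'n::finite"
  assumes sym: "transpose A = A"
  shows "min_eigenvalue A * (norm x)\<^sup>2 \<le> x \<bullet> (A *v x)"
    and min_eigenvalue_attained: "\<exists>v. v \<noteq> 0 \<and> A *v v = min_eigenvalue A *\<^sub>R v"
proof -
  let ?E = "{l. \<exists>v. v \<noteq> 0 \<and> A *v v = l *\<^sub>R v}"
  obtain B where B: "finite B" "span B = UNIV" "\<And>b. b \<in> B \<Longrightarrow> \<exists>l. A *v b = l *\<^sub>R b" "0 \<notin> B"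
    using symmetric_eigenbasis[OF sym] by (metis norm_zero zero_neq_one)
  obtain m where m: "\<And>b. b \<in> B \<Longrightarrow> A *v b = m b *\<^sub>R b" using B(3) by metis
  (* an eigenvector v has a nonzero component along some b, and then their eigenvalues agree *)
  have "?E \<subseteq> m ` B"
  proof
    fix l assume "l \<in> ?E"
    then obtain v where v: "v \<noteq> 0" "A *v v = l *\<^sub>R v" by blast
    have "\<exists>b\<in>B. v \<bullet> b \<noteq> 0"
    proof (rule ccontr)
      assume "\<not> ?thesis"
      then have "orthogonal v b" if "b \<in> B" for b using that by (simp add: orthogonal_def)
      then have "orthogonal v v" using orthogonal_to_span[of v B] B(2)
        by (metis UNIV_I)
      then show False using v by (simp add: orthogonal_self)
    qed
    then obtain b where b: "b \<in> B" "v \<bullet> b \<noteq> 0" by blast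
    have "l * (v \<bullet> b) = m b * (v \<bullet> b)"
      using symmetric_inner[OF sym, of v b] v m[OF b(1)] by simp
    then show "l \<in> m ` B" using b by auto
  qed
  then have fin: "finite ?E" using B(1) finite_surj by blast
  have "(UNIV :: (real^'n) set) \<noteq> {0}"
    using UNIV_not_singleton by blast
  then obtain v l where vl: "norm v = 1" "A *v v = l *\<^sub>R v"
    "\<And>w. l * (norm w)\<^sup>2 \<le> w \<bullet> (A *v w)"
    using rayleigh_minimum[OF sym subspace_UNIV] by (metis UNIV_I)
  then have lE: "l \<in> ?E" by (auto intro!: exI[of _ v])
  then have "min_eigenvalue A \<le> l" unfolding min_eigenvalue_def using fin by (rule Min_le[rotated])
  then show "min_eigenvalue A * (norm x)\<^sup>2 \<le> x \<bullet> (A *v x)"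
    using vl(3)[of x] by (meson mult_right_mono order_trans zero_le_power2)
  have "min_eigenvalue A \<in> ?E" unfolding min_eigenvalue_def using fin lE by (intro Min_in) auto
  then show "\<exists>v. v \<noteq> 0 \<and> A *v v = min_eigenvalue A *\<^sub>R v" by blast
qed

lemma min_eigenvalue_nonneg:
  assumes "pos_semidef_matrix A"
  shows "0 \<le> min_eigenvalue A"
proof -
  obtain v where v: "v \<noteq> 0" "A *v v = min_eigenvalue A *\<^sub>R v"
    using min_eigenvalue_attained assms unfolding pos_semidef_matrix_def by blast
  have "0 \<le> min_eigenvalue A * (v \<bullet> v)" using assms v unfolding pos_semidef_matrix_def
    by (metis inner_scaleR_right)
  moreover have "0 < v \<bullet> v" using v by simp
  ultimately show ?thesis by (simp only: zero_le_mult_iff) linarith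
qed

lemma spectral_norm_bound: "norm (A *v x) \<le> spectral_norm A * norm (x :: real^'n::finite)"
  unfolding spectral_norm_def by (rule onorm) simp

lemma spectral_norm_nonneg: "0 \<le> spectral_norm A"
  unfolding spectral_norm_def by (rule onorm_pos_le) simp

lemma spectral_norm_leI:
  fixes A :: "real^'n^'n::finite"
  assumes "\<And>x. norm (A *v x) \<le> c * norm x"
  shows "spectral_norm A \<le> c"
  unfolding spectral_norm_def using assms by (rule onorm_le)

text \<open>A matrix and its transpose have the same spectral norm. Only this direction is stated, as it
  can be applied to the transpose again.\<close>

lemma spectral_norm_transpose_bound:
  fixes A :: "real^'n^'n::finite"
  shows "norm (transpose A *v x) \<le> spectral_norm A * norm x"
proof (cases "transpose A *v x = 0")
  case False
  have "(norm (transpose A *v x))\<^sup>2 = (transpose A *v x) \<bullet> (transpose A *v x)"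
    by (simp only: dot_square_norm)
  also have "\<dots> = x \<bullet> (A *v (transpose A *v x))"
    by (rule inner_transpose)
  also have "\<dots> \<le> norm x * norm (A *v (transpose A *v x))"
    by (rule norm_cauchy_schwarz)
  also have "\<dots> \<le> norm x * (spectral_norm A * norm (transpose A *v x))"
    by (intro mult_left_mono spectral_norm_bound) auto
  finally have "norm (transpose A *v x) * norm (transpose A *v x)
      \<le> (spectral_norm A * norm x) * norm (transpose A *v x)"
    by (simp add: power2_eq_square mult_ac)
  then show ?thesis using False by (meson mult_right_le_imp_le zero_less_norm_iff)
qed (simp add: spectral_norm_nonneg)

lemma quadratic_form_le_spectral_norm:
  fixes A :: "real^'n^'n::finite"
  shows "x \<bullet> (A *v x) \<le> spectral_norm A * (norm x)\<^sup>2"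
proof -
  have "x \<bullet> (A *v x) \<le> norm x * norm (A *v x)" by (rule norm_cauchy_schwarz)
  also have "\<dots> \<le> norm x * (spectral_norm A * norm x)"
    by (intro mult_left_mono spectral_norm_bound) auto
  finally show ?thesis by (simp add: power2_eq_square mult_ac)
qed

text \<open>With \<open>norm_sqrt_le_via_inverse_quotient\<close> below, this is how the two spectral norms in the
  definition of \<open>c1_const\<close> are used: they are the costs of passing between the norms induced by
  \<open>A\<close> and by \<open>B\<close>.\<close>

lemma norm_sqrt_le_via_quotient:
  fixes A B :: "real^'n^'n::finite"
  assumes "pos_def_matrix A"
  shows "norm (matrix_sqrt B *v e) \<le>
    spectral_norm (matrix_sqrt B ** matrix_inv (matrix_sqrt A)) * norm (matrix_sqrt A *v e)"
  using spectral_norm_bound[of "matrix_sqrt B ** matrix_inv (matrix_sqrt A)" "matrix_sqrt A *v e"]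
  by (simp add: matrix_vector_mul_assoc[symmetric] matrix_inv_cancel[OF invertible_matrix_sqrt[OF assms]])

text \<open>The second norm in \<open>c1_const\<close> has the inverse on the left; its transpose is the quotient of
  square roots that maps the \<open>B\<close>-image of a vector to its \<open>A\<close>-image.\<close>

lemma transpose_sqrt_quotient:
  fixes A B :: "real^'n^'n::finite"
  assumes A: "pos_def_matrix A" and B: "pos_def_matrix B"
  shows "transpose (matrix_inv (matrix_sqrt B) ** matrix_sqrt A) *v (matrix_sqrt B *v d) = matrix_sqrt A *v d"
proof -
  have symA: "transpose (matrix_sqrt A) = matrix_sqrt A" and symB: "transpose (matrix_sqrt B) = matrix_sqrt B"
    using matrix_sqrt_works(1) A B pos_def_imp_semidef unfolding pos_semidef_matrix_def by blast+
  have "(transpose (matrix_inv (matrix_sqrt B) ** matrix_sqrt A) *v (matrix_sqrt B *v d)) \<bullet> w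
      = (matrix_sqrt A *v d) \<bullet> w" for w
    unfolding inner_transpose
    by (simp add: matrix_vector_mul_assoc[symmetric] symmetric_inner[OF symB] symmetric_inner[OF symA]
        matrix_inv_cancel[OF invertible_matrix_sqrt[OF B]])
  then show ?thesis by (intro vector_eq_rdot[THEN iffD1]) blast
qed

lemma norm_sqrt_le_via_inverse_quotient:
  fixes A B :: "real^'n^'n::finite"
  assumes "pos_def_matrix A" "pos_def_matrix B"
  shows "norm (matrix_sqrt A *v d) \<le>
    spectral_norm (matrix_inv (matrix_sqrt B) ** matrix_sqrt A) * norm (matrix_sqrt B *v d)"
  using spectral_norm_transpose_bound[of "matrix_inv (matrix_sqrt B) ** matrix_sqrt A" "matrix_sqrt B *v d"]
  by (simp only: transpose_sqrt_quotient[OF assms])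

lemma norm_sqrt_mono:
  fixes A B :: "real^'n^'n::finite"
  assumes "pos_semidef_matrix A" "pos_semidef_matrix B" "0 \<le> c" "x \<bullet> (B *v x) \<le> c\<^sup>2 * (x \<bullet> (A *v x))"
  shows "norm (matrix_sqrt B *v x) \<le> c * norm (matrix_sqrt A *v x)"
  by (rule power2_le_imp_le) (use assms in \<open>auto simp: power_mult_distrib norm_matrix_sqrt\<close>)

text \<open>Converse bounds on the two spectral norms from a comparison of quadratic forms. They are
  needed to see that the supremum in \<open>c1_const\<close> is taken over a bounded set.\<close>

lemma spectral_norm_sqrt_quotient_le:
  fixes A B :: "real^'n^'n::finite"
  assumes A: "pos_def_matrix A" and B: "pos_semidef_matrix B" and c: "0 \<le> c"
    and le: "\<And>x. x \<bullet> (B *v x) \<le> c\<^sup>2 * (x \<bullet> (A *v x))"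
  shows "spectral_norm (matrix_sqrt B ** matrix_inv (matrix_sqrt A)) \<le> c"
proof (rule spectral_norm_leI)
  fix w :: "real^'n"
  show "norm ((matrix_sqrt B ** matrix_inv (matrix_sqrt A)) *v w) \<le> c * norm w"
    using norm_sqrt_mono[OF pos_def_imp_semidef[OF A] B c le, of "matrix_inv (matrix_sqrt A) *v w"]
    by (simp add: matrix_vector_mul_assoc[symmetric] matrix_inv_cancel[OF invertible_matrix_sqrt[OF A]])
qed

lemma spectral_norm_inverse_sqrt_quotient_le:
  fixes A B :: "real^'n^'n::finite"
  assumes A: "pos_def_matrix A" and B: "pos_def_matrix B" and c: "0 \<le> c"
    and le: "\<And>x. x \<bullet> (A *v x) \<le> c\<^sup>2 * (x \<bullet> (B *v x))"
  shows "spectral_norm (matrix_inv (matrix_sqrt B) ** matrix_sqrt A) \<le> c"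
proof -
  let ?M = "matrix_inv (matrix_sqrt B) ** matrix_sqrt A"
  have "norm (transpose ?M *v z) \<le> c * norm z" for z
    using norm_sqrt_mono[OF pos_def_imp_semidef[OF B] pos_def_imp_semidef[OF A] c le,
        of "matrix_inv (matrix_sqrt B) *v z"]
      transpose_sqrt_quotient[OF A B, of "matrix_inv (matrix_sqrt B) *v z"]
    by (simp add: matrix_inv_cancel[OF invertible_matrix_sqrt[OF B]])
  then have T: "spectral_norm (transpose ?M) \<le> c" by (rule spectral_norm_leI)
  have "norm (?M *v w) \<le> c * norm w" for w
    using spectral_norm_transpose_bound[of "transpose ?M" w] mult_right_mono[OF T, of "norm w"]
    by (simp del: transpose_matrix_vector)
  then show ?thesis by (rule spectral_norm_leI)
qed

section \<open>Coordinate blocks\<close>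

lemma block_vec_in_block_space [simp]: "block_vec blk i x \<in> block_space blk i"
  by (simp add: block_vec_def block_space_def)

lemma block_vec_id: "x \<in> block_space blk i \<Longrightarrow> block_vec blk i x = x"
  by (auto simp: block_vec_def block_space_def vec_eq_iff)

lemma block_vec_idem [simp]: "block_vec blk i (block_vec blk i x) = block_vec blk i x"
  by (simp add: block_vec_id)

lemma block_vec_other: "x \<in> block_space blk i \<Longrightarrow> j \<noteq> i \<Longrightarrow> block_vec blk j x = 0"
  by (auto simp: block_vec_def block_space_def vec_eq_iff)

lemma linear_block_vec: "linear (block_vec blk i)"
  by (intro linearI) (auto simp: block_vec_def vec_eq_iff)

lemmas block_vec_add = linear_add[OF linear_block_vec]
lemmas block_vec_diff = linear_diff[OF linear_block_vec]
lemmas block_vec_scaleR = linear_scale[OF linear_block_vec]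
lemmas block_vec_0 = linear_0[OF linear_block_vec]
lemmas block_vec_sum = linear_sum[OF linear_block_vec]

lemma block_vec_inner: "block_vec blk i x \<bullet> y = x \<bullet> block_vec blk i y"
  by (auto simp: block_vec_def inner_vec_def intro!: sum.cong)

lemma sum_block_vec:
  fixes blk :: "'n::finite \<Rightarrow> 'b::finite"
  shows "(\<Sum>i\<in>UNIV. block_vec blk i x) = x"
  by (simp add: vec_eq_iff block_vec_def sum.delta)

lemma inner_sum_blocks:
  fixes blk :: "'n::finite \<Rightarrow> 'b::finite"
  shows "x \<bullet> y = (\<Sum>i\<in>UNIV. block_vec blk i x \<bullet> block_vec blk i y)"
proof -
  have "x \<bullet> y = (\<Sum>i\<in>UNIV. block_vec blk i x) \<bullet> y" by (simp only: sum_block_vec)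
  also have "\<dots> = (\<Sum>i\<in>UNIV. block_vec blk i (block_vec blk i x) \<bullet> y)"
    by (simp add: inner_sum_left)
  also have "\<dots> = (\<Sum>i\<in>UNIV. block_vec blk i x \<bullet> block_vec blk i y)"
    by (simp only: block_vec_inner[of blk _ "block_vec blk _ x" y])
  finally show ?thesis .
qed

lemma norm_sum_blocks:
  fixes blk :: "'n::finite \<Rightarrow> 'b::finite"
  shows "(norm x)\<^sup>2 = (\<Sum>i\<in>UNIV. (norm (block_vec blk i x))\<^sup>2)"
  using inner_sum_blocks[of x x blk] by (simp add: dot_square_norm)

lemma sum_block_vec_selected:
  fixes blk :: "'n::finite \<Rightarrow> 'b::finite"
  assumes "\<And>j. d j \<in> block_space blk j"
  shows "block_vec blk i (\<Sum>j\<in>UNIV. d j) = d i"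
proof -
  have "block_vec blk i (d j) = (if j = i then d i else 0)" for j
    using assms block_vec_id block_vec_other by (metis)
  then show ?thesis by (simp add: block_vec_sum)
qed

lemma block_mat_mult:
  "block_mat blk i A *v x = block_vec blk i (A *v block_vec blk i x)"
  by (auto simp: block_mat_def block_vec_def matrix_vector_mult_def vec_eq_iff intro!: sum.cong)

lemma block_mat_one_mult: "block_mat blk i (mat 1) *v x = block_vec blk i x"
  by (simp add: block_mat_mult)

lemma block_diag_mult:
  fixes blk :: "'n::finite \<Rightarrow> 'b::finite"
  shows "block_diag blk A *v x = (\<Sum>i\<in>UNIV. block_mat blk i A *v x)"
proof -

  have "(block_diag blk A *v x) $ j = (\<Sum>i\<in>UNIV. (block_mat blk i A *v x) $ j)" for j
  proof -
    have "(block_mat blk i A *v x) $ j = (if i = blk j then (block_diag blk A *v x) $ j else 0)" for i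
      by (auto simp: block_mat_def block_diag_def matrix_vector_mult_def intro!: sum.cong)
    then show ?thesis by simp
  qed
  then show ?thesis by (simp add: vec_eq_iff)
qed

lemma block_mat_quadratic:
  "x \<bullet> (block_mat blk i A *v y) = block_vec blk i x \<bullet> (A *v block_vec blk i y)"
  by (simp add: block_mat_mult block_vec_inner)

lemma block_diag_quadratic:
  fixes blk :: "'n::finite \<Rightarrow> 'b::finite"
  shows "x \<bullet> (block_diag blk A *v y) = (\<Sum>i\<in>UNIV. block_vec blk i x \<bullet> (A *v block_vec blk i y))"
  by (simp add: block_diag_mult inner_sum_right block_mat_quadratic)

lemma block_mat_symmetric: "transpose A = A \<Longrightarrow> transpose (block_mat blk i A) = block_mat blk i A"
proof (rule symmetricI)
  fix x y assume A: "transpose A = A"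
  have "(block_mat blk i A *v x) \<bullet> y = (A *v block_vec blk i x) \<bullet> block_vec blk i y"
    by (simp add: block_mat_mult block_vec_inner)
  also have "\<dots> = x \<bullet> (block_mat blk i A *v y)"
    unfolding symmetric_inner[OF A] block_mat_quadratic ..
  finally show "(block_mat blk i A *v x) \<bullet> y = x \<bullet> (block_mat blk i A *v y)" .
qed

lemma block_mat_psd:
  assumes "pos_semidef_matrix A"
  shows "pos_semidef_matrix (block_mat blk i A)"
  using assms by (simp add: pos_semidef_matrix_def block_mat_symmetric block_mat_quadratic)

lemma block_diag_symmetric:
  fixes blk :: "'n::finite \<Rightarrow> 'b::finite"
  assumes "transpose A = A"
  shows "transpose (block_diag blk A) = block_diag blk A"
proof (rule symmetricI)
  fix x y
  show "(block_diag blk A *v x) \<bullet> y = x \<bullet> (block_diag blk A *v y)"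
    unfolding block_diag_mult inner_sum_left inner_sum_right
    by (simp only: symmetric_inner[OF block_mat_symmetric[OF assms]])
qed

lemma block_diag_pos_def:
  fixes blk :: "'n::finite \<Rightarrow> 'b::finite"
  assumes "pos_def_matrix A"
  shows "pos_def_matrix (block_diag blk A)"
  unfolding pos_def_matrix_def
proof (intro conjI allI impI)
  show "transpose (block_diag blk A) = block_diag blk A"
    using assms by (intro block_diag_symmetric) (simp add: pos_def_matrix_def)
  fix v :: "real^'n" assume "v \<noteq> 0"
  then obtain i where i: "block_vec blk i v \<noteq> 0"
    using sum_block_vec[of blk v] by (metis sum.neutral)
  show "0 < v \<bullet> (block_diag blk A *v v)" unfolding block_diag_quadratic
  proof (rule sum_pos2[of _ i])
    show "0 < block_vec blk i v \<bullet> (A *v block_vec blk i v)"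
      using i assms by (auto simp: pos_def_matrix_def)
    show "0 \<le> block_vec blk j v \<bullet> (A *v block_vec blk j v)" for j
      using pos_def_imp_semidef[OF assms] by (auto simp: pos_semidef_matrix_def)
  qed auto
qed

text \<open>The description defining \<open>block_inv\<close> is satisfied by exactly one matrix, as for ordinary
  inverses; existence reduces to the inverse of a full matrix.\<close>

lemma block_inv_works:
  fixes A :: "real^'n^'n::finite" and blk :: "'n \<Rightarrow> 'b" and i :: 'b
  assumes A: "pos_def_matrix A"
  defines "B \<equiv> block_inv blk i A"
  shows "block_mat blk i B = B" "block_mat blk i A ** B = block_mat blk i (mat 1)"
    "B ** block_mat blk i A = block_mat blk i (mat 1)"
proof -
  let ?P = "block_vec blk i" and ?Q = "\<lambda>B. block_mat blk i B = B \<and>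
      block_mat blk i A ** B = block_mat blk i (mat 1) \<and>
      B ** block_mat blk i A = block_mat blk i (mat 1)"
  (* completed by the identity outside the block, the submatrix becomes invertible *)
  define C where "C = block_mat blk i A + (mat 1 - block_mat blk i (mat 1))"
  have C: "C *v x = ?P (A *v ?P x) + (x - ?P x)" for x
    by (simp add: C_def matrix_vector_mult_add_rdistrib matrix_vector_mult_diff_rdistrib block_mat_mult)
  have PC: "?P (C *v x) = ?P (A *v ?P x)" "C *v ?P x = ?P (A *v ?P x)" for x
    by (simp_all add: C block_vec_add block_vec_diff)
  have "invertible C"
  proof (rule invertible_if_kernel_trivial)
    fix x assume "C *v x = 0"
    then have P0: "?P (A *v ?P x) = 0" using PC(1)[of x] by (simp add: block_vec_0)
    then have "x = ?P x" using \<open>C *v x = 0\<close> by (simp add: C)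
    moreover have "?P x \<bullet> (A *v ?P x) = 0"
      using P0 block_vec_inner[of blk i "?P x" "A *v ?P x"] by simp
    then have "?P x = 0" using A unfolding pos_def_matrix_def by force
    ultimately show "x = 0" by simp
  qed
  note inv = matrix_inv_cancel[OF this]
  define B0 where "B0 = block_mat blk i (matrix_inv C)"
  have B0: "B0 *v x = ?P (matrix_inv C *v ?P x)" for x by (simp add: B0_def block_mat_mult)
  have "?Q B0"
  proof (intro conjI)
    show "block_mat blk i B0 = B0"
      unfolding matrix_eq by (simp add: block_mat_mult B0)
    have "block_mat blk i A *v (B0 *v x) = ?P x" for x
    proof -
      have "block_mat blk i A *v (B0 *v x) = ?P (C *v (matrix_inv C *v ?P x))"
        by (simp add: block_mat_mult B0 PC)
      then show ?thesis by (simp add: inv)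
    qed
    then show "block_mat blk i A ** B0 = block_mat blk i (mat 1)"
      by (simp add: matrix_eq block_mat_one_mult matrix_vector_mul_assoc[symmetric])
    have "B0 *v (block_mat blk i A *v x) = ?P x" for x
    proof -
      have "B0 *v (block_mat blk i A *v x) = ?P (matrix_inv C *v (C *v ?P x))"
        by (simp add: block_mat_mult B0 PC)
      then show ?thesis by (simp add: inv)
    qed
    then show "B0 ** block_mat blk i A = block_mat blk i (mat 1)"
      by (simp add: matrix_eq block_mat_one_mult matrix_vector_mul_assoc[symmetric])
  qed
  moreover have "B1 = B2" if "?Q B1" "?Q B2" for B1 B2
  proof -
    have "B1 *v x = ?P (B1 *v x)" for x
      using that(1) block_mat_mult[of blk i B1 x] by (metis block_vec_idem)
    then have left: "B1 = block_mat blk i (mat 1) ** B1"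
      unfolding matrix_eq by (simp add: block_mat_one_mult matrix_vector_mul_assoc[symmetric])
    have "B2 *v x = B2 *v ?P x" for x
      using that(2) block_mat_mult[of blk i B2 x] block_mat_mult[of blk i B2 "?P x"] by simp
    then have right: "B2 = B2 ** block_mat blk i (mat 1)"
      unfolding matrix_eq by (simp add: block_mat_one_mult matrix_vector_mul_assoc[symmetric])
    have "B1 = (B2 ** block_mat blk i A) ** B1" by (subst left) (simp only: that)
    also have "\<dots> = B2" 
      using right that(1) by (simp only: matrix_mul_assoc[symmetric])
    finally show ?thesis .
  qed
  ultimately have "\<exists>!B. ?Q B" by blast
  from theI'[OF this] show "block_mat blk i B = B" "block_mat blk i A ** B = block_mat blk i (mat 1)"
    "B ** block_mat blk i A = block_mat blk i (mat 1)"
    unfolding B_def block_inv_def by auto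
qed

lemma block_norm_nonneg:
  "pos_semidef_matrix (ehess f x) \<Longrightarrow> 0 \<le> block_norm blk f x i y"
  using block_mat_psd[of "ehess f x" blk i] unfolding block_norm_def by (auto simp: pos_semidef_matrix_def)

lemma block_norm_sq:
  "pos_semidef_matrix (ehess f x) \<Longrightarrow>
    (block_norm blk f x i y)\<^sup>2 = block_vec blk i y \<bullet> (ehess f x *v block_vec blk i y)"
  by (simp add: block_norm_def block_mat_quadratic pos_semidef_matrix_def)

text \<open>\<open>v\<close> is the image of \<open>z = block_inv blk i (ehess f x) *v v\<close> under the block of the Hessian, and the dual norm of \<open>v\<close> is the
  local norm of \<open>z\<close>, so this is the Cauchy-Schwarz inequality for \<open>z\<close> and \<open>y\<close>.\<close>

lemma block_dual_norm_inner:
  assumes A: "pos_def_matrix (ehess f x)" and v: "v \<in> block_space blk i"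
  shows "v \<bullet> y \<le> block_dual_norm blk f x i v * block_norm blk f x i y"
proof -
  let ?A = "block_mat blk i (ehess f x)" and ?B = "block_inv blk i (ehess f x)"
  have v': "?A *v (?B *v v) = v"
    using v by (simp add: matrix_vector_mul_assoc block_inv_works(2)[OF A] block_mat_one_mult
        block_vec_id)
  have psd: "pos_semidef_matrix ?A"
    using A by (intro block_mat_psd pos_def_imp_semidef)
  have "v \<bullet> y = (?B *v v) \<bullet> (?A *v y)"
    using symmetric_inner[of ?A "?B *v v" y] psd unfolding pos_semidef_matrix_def by (simp add: v')
  also have "\<dots> \<le> sqrt ((?B *v v) \<bullet> (?A *v (?B *v v))) * sqrt (y \<bullet> (?A *v y))"
    by (rule psd_Cauchy_Schwarz[OF psd])
  also have "(?B *v v) \<bullet> (?A *v (?B *v v)) = v \<bullet> (?B *v v)"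
    using v' by (simp add: inner_commute)
  finally show ?thesis by (simp add: block_dual_norm_def block_norm_def)
qed

lemma block_norm_Cauchy_Schwarz:
  assumes "pos_semidef_matrix (ehess f x)"
  shows "(block_mat blk i (ehess f x) *v z) \<bullet> y \<le> block_norm blk f x i z * block_norm blk f x i y"
  using psd_Cauchy_Schwarz[OF block_mat_psd[OF assms], of y blk i z]
  by (simp add: block_norm_def inner_commute mult.commute)

section \<open>Derivatives along lines\<close>

lemma gradient_has_derivative:
  fixes h :: "real^'n::finite \<Rightarrow> real"
  assumes "h differentiable (at x)"
  shows "(h has_derivative (\<lambda>v. (\<chi> j. partial_deriv j h x) \<bullet> v)) (at x)"
proof -
  let ?D = "frechet_derivative h (at x)"
  have D: "(h has_derivative ?D) (at x)" using assms by (simp add: frechet_derivative_works)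
  then have lin: "linear ?D" by (rule has_derivative_linear)
  have "?D v = (\<chi> j. partial_deriv j h x) \<bullet> v" for v
  proof -
    have "v = (\<Sum>j\<in>UNIV. v $ j *\<^sub>R axis j 1)"
      by (simp add: vec_eq_iff axis_def if_distrib cong: if_cong)
    then have "?D v = ?D (\<Sum>j\<in>UNIV. v $ j *\<^sub>R axis j 1)" by simp
    also have "\<dots> = (\<Sum>j\<in>UNIV. v $ j * partial_deriv j h x)"
      by (simp add: linear_sum[OF lin] linear_scale[OF lin] partial_deriv_def)
    finally show ?thesis by (simp add: inner_vec_def mult.commute)
  qed
  then have "?D = (\<lambda>v. (\<chi> j. partial_deriv j h x) \<bullet> v)" by blast
  then show ?thesis using D by simp
qed

lemma line_has_derivative: "((\<lambda>t. x + t *\<^sub>R u) has_derivative (\<lambda>h. h *\<^sub>R u)) (at t)"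
  for x u :: "'a::real_normed_vector"
  by (auto intro!: derivative_eq_intros)

context
  fixes f :: "real^'n::finite \<Rightarrow> ereal"
  assumes C3: "cont_diff_on 3 (\<lambda>y. real_of_ereal (f y)) (edom f)"
    and op: "open (edom f)"
begin

lemma egrad_has_derivative:
  assumes "x \<in> edom f"
  shows "((\<lambda>y. real_of_ereal (f y)) has_derivative (\<lambda>v. egrad f x \<bullet> v)) (at x)"
  using gradient_has_derivative[of "\<lambda>y. real_of_ereal (f y)" x] C3 assms
  by (simp add: numeral_3_eq_3 egrad_def)

lemma ehess_has_derivative:
  assumes "x \<in> edom f"
  shows "(egrad f has_derivative (\<lambda>v. ehess f x *v v)) (at x)"
proof -
  have "egrad f differentiable (at x)"
  proof (subst differentiable_componentwise_within, intro ballI)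
    fix i :: "real^'n" assume "i \<in> Basis"
    then obtain j where "i = axis j 1" by (auto simp: Basis_vec_def)
    then have "(\<lambda>y. egrad f y \<bullet> i) = partial_deriv j (\<lambda>y. real_of_ereal (f y))"
      by (simp add: inner_axis egrad_def fun_eq_iff)
    then show "(\<lambda>y. egrad f y \<bullet> i) differentiable (at x)"
      using C3 assms by (simp add: numeral_3_eq_3)
  qed
  then show ?thesis by (simp add: ehess_def jacobian_works)
qed

lemma ehess_entry:
  assumes "x \<in> edom f"
  shows "ehess f x $ j $ k = partial_deriv k (partial_deriv j (\<lambda>y. real_of_ereal (f y))) x"
proof -
  have "((\<lambda>y. egrad f y $ j) has_derivative (\<lambda>v. (ehess f x *v v) $ j)) (at x)"
    using ehess_has_derivative[OF assms] by (rule bounded_linear.has_derivative[OF bounded_linear_vec_nth])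
  then have "(partial_deriv j (\<lambda>y. real_of_ereal (f y)) has_derivative (\<lambda>v. (ehess f x *v v) $ j)) (at x)"
    by (simp add: egrad_def)
  from frechet_derivative_at[OF this, symmetric] show ?thesis
    unfolding partial_deriv_def[of k] by (simp add: matrix_vector_mult_basis column_def)
qed

text \<open>Three derivatives of \<open>f\<close> are available only through its iterated partial derivatives, so the
  quadratic form is written out in coordinates.\<close>

lemma ehess_quadratic_differentiable:
  assumes x: "x \<in> edom f"
  shows "(\<lambda>y. u \<bullet> (ehess f y *v u)) differentiable (at x)"
proof -
  let ?h = "\<lambda>y. \<Sum>j\<in>UNIV. u $ j * (\<Sum>k\<in>UNIV.
    partial_deriv k (partial_deriv j (\<lambda>y. real_of_ereal (f y))) y * u $ k)"
  have "?h differentiable (at x)"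
    using C3 x by (intro differentiable_sum differentiable_mult ballI) (auto simp: numeral_3_eq_3)
  then obtain D where "(?h has_derivative D) (at x)" by (auto simp: differentiable_def)
  then have "((\<lambda>y. u \<bullet> (ehess f y *v u)) has_derivative D) (at x)"
    by (rule has_derivative_transform_within_open[OF _ op x])
      (simp add: inner_vec_def matrix_vector_mult_def ehess_entry)
  then show ?thesis by (auto simp: differentiable_def)
qed

lemma line_first_derivative:
  assumes "x + t *\<^sub>R u \<in> edom f"
  shows "((\<lambda>t. real_of_ereal (f (x + t *\<^sub>R u))) has_real_derivative egrad f (x + t *\<^sub>R u) \<bullet> u) (at t)"
  using has_derivative_compose[OF line_has_derivative egrad_has_derivative[OF assms]]
  by (simp add: has_field_derivative_def mult.commute[of _ "_ \<bullet> _"])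

lemma line_second_derivative:
  assumes "x + t *\<^sub>R u \<in> edom f"
  shows "((\<lambda>t. egrad f (x + t *\<^sub>R u) \<bullet> w) has_real_derivative w \<bullet> (ehess f (x + t *\<^sub>R u) *v u)) (at t)"
proof -
  have "((\<lambda>t. egrad f (x + t *\<^sub>R u) \<bullet> w) has_derivative
      (\<lambda>h. (ehess f (x + t *\<^sub>R u) *v (h *\<^sub>R u)) \<bullet> w)) (at t)"
    by (intro has_derivative_inner_left
        has_derivative_compose[OF line_has_derivative ehess_has_derivative[OF assms]])
  moreover have "(\<lambda>h. (ehess f (x + t *\<^sub>R u) *v (h *\<^sub>R u)) \<bullet> w)
      = (*) (w \<bullet> (ehess f (x + t *\<^sub>R u) *v u))"
    by (simp add: fun_eq_iff matrix_vector_mult_scaleR inner_commute)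
  ultimately show ?thesis by (simp only: has_field_derivative_def)
qed

text \<open>Self-concordance is postulated at \<open>t = 0\<close> on every line. Restarting the line at
  \<open>x + t *\<^sub>R u\<close> identifies the iterated derivatives at \<open>0\<close> there with derivatives of the Hessian
  form at \<open>t\<close> along the original line.\<close>

lemma line_third_derivative:
  assumes y: "x + t *\<^sub>R u \<in> edom f"
  shows "((\<lambda>t. u \<bullet> (ehess f (x + t *\<^sub>R u) *v u)) has_real_derivative
      (deriv ^^ 3) (\<lambda>s. real_of_ereal (f (x + t *\<^sub>R u + s *\<^sub>R u))) 0) (at t)"
    and "(deriv ^^ 2) (\<lambda>s. real_of_ereal (f (x + t *\<^sub>R u + s *\<^sub>R u))) 0
      = u \<bullet> (ehess f (x + t *\<^sub>R u) *v u)"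
proof -
  let ?y = "x + t *\<^sub>R u" and ?q = "\<lambda>z. u \<bullet> (ehess f z *v u)"
  let ?\<psi> = "\<lambda>s. real_of_ereal (f (?y + s *\<^sub>R u))"
  define T where "T = (\<lambda>s. ?y + s *\<^sub>R u) -` edom f"
  have T: "open T" unfolding T_def using op
    by (intro open_vimage continuous_intros)
  have T0: "0 \<in> T" using y by (simp add: T_def)
  have d1: "deriv ?\<psi> s = egrad f (?y + s *\<^sub>R u) \<bullet> u" if "s \<in> T" for s
    using that by (intro DERIV_imp_deriv line_first_derivative) (simp add: T_def)
  have d2: "deriv (deriv ?\<psi>) s = ?q (?y + s *\<^sub>R u)" if "s \<in> T" for s
  proof (rule DERIV_imp_deriv)
    have "((\<lambda>s. egrad f (?y + s *\<^sub>R u) \<bullet> u) has_real_derivative ?q (?y + s *\<^sub>R u)) (at s)"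
      using that by (intro line_second_derivative) (simp add: T_def)
    then show "(deriv ?\<psi> has_real_derivative ?q (?y + s *\<^sub>R u)) (at s)"
      by (rule has_field_derivative_transform_within_open[OF _ T that]) (simp add: d1)
  qed
  show "(deriv ^^ 2) ?\<psi> 0 = ?q ?y"
    using d2[OF T0] by (simp add: numeral_2_eq_2)
  obtain D where D: "(?q has_derivative D) (at ?y)"
    using ehess_quadratic_differentiable[OF y, of u] by (auto simp: differentiable_def)
  have lin: "linear D" using D by (rule has_derivative_linear)
  have D': "((\<lambda>s. ?q (x + s *\<^sub>R u)) has_real_derivative D u) (at t)"
    using has_derivative_compose[OF line_has_derivative D]
    by (simp add: has_field_derivative_def linear_scale[OF lin] mult.commute[of _ "D u"])
  have "((\<lambda>s. ?q (?y + s *\<^sub>R u)) has_real_derivative D u) (at 0)"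
  proof -
    have "(?q has_derivative D) (at (?y + 0 *\<^sub>R u))" using D by simp
    from has_derivative_compose[OF line_has_derivative this]
    show ?thesis by (simp add: has_field_derivative_def linear_scale[OF lin] mult.commute[of _ "D u"])
  qed
  then have "(deriv (deriv ?\<psi>) has_real_derivative D u) (at 0)"
    by (rule has_field_derivative_transform_within_open[OF _ T T0]) (simp add: d2)
  then have "(deriv ^^ 3) ?\<psi> 0 = D u"
    by (simp add: numeral_3_eq_3 DERIV_imp_deriv)
  then show "((\<lambda>s. ?q (x + s *\<^sub>R u)) has_real_derivative (deriv ^^ 3) ?\<psi> 0) (at t)"
    using D' by simp
qed

end

lemma self_concordant_along_line:
  fixes f :: "real^'n::finite \<Rightarrow> ereal"
  assumes "standard_self_concordant f" "x + t *\<^sub>R u \<in> edom f"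
  obtains c where "((\<lambda>t. u \<bullet> (ehess f (x + t *\<^sub>R u) *v u)) has_real_derivative c) (at t)"
    "\<bar>c\<bar> \<le> 2 * (u \<bullet> (ehess f (x + t *\<^sub>R u) *v u)) powr (3/2)"
proof -
  have C3: "cont_diff_on 3 (\<lambda>y. real_of_ereal (f y)) (edom f)" and op: "open (edom f)"
    using assms(1) by (auto simp: standard_self_concordant_def)
  show thesis
    using that[OF line_third_derivative(1)[OF C3 op assms(2)]] assms
      line_third_derivative(2)[OF C3 op assms(2)]
    unfolding standard_self_concordant_def Let_def by metis
qed

section \<open>The function omega-star and its inverse\<close>

lemma omega_star_0 [simp]: "omega_star 0 = 0"
  by (simp add: omega_star_def)

lemma omega_star_deriv:
  assumes "s < 1" shows "(omega_star has_real_derivative s / (1 - s)) (at s)"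
  unfolding omega_star_def [abs_def] using assms
  by (auto intro!: derivative_eq_intros simp: field_simps)

lemma omega_star_strict_mono:
  assumes "0 \<le> s" "s < t" "t < 1" shows "omega_star s < omega_star t"
proof (rule DERIV_pos_imp_increasing_open[OF assms(2)])
  fix x assume x: "s < x" "x < t"
  then have "(omega_star has_real_derivative x / (1 - x)) (at x)"
    using assms by (intro omega_star_deriv) auto
  moreover have "0 < x / (1 - x)" using x assms by simp
  ultimately show "\<exists>y. (omega_star has_real_derivative y) (at x) \<and> 0 < y" by blast
next
  have "1 - x \<noteq> 0" if "x \<in> {s..t}" for x using that assms by auto
  then show "continuous_on {s..t} omega_star"
    unfolding omega_star_def [abs_def] using assms by (intro continuous_intros) auto
qed

lemma omega_star_lower:
  assumes "0 \<le> t" "t < 1" shows "t\<^sup>2 / 2 \<le> omega_star t"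
proof -
  have "omega_star 0 - 0\<^sup>2 / 2 \<le> omega_star t - t\<^sup>2 / 2"
  proof (rule DERIV_nonneg_imp_nondecreasing[OF assms(1), of "\<lambda>s. omega_star s - s\<^sup>2 / 2"])
    fix s assume s: "0 \<le> s" "s \<le> t"
    have "((\<lambda>s. omega_star s - s\<^sup>2 / 2) has_real_derivative s / (1 - s) - s) (at s)"
      using omega_star_deriv[of s] s assms by (auto intro!: derivative_eq_intros)
    moreover have "s / (1 - s) - s = s\<^sup>2 / (1 - s)"
      using s assms by (simp add: field_simps power2_eq_square)
    ultimately have "((\<lambda>s. omega_star s - s\<^sup>2 / 2) has_real_derivative s\<^sup>2 / (1 - s)) (at s)" by simp
    moreover have "0 \<le> s\<^sup>2 / (1 - s)" using s assms by simp
    ultimately show "\<exists>y. ((\<lambda>s. omega_star s - s\<^sup>2 / 2) has_real_derivative y) (at s) \<and> 0 \<le> y" by blast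
  qed
  then show ?thesis by simp
qed

lemma omega_star_upper:
  assumes "0 \<le> t" "t < 1" shows "omega_star t \<le> t\<^sup>2 / (2 * (1 - t))"
proof -
  have "0\<^sup>2 / (2 * (1 - 0)) - omega_star 0 \<le> t\<^sup>2 / (2 * (1 - t)) - omega_star t"
  proof (rule DERIV_nonneg_imp_nondecreasing[OF assms(1), of "\<lambda>s. s\<^sup>2 / (2 * (1 - s)) - omega_star s"])
    fix s assume s: "0 \<le> s" "s \<le> t"
    have "((\<lambda>s. s\<^sup>2 / (2 * (1 - s)) - omega_star s) has_real_derivative
        (2 * s * (2 * (1 - s)) - s\<^sup>2 * (- 2)) / (2 * (1 - s))\<^sup>2 - s / (1 - s)) (at s)"
      using omega_star_deriv[of s] s assms
      by (auto intro!: derivative_eq_intros simp: power2_eq_square)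
    moreover have "(2 * s * (2 * (1 - s)) - s\<^sup>2 * (- 2)) / (2 * (1 - s))\<^sup>2 - s / (1 - s)
        = s\<^sup>2 / (2 * (1 - s)\<^sup>2)"
      using s assms by (simp add: divide_simps) (simp add: algebra_simps power2_eq_square)
    ultimately show "\<exists>y. ((\<lambda>s. s\<^sup>2 / (2 * (1 - s)) - omega_star s) has_real_derivative y) (at s) \<and> 0 \<le> y"
      by (intro exI conjI) auto
  qed
  then show ?thesis by simp
qed

text \<open>\<open>omega_star\<close> attains every nonnegative value: at \<open>1 - exp (- \<delta> - 1)\<close> it is at least \<open>\<delta>\<close>.\<close>

lemma omega_star_inv_works:
  assumes "0 \<le> \<delta>"
  shows "0 \<le> omega_star_inv \<delta>" "omega_star_inv \<delta> < 1" "omega_star (omega_star_inv \<delta>) = \<delta>"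
proof -
  define t where "t = 1 - exp (- (\<delta> + 1))"
  have t: "0 \<le> t" "t < 1" using assms by (auto simp: t_def)
  have ge: "\<delta> \<le> omega_star t" using t by (simp add: omega_star_def t_def)
  have cont: "continuous_on {0..t} omega_star"
    unfolding omega_star_def [abs_def] using t by (intro continuous_intros) auto
  obtain s where "0 \<le> s" "s \<le> t" "omega_star s = \<delta>"
    using IVT'[of omega_star 0 \<delta> t] assms t ge cont by auto
  then have "\<delta> \<in> omega_star ` {0..<1}" using t by force
  then have "omega_star_inv \<delta> \<in> {0..<1} \<and> omega_star (omega_star_inv \<delta>) = \<delta>"
    unfolding omega_star_inv_def by (simp only: inv_into_into f_inv_into_f)
  then show "0 \<le> omega_star_inv \<delta>" "omega_star_inv \<delta> < 1" "omega_star (omega_star_inv \<delta>) = \<delta>"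
    by auto
qed

lemma omega_star_inv_mono:
  assumes "0 \<le> \<delta>" "\<delta> \<le> \<delta>'" shows "omega_star_inv \<delta> \<le> omega_star_inv \<delta>'"
proof (rule ccontr)
  assume "\<not> ?thesis"
  then have "omega_star (omega_star_inv \<delta>') < omega_star (omega_star_inv \<delta>)"
    using omega_star_inv_works[of \<delta>] omega_star_inv_works[of \<delta>'] assms
    by (intro omega_star_strict_mono) auto
  then show False using omega_star_inv_works(3)[of \<delta>] omega_star_inv_works(3)[of \<delta>'] assms by simp
qed

lemma omega_star_inv_sq_le:
  assumes "0 \<le> \<delta>" shows "(omega_star_inv \<delta>)\<^sup>2 \<le> 2 * \<delta>"
  using omega_star_lower[of "omega_star_inv \<delta>"] omega_star_inv_works[OF assms] by simp

section \<open>Damped steps of self-concordant functions\<close>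

text \<open>The hypothesis on \<open>c\<close> says that \<open>1 / sqrt q\<close> has derivative at least \<open>-1\<close>; integrating this
  gives \<open>1 / sqrt (q t) \<ge> 1 / sqrt (q 0) - t\<close>.\<close>

lemma self_concordant_curvature_bound:
  fixes q c :: "real \<Rightarrow> real"
  assumes t: "0 \<le> t" and lt: "sqrt (q 0) * t < 1"
    and pos: "\<And>s. 0 \<le> s \<Longrightarrow> s \<le> t \<Longrightarrow> 0 < q s"
    and der: "\<And>s. 0 \<le> s \<Longrightarrow> s \<le> t \<Longrightarrow> (q has_real_derivative c s) (at s)"
    and sc: "\<And>s. 0 \<le> s \<Longrightarrow> s \<le> t \<Longrightarrow> \<bar>c s\<bar> \<le> 2 * q s powr (3/2)"
  shows "q t \<le> (sqrt (q 0) / (1 - sqrt (q 0) * t))\<^sup>2"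
proof -
  let ?l = "sqrt (q 0)"
  have l: "?l > 0" using pos[of 0] t by simp
  have "1 / ?l + 0 \<le> 1 / sqrt (q t) + t"
  proof (rule DERIV_nonneg_imp_nondecreasing[OF t, of "\<lambda>s. 1 / sqrt (q s) + s"])
    fix s assume s: "0 \<le> s" "s \<le> t"
    let ?r = "sqrt (q s)"
    have r: "?r > 0" "q s = ?r * ?r" using pos[OF s] by auto
    have "q s powr (3/2) = q s powr 1 * q s powr (1/2)"
      by (subst powr_add[symmetric]) simp
    also have "\<dots> = ?r * ?r * ?r" using pos[OF s] r by (simp add: powr_half_sqrt)
    finally have "c s \<le> 2 * (?r * ?r * ?r)" using sc[OF s] by simp
    then have "0 \<le> 1 - c s / (2 * (?r * ?r * ?r))" using r by (simp add: divide_le_eq)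
    moreover have "((\<lambda>s. 1 / sqrt (q s) + s) has_real_derivative
        1 - c s / (2 * (?r * ?r * ?r))) (at s)"
      using der[OF s] pos[OF s] r(1)
      by (auto intro!: derivative_eq_intros simp: field_simps)
    ultimately show "\<exists>y. ((\<lambda>s. 1 / sqrt (q s) + s) has_real_derivative y) (at s) \<and> 0 \<le> y" by blast
  qed
  then have "(1 - ?l * t) / ?l \<le> 1 / sqrt (q t)" using l by (simp add: field_simps)
  moreover have "0 < (1 - ?l * t) / ?l" "0 < sqrt (q t)" using l lt pos[of t] t by auto
  ultimately have "sqrt (q t) \<le> ?l / (1 - ?l * t)"
    using l lt by (simp add: field_simps)
  then show ?thesis using pos[of t] t
    by (metis less_imp_le order_refl real_sqrt_pow2 real_sqrt_ge_zero power_mono)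
qed

text \<open>Integrating the curvature bound twice; \<open>omega_star (l s)\<close> has second derivative
  \<open>l^2 / (1 - l s)^2\<close> in \<open>s\<close>.\<close>

lemma self_concordant_upper_bound:
  fixes \<psi> \<psi>' q c :: "real \<Rightarrow> real"
  assumes t: "0 \<le> t" and lt: "sqrt (q 0) * t < 1"
    and d0: "\<And>s. 0 \<le> s \<Longrightarrow> s \<le> t \<Longrightarrow> (\<psi> has_real_derivative \<psi>' s) (at s)"
    and d1: "\<And>s. 0 \<le> s \<Longrightarrow> s \<le> t \<Longrightarrow> (\<psi>' has_real_derivative q s) (at s)"
    and pos: "\<And>s. 0 \<le> s \<Longrightarrow> s \<le> t \<Longrightarrow> 0 < q s"
    and der: "\<And>s. 0 \<le> s \<Longrightarrow> s \<le> t \<Longrightarrow> (q has_real_derivative c s) (at s)"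
    and sc: "\<And>s. 0 \<le> s \<Longrightarrow> s \<le> t \<Longrightarrow> \<bar>c s\<bar> \<le> 2 * q s powr (3/2)"
  shows "\<psi> t \<le> \<psi> 0 + t * \<psi>' 0 + omega_star (sqrt (q 0) * t)"
proof -
  let ?l = "sqrt (q 0)"
  have l: "0 \<le> ?l" using pos[of 0] t by simp
  have ls: "?l * s < 1" if "s \<le> t" for s
    using mult_left_mono[OF that l] lt by linarith
  have first: "\<psi>' s - ?l / (1 - ?l * s) \<le> \<psi>' 0 - ?l / (1 - ?l * 0)" if s: "0 \<le> s" "s \<le> t" for s
  proof (rule DERIV_nonpos_imp_nonincreasing[OF s(1), of "\<lambda>s. \<psi>' s - ?l / (1 - ?l * s)"])
    fix r assume r: "0 \<le> r" "r \<le> s"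
    have "q r \<le> (?l / (1 - ?l * r))\<^sup>2"
      by (rule self_concordant_curvature_bound[of r q c]) (use r s ls pos der sc in auto)
    moreover have "((\<lambda>s. \<psi>' s - ?l / (1 - ?l * s)) has_real_derivative
        q r - (?l / (1 - ?l * r))\<^sup>2) (at r)"
      using d1[of r] ls[of r] r s
      by (auto intro!: derivative_eq_intros simp: power2_eq_square)
    ultimately show "\<exists>y. ((\<lambda>s. \<psi>' s - ?l / (1 - ?l * s)) has_real_derivative y) (at r) \<and> y \<le> 0"
      by (intro exI conjI) auto
  qed
  have "\<psi> t - t * \<psi>' 0 - omega_star (?l * t) \<le> \<psi> 0 - 0 * \<psi>' 0 - omega_star (?l * 0)"
  proof (rule DERIV_nonpos_imp_nonincreasing[OF t, of "\<lambda>s. \<psi> s - s * \<psi>' 0 - omega_star (?l * s)"])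
    fix s assume s: "0 \<le> s" "s \<le> t"
    have "((\<lambda>s. omega_star (?l * s)) has_real_derivative (?l * s / (1 - ?l * s)) * ?l) (at s)"
      by (rule DERIV_chain2[where f = omega_star and g = "\<lambda>s. ?l * s"])
        (auto intro!: omega_star_deriv ls s derivative_eq_intros)
    moreover have "(?l * s / (1 - ?l * s)) * ?l = ?l / (1 - ?l * s) - ?l"
      using ls[OF s(2)] by (simp add: field_simps)
    ultimately have "((\<lambda>s. \<psi> s - s * \<psi>' 0 - omega_star (?l * s)) has_real_derivative
        \<psi>' s - \<psi>' 0 - (?l / (1 - ?l * s) - ?l)) (at s)"
      using d0[OF s] by (auto intro!: derivative_eq_intros)
    then show "\<exists>y. ((\<lambda>s. \<psi> s - s * \<psi>' 0 - omega_star (?l * s)) has_real_derivative y) (at s) \<and> y \<le> 0"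
      using first[OF s] by (intro exI conjI) auto
  qed
  then show ?thesis by (simp add: omega_star_def)
qed

lemma closed_convex_fun_combination:
  assumes "closed_convex_fun V h" "x \<in> V" "y \<in> V" "h x \<le> ereal a" "h y \<le> ereal b"
    "0 \<le> t" "t \<le> 1"
  shows "x + t *\<^sub>R (y - x) \<in> V" "h (x + t *\<^sub>R (y - x)) \<le> ereal (a + t * (b - a))"
proof -
  have "(x, a) \<in> epi V h" "(y, b) \<in> epi V h" "convex (epi V h)"
    using assms by (auto simp: epi_def closed_convex_fun_def)
  then have "(1 - t) *\<^sub>R (x, a) + t *\<^sub>R (y, b) \<in> epi V h"
    using assms(6,7) by (intro convexD) auto
  then show "x + t *\<^sub>R (y - x) \<in> V" "h (x + t *\<^sub>R (y - x)) \<le> ereal (a + t * (b - a))"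
    by (auto simp: epi_def algebra_simps)
qed

lemma ereal_less_infinity_bound:
  fixes e :: ereal assumes "e < \<infinity>" obtains r where "e \<le> ereal r"
  using assms by (cases e) auto

lemma closed_convex_fun_edom:
  assumes "closed_convex_fun V h" "x \<in> V" "y \<in> V" "x \<in> edom h" "y \<in> edom h" "0 \<le> t" "t \<le> 1"
  shows "x + t *\<^sub>R (y - x) \<in> edom h"
proof -
  obtain a b where "h x \<le> ereal a" "h y \<le> ereal b"
    using assms ereal_less_infinity_bound by (metis edom_def mem_Collect_eq)
  from closed_convex_fun_combination(2)[OF assms(1-3) this assms(6,7)]
  show ?thesis by (auto simp: edom_def)
qed

lemma real_of_ereal_le_iff_finite:
  assumes "f x \<noteq> -\<infinity>" "f x < \<infinity>"
  shows "f x \<le> ereal r \<longleftrightarrow> real_of_ereal (f x) \<le> r"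
  using assms by (cases "f x") auto

text \<open>That the step does not leave the open domain is part of the claim. The set \<open>T\<close> of step
  lengths whose points remain in the domain is open; on it the upper bound \<open>U\<close> holds, and since
  the epigraph is closed, \<open>T\<close> is closed as well. Connectedness of the interval finishes.\<close>

lemma self_concordant_damped_step:
  fixes f :: "real^'n::finite \<Rightarrow> ereal"
  assumes sc: "standard_self_concordant f" and nm: "\<And>y. f y \<noteq> -\<infinity>" and x: "x \<in> edom f"
    and l: "l = sqrt (u \<bullet> (ehess f x *v u))"
    and \<tau>: "0 \<le> \<tau>" "l * \<tau> < 1" and l0: "0 \<le> l"
    and pos: "\<And>s. 0 \<le> s \<Longrightarrow> s \<le> \<tau> \<Longrightarrow> x + s *\<^sub>R u \<in> edom f \<Longrightarrow> 0 < u \<bullet> (ehess f (x + s *\<^sub>R u) *v u)"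
  shows "x + \<tau> *\<^sub>R u \<in> edom f"
    "real_of_ereal (f (x + \<tau> *\<^sub>R u)) \<le> real_of_ereal (f x) + \<tau> * (egrad f x \<bullet> u) + omega_star (l * \<tau>)"
proof -
  have C3: "cont_diff_on 3 (\<lambda>y. real_of_ereal (f y)) (edom f)" and op: "open (edom f)"
    and cc: "closed_convex_fun UNIV f"
    using sc by (auto simp: standard_self_concordant_def)
  define U where "U s = real_of_ereal (f x) + s * (egrad f x \<bullet> u) + omega_star (l * s)" for s
  define T where "T = {s\<in>{0..\<tau>}. x + s *\<^sub>R u \<in> edom f}"
  have bound: "real_of_ereal (f (x + s *\<^sub>R u)) \<le> U s" if "s \<in> T" for s
  proof -
    have s: "0 \<le> s" "s \<le> \<tau>" "x + s *\<^sub>R u \<in> edom f" using that by (auto simp: T_def)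
    have seg: "x + r *\<^sub>R u \<in> edom f" if "0 \<le> r" "r \<le> s" for r
      using closed_convex_fun_edom[OF cc _ _ x s(3), where t = "r / s"] that x
      by (cases "s = 0") auto
    have "\<exists>c. ((\<lambda>t. u \<bullet> (ehess f (x + t *\<^sub>R u) *v u)) has_real_derivative c) (at r) \<and>
      \<bar>c\<bar> \<le> 2 * (u \<bullet> (ehess f (x + r *\<^sub>R u) *v u)) powr (3/2)" if "0 \<le> r \<and> r \<le> s" for r
      by (rule self_concordant_along_line[OF sc seg[of r]]) (use that in auto)
    then obtain c where c: "\<And>r. 0 \<le> r \<and> r \<le> s \<Longrightarrow>
      ((\<lambda>t. u \<bullet> (ehess f (x + t *\<^sub>R u) *v u)) has_real_derivative c r) (at r) \<and>
      \<bar>c r\<bar> \<le> 2 * (u \<bullet> (ehess f (x + r *\<^sub>R u) *v u)) powr (3/2)"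
      by metis
    have ls: "l * s < 1" using mult_left_mono[OF s(2) l0] \<tau> by linarith
    have "real_of_ereal (f (x + s *\<^sub>R u)) \<le> real_of_ereal (f (x + 0 *\<^sub>R u))
        + s * (egrad f (x + 0 *\<^sub>R u) \<bullet> u) + omega_star (sqrt (u \<bullet> (ehess f (x + 0 *\<^sub>R u) *v u)) * s)"
    proof (rule self_concordant_upper_bound[OF s(1), where c = c])
      show "sqrt (u \<bullet> (ehess f (x + 0 *\<^sub>R u) *v u)) * s < 1" using ls l by simp
      fix r assume r: "0 \<le> r" "r \<le> s"
      show "((\<lambda>s. real_of_ereal (f (x + s *\<^sub>R u))) has_real_derivative egrad f (x + r *\<^sub>R u) \<bullet> u) (at r)"
        by (rule line_first_derivative[OF C3 op seg[OF r]])
      show "((\<lambda>s. egrad f (x + s *\<^sub>R u) \<bullet> u) has_real_derivative u \<bullet> (ehess f (x + r *\<^sub>R u) *v u)) (at r)"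
        by (rule line_second_derivative[OF C3 op seg[OF r]])
      show "0 < u \<bullet> (ehess f (x + r *\<^sub>R u) *v u)" using pos[OF r(1) _ seg[OF r]] r s by simp
    qed (use c in blast)+
    then show ?thesis by (simp add: U_def l)
  qed
  have T_closed_form: "T = {0..\<tau>} \<inter> (\<lambda>s. (x + s *\<^sub>R u, U s)) -` epi UNIV f"
    using bound nm by (auto simp: T_def epi_def edom_def real_of_ereal_le_iff_finite)
  have "continuous_on {0..\<tau>} U"
  proof -
    have "l * s < 1" if "s \<in> {0..\<tau>}" for s
      using mult_left_mono[of s \<tau> l] that l0 \<tau> by auto
    then show ?thesis unfolding U_def omega_star_def by (intro continuous_intros) force+
  qed
  then have "continuous_on {0..\<tau>} (\<lambda>s. (x + s *\<^sub>R u, U s))" by (intro continuous_intros)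
  then have "closedin (top_of_set {0..\<tau>}) T" unfolding T_closed_form
    using cc by (intro continuous_closedin_preimage) (auto simp: closed_convex_fun_def)
  moreover have "openin (top_of_set {0..\<tau>}) T"
  proof -
    have "continuous_on {0..\<tau>} (\<lambda>s. x + s *\<^sub>R u)" by (intro continuous_intros)
    moreover have "T = {0..\<tau>} \<inter> (\<lambda>s. x + s *\<^sub>R u) -` edom f" by (auto simp: T_def)
    ultimately show ?thesis using op by (simp add: continuous_openin_preimage_gen)
  qed
  moreover have "0 \<in> T" using x \<tau> by (simp add: T_def)
  ultimately have "T = {0..\<tau>}" using connected_Icc[of 0 \<tau>] unfolding connected_clopen by blast
  then have "\<tau> \<in> T" using \<tau> by simp
  then show "x + \<tau> *\<^sub>R u \<in> edom f"
    "real_of_ereal (f (x + \<tau> *\<^sub>R u)) \<le> real_of_ereal (f x) + \<tau> * (egrad f x \<bullet> u) + omega_star (l * \<tau>)"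
    using bound by (auto simp: T_def U_def)
qed

section \<open>Lower semicontinuous functions\<close>

lemma lsc_of_closed_epigraph:
  assumes "closed_convex_fun UNIV h"
  shows "open {x. ereal c < h x}"
proof -
  have "closed ((\<lambda>x. (x, c)) -` epi UNIV h)"
    using assms by (intro closed_vimage continuous_intros) (auto simp: closed_convex_fun_def)
  moreover have "{x. ereal c < h x} = - ((\<lambda>x. (x, c)) -` epi UNIV h)"
    by (auto simp: epi_def not_le)
  ultimately show ?thesis by (simp add: open_Compl)
qed

lemma lsc_of_closed_epigraph_block:
  fixes blk :: "'n::finite \<Rightarrow> 'b"
  assumes "closed_convex_fun (block_space blk i) h"
  shows "open {x. ereal c < h (block_vec blk i x)}"
proof -
  have "closed ((\<lambda>x. (block_vec blk i x, c)) -` epi (block_space blk i) h)"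
    using assms by (intro closed_vimage continuous_intros linear_continuous_on linear_block_vec
        linear_conv_bounded_linear[THEN iffD1]) (auto simp: closed_convex_fun_def)
  moreover have "{x. ereal c < h (block_vec blk i x)} =
      - ((\<lambda>x. (block_vec blk i x, c)) -` epi (block_space blk i) h)"
    by (auto simp: epi_def not_le)
  ultimately show ?thesis by (simp add: open_Compl)
qed

text \<open>A sum exceeds \<open>c\<close> iff \<open>c\<close> can be split into parts that are exceeded by the summands.\<close>

lemma lsc_add:
  fixes h k :: "'a::topological_space \<Rightarrow> ereal"
  assumes "\<And>c. open {x. ereal c < h x}" "\<And>c. open {x. ereal c < k x}"
    and "\<And>x. h x \<noteq> -\<infinity>" "\<And>x. k x \<noteq> -\<infinity>"
  shows "open {x. ereal c < h x + k x}"
proof -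
  have "ereal c < u + v \<longleftrightarrow> (\<exists>a. ereal a < u \<and> ereal (c - a) < v)"
    if "u \<noteq> -\<infinity>" "v \<noteq> -\<infinity>" for u v :: ereal
  proof (cases u; cases v)
    fix r s assume "u = ereal r" "v = ereal s"
    moreover have "c < r + s \<Longrightarrow> c - (c + r - s) / 2 < s \<and> (c + r - s) / 2 < r"
      by (simp add: field_simps)
    ultimately show ?thesis by (auto intro!: exI[of _ "(c + r - s) / 2"])
  next
    fix r assume "u = ereal r" "v = \<infinity>"
    then show ?thesis by (auto intro!: exI[of _ "r - 1"])
  next
    fix s assume "u = \<infinity>" "v = ereal s"
    then show ?thesis by (auto intro!: exI[of _ "c - s + 1"])
  qed (use that in auto)
  then have "{x. ereal c < h x + k x} = (\<Union>a. {x. ereal a < h x} \<inter> {x. ereal (c - a) < k x})"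
    using assms(3,4) by auto
  also have "open \<dots>" using assms(1,2) by (intro open_UN open_Int) auto
  finally show ?thesis .
qed

lemma sum_ereal_not_MInfty:
  fixes h :: "'b \<Rightarrow> ereal"
  assumes "\<And>i. i \<in> I \<Longrightarrow> h i \<noteq> -\<infinity>"
  shows "(\<Sum>i\<in>I. h i) \<noteq> -\<infinity>"
  using assms by (induction I rule: infinite_finite_induct) auto

lemma lsc_sum:
  fixes h :: "'b \<Rightarrow> 'a::topological_space \<Rightarrow> ereal"
  assumes "finite I" "\<And>i c. i \<in> I \<Longrightarrow> open {x. ereal c < h i x}" "\<And>i x. i \<in> I \<Longrightarrow> h i x \<noteq> -\<infinity>"
  shows "open {x. ereal c < (\<Sum>i\<in>I. h i x)}"
  using assms
proof (induction I arbitrary: c rule: finite_induct)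
  case empty
  show ?case by (simp add: zero_ereal_def)
next
  case (insert i I)
  have "(\<Sum>i\<in>I. h i x) \<noteq> -\<infinity>" for x
    using insert.prems(2) by (intro sum_ereal_not_MInfty) auto
  then show ?case using insert by (simp add: lsc_add)
qed

section \<open>The composite problem\<close>

text \<open>\<open>F\<close> and \<open>S\<close> are parameters tied down by equations, so that an instance may use its own names
  for them.\<close>

locale composite_problem =
  fixes blk :: "'n::finite \<Rightarrow> 'b::finite"
    and f :: "real^'n \<Rightarrow> ereal"
    and g :: "'b \<Rightarrow> real^'n \<Rightarrow> ereal"
    and F :: "real^'n \<Rightarrow> ereal"
    and x0 xstar :: "real^'n"
    and S :: "(real^'n) set"
  assumes F_eq: "\<And>x. F x = f x + separable blk g x"
    and S_eq: "S = {x. F x \<le> F x0}"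
    and f_not_minf: "\<And>x. f x \<noteq> -\<infinity>"
    and f_sc: "standard_self_concordant f"
    and g_proper: "\<And>i. proper_fun (block_space blk i) (g i)"
    and g_closed_convex: "\<And>i. closed_convex_fun (block_space blk i) (g i)"
    and hess_cont: "continuous_on (edom F) (ehess f)"
    and hess_pos_def: "\<And>x. x \<in> edom F \<Longrightarrow> pos_def_matrix (ehess f x)"
    and unique_solution: "\<And>z. (\<forall>y. F z \<le> F y) \<longleftrightarrow> z = xstar"
    and x0_dom: "x0 \<in> edom F"
begin

abbreviation "fr x \<equiv> real_of_ereal (f x)"
abbreviation "gr i x \<equiv> real_of_ereal (g i (block_vec blk i x))"
abbreviation "Gr x \<equiv> \<Sum>i\<in>UNIV. gr i x"
abbreviation "Fr x \<equiv> real_of_ereal (F x)"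

lemma f_C3: "cont_diff_on 3 (\<lambda>y. real_of_ereal (f y)) (edom f)"
  and f_open: "open (edom f)" and f_cc: "closed_convex_fun UNIV f"
  using f_sc by (auto simp: standard_self_concordant_def)

lemma g_not_minf: "g i (block_vec blk i x) \<noteq> -\<infinity>"
  using g_proper[of i] block_vec_in_block_space[of blk i x] unfolding proper_fun_def by blast

lemma separable_not_minf: "separable blk g x \<noteq> -\<infinity>"
  unfolding separable_def using g_not_minf by (intro sum_ereal_not_MInfty) auto

lemma separable_finite_iff: "separable blk g x < \<infinity> \<longleftrightarrow> (\<forall>i. block_vec blk i x \<in> edom (g i))"
  unfolding separable_def edom_def by (simp add: less_top[symmetric] top_ereal_def sum_Pinfty)

lemma separable_real:
  assumes "\<And>i. block_vec blk i x \<in> edom (g i)"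
  shows "separable blk g x = ereal (Gr x)"
proof -
  have "g i (block_vec blk i x) = ereal (gr i x)" for i
    using assms[of i] g_not_minf[of i x] by (cases "g i (block_vec blk i x)") (auto simp: edom_def)
  then have "separable blk g x = (\<Sum>i\<in>UNIV. ereal (gr i x))" unfolding separable_def by simp
  then show ?thesis by simp
qed

lemma edom_F_iff: "x \<in> edom F \<longleftrightarrow> x \<in> edom f \<and> (\<forall>i. block_vec blk i x \<in> edom (g i))"
  using f_not_minf[of x] separable_not_minf[of x] separable_finite_iff[of x]
  unfolding edom_def F_eq by (cases "f x"; cases "separable blk g x") auto

lemma F_not_minf: "F x \<noteq> -\<infinity>"
  using f_not_minf separable_not_minf unfolding F_eq by simp

lemma F_real: "x \<in> edom F \<Longrightarrow> F x = ereal (Fr x)"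
  using F_not_minf[of x] by (cases "F x") (auto simp: edom_def)

lemma f_real: "x \<in> edom f \<Longrightarrow> f x = ereal (fr x)"
  using f_not_minf[of x] by (cases "f x") (auto simp: edom_def)

lemma Fr_split:
  assumes "x \<in> edom F" shows "Fr x = fr x + Gr x"
proof -
  have "F x = ereal (fr x + Gr x)"
    using assms separable_real[of x] f_real[of x] unfolding edom_F_iff F_eq by (metis plus_ereal.simps(1))
  then show ?thesis by simp
qed

lemma S_subset: "S \<subseteq> edom F"
  using x0_dom unfolding S_eq edom_def by auto

lemma S_iff: "x \<in> S \<longleftrightarrow> x \<in> edom F \<and> Fr x \<le> Fr x0"
proof -
  have "x \<in> edom F \<Longrightarrow> F x \<le> F x0 \<longleftrightarrow> Fr x \<le> Fr x0"
    using F_real[of x] F_real[OF x0_dom] by (metis ereal_less_eq(3))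
  then show ?thesis using S_subset by (auto simp: S_eq)
qed

lemma xstar_min: "F xstar \<le> F y"
  using unique_solution by blast

lemma xstar_in_S: "xstar \<in> S"
  using xstar_min S_eq by simp

lemma xstar_dom: "xstar \<in> edom F"
  using xstar_in_S S_subset by blast

lemma x0_in_S: "x0 \<in> S"
  by (simp add: S_eq)

lemma Fr_xstar_le: "y \<in> edom F \<Longrightarrow> Fr xstar \<le> Fr y"
  using xstar_min[of y] F_real[OF xstar_dom] F_real[of y] by (metis ereal_less_eq(3))

lemma gr_convex:
  assumes "block_vec blk i x \<in> edom (g i)" "block_vec blk i y \<in> edom (g i)" "0 \<le> t" "t \<le> 1"
  shows "block_vec blk i (x + t *\<^sub>R (y - x)) \<in> edom (g i)"
    "gr i (x + t *\<^sub>R (y - x)) \<le> gr i x + t * (gr i y - gr i x)"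
proof -
  let ?P = "block_vec blk i"
  have eq: "?P (x + t *\<^sub>R (y - x)) = ?P x + t *\<^sub>R (?P y - ?P x)"
    by (simp add: block_vec_add block_vec_scaleR block_vec_diff)
  show dom: "?P (x + t *\<^sub>R (y - x)) \<in> edom (g i)"
    unfolding eq using assms by (intro closed_convex_fun_edom[OF g_closed_convex]) auto
  have "g i (?P z) = ereal (gr i z)" if "?P z \<in> edom (g i)" for z
    using that g_not_minf[of i z] by (cases "g i (?P z)") (auto simp: edom_def)
  then have "g i (?P (x + t *\<^sub>R (y - x))) \<le> ereal (gr i x + t * (gr i y - gr i x))"
    unfolding eq using assms by (intro closed_convex_fun_combination[OF g_closed_convex]) auto
  then show "gr i (x + t *\<^sub>R (y - x)) \<le> gr i x + t * (gr i y - gr i x)"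
    using dom g_not_minf by (simp add: edom_def real_of_ereal_le_iff_finite[where f = "g i"])
qed

lemma Gr_convex:
  assumes "\<And>i. block_vec blk i x \<in> edom (g i)" "\<And>i. block_vec blk i y \<in> edom (g i)" "0 \<le> t" "t \<le> 1"
  shows "Gr (x + t *\<^sub>R (y - x)) \<le> Gr x + t * (Gr y - Gr x)"
proof -
  have "Gr (x + t *\<^sub>R (y - x)) \<le> (\<Sum>i\<in>UNIV. gr i x + t * (gr i y - gr i x))"
    using assms by (intro sum_mono gr_convex)
  then show ?thesis by (simp add: sum.distrib sum_distrib_left[symmetric] sum_subtractf)
qed

lemma Fr_convex:
  assumes x: "x \<in> edom F" and y: "y \<in> edom F" and t: "0 \<le> t" "t \<le> 1"
  shows "x + t *\<^sub>R (y - x) \<in> edom F" "Fr (x + t *\<^sub>R (y - x)) \<le> Fr x + t * (Fr y - Fr x)"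
proof -
  let ?z = "x + t *\<^sub>R (y - x)"
  have fz: "?z \<in> edom f"
    using x y t by (intro closed_convex_fun_edom[OF f_cc]) (auto simp: edom_F_iff)
  then show z: "?z \<in> edom F"
    using x y t by (auto simp: edom_F_iff intro!: gr_convex)
  have "f ?z \<le> ereal (fr x + t * (fr y - fr x))"
    using x y t f_real by (intro closed_convex_fun_combination[OF f_cc]) (auto simp: edom_F_iff)
  then have "fr ?z \<le> fr x + t * (fr y - fr x)"
    using f_real[OF fz] by (metis ereal_less_eq(3))
  moreover have "Gr ?z \<le> Gr x + t * (Gr y - Gr x)"
    using x y t by (intro Gr_convex) (auto simp: edom_F_iff)
  ultimately show "Fr ?z \<le> Fr x + t * (Fr y - Fr x)"
    unfolding Fr_split[OF x] Fr_split[OF y] Fr_split[OF z] right_diff_distrib distrib_left by linarith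
qed

lemma S_segment:
  assumes "x \<in> S" "y \<in> S" "0 \<le> t" "t \<le> 1"
  shows "x + t *\<^sub>R (y - x) \<in> S"
proof -
  have "Fr x + t * (Fr y - Fr x) = (1 - t) * Fr x + t * Fr y" by (simp add: algebra_simps)
  also have "\<dots> \<le> Fr x0" using assms by (intro convex_bound_le) (auto simp: S_iff)
  finally show ?thesis using Fr_convex[of x y t] assms by (force simp: S_iff)
qed

lemma sublevel_closed: "closed {x. F x \<le> ereal c}"
proof -
  have "open {x. ereal c < f x + (\<Sum>i\<in>UNIV. g i (block_vec blk i x))}"
    using separable_not_minf by (intro lsc_add lsc_sum lsc_of_closed_epigraph f_cc f_not_minf
        lsc_of_closed_epigraph_block g_closed_convex g_not_minf) (auto simp: separable_def)
  moreover have "{x. F x \<le> ereal c} = - {x. ereal c < f x + (\<Sum>i\<in>UNIV. g i (block_vec blk i x))}"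
    by (auto simp: F_eq separable_def not_less)
  ultimately show ?thesis by (simp add: closed_Compl)
qed

text \<open>Lower semicontinuity and uniqueness of the minimiser: if no \<open>\<epsilon>\<close> worked, the nested compact sets
  of points of the sphere with value at most \<open>F xstar + 1 / (n + 1)\<close> would share a point, which
  would be a second minimiser.\<close>

lemma F_growth_on_sphere:
  obtains \<epsilon> where "\<epsilon> > 0" "\<And>y. y \<in> sphere xstar 1 \<Longrightarrow> ereal (Fr xstar + \<epsilon>) < F y"
proof -
  let ?C = "\<lambda>n::nat. sphere xstar 1 \<inter> {x. F x \<le> ereal (Fr xstar + 1 / (real n + 1))}"
  have "\<exists>n. ?C n = {}"
  proof (rule ccontr)
    assume ne: "\<nexists>n. ?C n = {}"
    have "(\<Inter>n. ?C n) \<noteq> {}"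
    proof (rule compact_nest)
      show "compact (?C n)" for n by (intro compact_Int_closed sublevel_closed) auto
      show "?C n \<noteq> {}" for n using ne by blast
      fix m n :: nat assume "m \<le> n"
      then have "1 / (real n + 1) \<le> 1 / (real m + 1)" by (simp add: frac_le)
      then have "ereal (Fr xstar + 1 / (real n + 1)) \<le> ereal (Fr xstar + 1 / (real m + 1))" by simp
      then show "?C n \<subseteq> ?C m" by (auto intro: order_trans)
    qed
    then obtain y where y: "y \<in> ?C n" for n by blast
    have "F y \<le> ereal (Fr xstar + 1 / (real n + 1))" for n using y[of n] by blast
    moreover have "y \<in> edom F" using calculation[of 0] by (auto simp: edom_def)
    ultimately have le: "Fr y \<le> Fr xstar + 1 / (real n + 1)" for n
      using F_real by (metis ereal_less_eq(3))
    have "Fr y \<le> Fr xstar"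
    proof (rule field_le_epsilon)
      fix e :: real assume "e > 0"
      then obtain n where "inverse (real (Suc n)) < e" using reals_Archimedean by blast
      then show "Fr y \<le> Fr xstar + e" using le[of n] by (simp add: inverse_eq_divide add.commute)
    qed
    then have "F y \<le> F xstar" using F_real[OF xstar_dom] F_real[OF \<open>y \<in> edom F\<close>]
      by (metis ereal_less_eq(3))
    then have "\<forall>z. F y \<le> F z" using xstar_min order_trans by blast
    then have "y = xstar" using unique_solution by blast
    then show False using y[of 0] by simp
  qed
  then obtain n where "?C n = {}" by blast
  then have "ereal (Fr xstar + 1 / (real n + 1)) < F y" if "y \<in> sphere xstar 1" for y
    using that by (auto simp: not_le[symmetric])
  then show thesis by (intro that[of "1 / (real n + 1)"]) auto
qed

text \<open>By convexity the growth \<open>\<epsilon>\<close> on the unit sphere around \<open>xstar\<close> extends to growth of at least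
  \<open>\<epsilon> r\<close> at distance \<open>r \<ge> 1\<close>, so \<open>S\<close> is bounded.\<close>

lemma S_compact: "compact S"
proof -
  obtain \<epsilon> where \<epsilon>: "\<epsilon> > 0" "\<And>y. y \<in> sphere xstar 1 \<Longrightarrow> ereal (Fr xstar + \<epsilon>) < F y"
    by (rule F_growth_on_sphere) blast
  define R where "R = max 1 ((Fr x0 - Fr xstar) / \<epsilon>)"
  have "dist xstar x \<le> R" if x: "x \<in> S" for x
  proof (cases "norm (x - xstar) \<le> 1")
    case True
    then show ?thesis by (simp add: R_def dist_norm norm_minus_commute)
  next
    case False
    define r where "r = norm (x - xstar)"
    have r: "r > 1" using False by (simp add: r_def)
    define y where "y = xstar + (1 / r) *\<^sub>R (x - xstar)"
    have "y \<in> sphere xstar 1" using r by (auto simp: y_def dist_norm r_def)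
    moreover have y: "y \<in> edom F" "Fr y \<le> Fr xstar + (1 / r) * (Fr x - Fr xstar)"
      unfolding y_def using Fr_convex[OF xstar_dom, of x "1 / r"] x S_subset r by auto
    ultimately have "ereal (Fr xstar + \<epsilon>) < ereal (Fr y)"
      using \<epsilon>(2)[of y] by (subst F_real[OF y(1), symmetric])
    then have "Fr xstar + \<epsilon> < Fr y" by (simp only: less_ereal.simps)
    then have "\<epsilon> < (1 / r) * (Fr x - Fr xstar)" using y(2) by linarith
    also have "\<dots> \<le> (1 / r) * (Fr x0 - Fr xstar)"
      using x r by (intro mult_left_mono) (auto simp: S_iff)
    finally have "r < (Fr x0 - Fr xstar) / \<epsilon>"
      using r \<epsilon>(1) by (simp add: field_simps)
    then show ?thesis by (simp add: R_def r_def dist_norm norm_minus_commute)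
  qed
  then have "bounded S" unfolding bounded_def by blast
  moreover have "closed S" 
    using sublevel_closed[of "Fr x0"] by (simp only: S_eq F_real[OF x0_dom, symmetric])
  ultimately show ?thesis by (simp add: compact_eq_bounded_closed)
qed

lemma S_psd: "x \<in> S \<Longrightarrow> pos_semidef_matrix (ehess f x)"
  using S_subset hess_pos_def pos_def_imp_semidef by blast

lemma L_const_bdd: "bdd_above ((\<lambda>x. spectral_norm (ehess f x)) ` S)"
proof -
  have "compact (ehess f ` S)"
    by (rule compact_continuous_image[OF continuous_on_subset[OF hess_cont S_subset] S_compact])
  then have "bounded (ehess f ` S)" by (rule compact_imp_bounded)
  then obtain c where c: "\<And>x. x \<in> S \<Longrightarrow> norm (ehess f x) \<le> c"
    unfolding bounded_iff by fast
  have "spectral_norm (ehess f x) \<le> real CARD('n) * real CARD('n) * c" if "x \<in> S" for x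
    unfolding spectral_norm_def
  proof (rule onorm_le_matrix_component)
    fix i j
    have "\<bar>ehess f x $ i $ j\<bar> \<le> norm (ehess f x $ i)" by (rule component_le_norm_cart)
    also have "\<dots> \<le> norm (ehess f x)" by (rule Finite_Cartesian_Product.norm_nth_le)
    finally show "\<bar>ehess f x $ i $ j\<bar> \<le> c" using c[OF that] by simp
  qed
  then show ?thesis by (rule bdd_aboveI2)
qed

abbreviation "L \<equiv> L_const f S"
abbreviation "\<sigma> \<equiv> sigma_const f S"

lemma hess_upper:
  assumes "x \<in> S" shows "v \<bullet> (ehess f x *v v) \<le> L * (norm v)\<^sup>2"
proof -
  have "spectral_norm (ehess f x) \<le> L"
    unfolding L_const_def by (rule cSUP_upper[OF assms L_const_bdd])
  then have "spectral_norm (ehess f x) * (norm v)\<^sup>2 \<le> L * (norm v)\<^sup>2"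
    by (rule mult_right_mono) simp
  then show ?thesis using quadratic_form_le_spectral_norm[of v "ehess f x"] by linarith
qed

lemma L_nonneg: "0 \<le> L"
  using cSUP_upper[OF x0_in_S L_const_bdd] spectral_norm_nonneg[of "ehess f x0"]
  unfolding L_const_def by linarith

lemma sigma_nonneg: "0 \<le> \<sigma>"
  unfolding sigma_const_def using x0_in_S S_psd min_eigenvalue_nonneg by (intro cINF_greatest) auto

lemma hess_lower:
  assumes "x \<in> S" shows "\<sigma> * (norm v)\<^sup>2 \<le> v \<bullet> (ehess f x *v v)"
proof -
  have "\<sigma> \<le> min_eigenvalue (ehess f x)" unfolding sigma_const_def
    using assms S_psd min_eigenvalue_nonneg by (intro cINF_lower bdd_belowI2[where m = 0]) auto
  then have "\<sigma> * (norm v)\<^sup>2 \<le> min_eigenvalue (ehess f x) * (norm v)\<^sup>2" by (rule mult_right_mono) simp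
  also have "\<dots> \<le> v \<bullet> (ehess f x *v v)"
    using S_psd[OF assms] by (intro min_eigenvalue_le) (simp add: pos_semidef_matrix_def)
  finally show ?thesis .
qed

text \<open>Minus the gradient of \<open>f\<close> at \<open>xstar\<close> is a subgradient of the separable part there. Moving from
  \<open>xstar\<close> towards \<open>y\<close> by a fraction \<open>t\<close> changes \<open>f\<close> to first order by the gradient and the convex
  separable part by at most \<open>t (Gr y - Gr xstar)\<close>, and the total cannot decrease.\<close>

lemma optimality_condition:
  assumes y: "\<And>i. block_vec blk i y \<in> edom (g i)"
  shows "Gr xstar - egrad f xstar \<bullet> (y - xstar) \<le> Gr y"
proof (rule ccontr)
  let ?w = "y - xstar"
  define k where "k t = fr (xstar + t *\<^sub>R ?w) + t * (Gr y - Gr xstar)" for t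
  assume "\<not> ?thesis"
  then have neg: "egrad f xstar \<bullet> ?w + (Gr y - Gr xstar) < 0" by simp
  have xf: "xstar \<in> edom f" and xg: "\<And>i. block_vec blk i xstar \<in> edom (g i)"
    using xstar_dom by (auto simp: edom_F_iff)
  have "(k has_real_derivative egrad f xstar \<bullet> ?w + (Gr y - Gr xstar)) (at 0)"
    unfolding k_def using line_first_derivative[OF f_C3 f_open, of xstar 0 ?w] xf
    by (auto intro!: derivative_eq_intros)
  from DERIV_neg_dec_right[OF this neg] obtain e where
    e: "e > 0" "\<forall>h>0. h < e \<longrightarrow> k (0 + h) < k 0" by blast
  have "((\<lambda>t. xstar + t *\<^sub>R ?w) \<longlongrightarrow> xstar + 0 *\<^sub>R ?w) (at_right 0)"
    by (intro tendsto_intros)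
  then have "eventually (\<lambda>t. xstar + t *\<^sub>R ?w \<in> edom f) (at_right 0)"
    by (rule topological_tendstoD) (use f_open xf in auto)
  moreover have "eventually (\<lambda>t. t \<in> {0<..<min e 1}) (at_right 0)"
    using e(1) by (intro eventually_at_right_real) auto
  ultimately have "eventually (\<lambda>t. xstar + t *\<^sub>R ?w \<in> edom f \<and> t \<in> {0<..<min e 1}) (at_right 0)"
    by (rule eventually_conj)
  from eventually_happens[OF this] obtain t where
    "xstar + t *\<^sub>R ?w \<in> edom f \<and> t \<in> {0<..<min e 1}"
    unfolding trivial_limit_def[symmetric] using trivial_limit_at_right_real[of 0] by blast
  then have t: "xstar + t *\<^sub>R ?w \<in> edom f" "0 < t" "t < e" "t < 1" by auto
  have z: "xstar + t *\<^sub>R ?w \<in> edom F"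
    using t gr_convex(1)[OF xg y, of t] by (simp add: edom_F_iff)
  have "Fr xstar \<le> Fr (xstar + t *\<^sub>R ?w)" by (rule Fr_xstar_le[OF z])
  also have "\<dots> \<le> fr (xstar + t *\<^sub>R ?w) + (Gr xstar + t * (Gr y - Gr xstar))"
    using t Gr_convex[OF xg y, of t] by (simp add: Fr_split[OF z])
  finally have "k 0 \<le> k t" by (simp add: k_def Fr_split[OF xstar_dom])
  moreover have "k (0 + t) < k 0" using e(2) t by blast
  ultimately show False by simp
qed

lemma L_pos: "0 < L"
proof -
  define v where "v = (axis undefined 1 :: real^'n)"
  have v: "v \<noteq> 0" "norm v = 1" by (auto simp: v_def axis_eq_0_iff)
  have "0 < v \<bullet> (ehess f x0 *v v)"
    using hess_pos_def[OF x0_dom] v(1) unfolding pos_def_matrix_def by blast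
  also have "\<dots> \<le> L" using hess_upper[OF x0_in_S, of v] v(2) by simp
  finally show ?thesis .
qed

text \<open>The test vector \<open>w\<close> is kept free: \<open>w = - (y - x)\<close> gives strong monotonicity, \<open>w = y - x\<close> the
  upper curvature bound, and a combination of \<open>y - x\<close> with the gradient increment itself
  cocoercivity.\<close>

lemma gradient_increment_le:
  assumes xy: "x \<in> S" "y \<in> S" and t: "0 \<le> t" "t \<le> 1"
    and le: "\<And>z. z \<in> S \<Longrightarrow> w \<bullet> (ehess f z *v (y - x)) \<le> c"
  shows "(egrad f (x + t *\<^sub>R (y - x)) - egrad f x) \<bullet> w \<le> t * c"
proof -
  let ?z = "\<lambda>s. x + s *\<^sub>R (y - x)"
  have "egrad f (?z t) \<bullet> w - t * c \<le> egrad f (?z 0) \<bullet> w - 0 * c"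
  proof (rule DERIV_nonpos_imp_nonincreasing[OF t(1), of "\<lambda>s. egrad f (?z s) \<bullet> w - s * c"])
    fix s assume s: "0 \<le> s" "s \<le> t"
    have z: "?z s \<in> S" using s t xy by (intro S_segment) auto
    then have "?z s \<in> edom f" using S_subset by (auto simp: edom_F_iff)
    from line_second_derivative[OF f_C3 f_open this]
    have "((\<lambda>s. egrad f (?z s) \<bullet> w - s * c) has_real_derivative
        w \<bullet> (ehess f (?z s) *v (y - x)) - c) (at s)"
      by (auto intro!: derivative_eq_intros)
    then show "\<exists>y. ((\<lambda>s. egrad f (?z s) \<bullet> w - s * c) has_real_derivative y) (at s) \<and> y \<le> 0"
      using le[OF z] by (intro exI conjI) auto
  qed
  then show ?thesis by (simp add: inner_diff_left)
qed

lemma gradient_strongly_monotone: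
  assumes "x \<in> S" "y \<in> S"
  shows "\<sigma> * (norm (y - x))\<^sup>2 \<le> (egrad f y - egrad f x) \<bullet> (y - x)"
proof -
  have "- (y - x) \<bullet> (ehess f z *v (y - x)) \<le> - (\<sigma> * (norm (y - x))\<^sup>2)" if "z \<in> S" for z
    using hess_lower[OF that] by (simp only: inner_minus_left neg_le_iff_le)
  then have "(egrad f (x + 1 *\<^sub>R (y - x)) - egrad f x) \<bullet> (- (y - x)) \<le> 1 * (- (\<sigma> * (norm (y - x))\<^sup>2))"
    by (intro gradient_increment_le assms) auto
  then show ?thesis by (simp add: algebra_simps)
qed

text \<open>For a convex function with \<open>L\<close>-Lipschitz gradient on the whole space this is the theorem of
  Baillon and Haddad. Here only the segment is known to lie in \<open>S\<close>, but there the Hessian is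
  available: \<open>0 \<le> (r - L e) \<bullet> A (r - L e)\<close> and \<open>r \<bullet> A r \<le> L |r|^2\<close> bound
  \<open>(2 L r - L^2 e) \<bullet> A e\<close>, whose integral along the segment is \<open>2 L |r|^2 - L^2 (r \<bullet> e)\<close>.\<close>

lemma gradient_cocoercive:
  assumes "x \<in> S" "y \<in> S"
  shows "(norm (egrad f y - egrad f x))\<^sup>2 \<le> L * ((egrad f y - egrad f x) \<bullet> (y - x))"
proof -
  define r where "r = egrad f y - egrad f x"
  let ?e = "y - x"
  have "((2 * L) *\<^sub>R r - (L\<^sup>2) *\<^sub>R ?e) \<bullet> (ehess f z *v ?e) \<le> L * (norm r)\<^sup>2"
    if z: "z \<in> S" for z
  proof -
    let ?A = "ehess f z"
    have sym: "transpose ?A = ?A" using S_psd[OF z] by (simp add: pos_semidef_matrix_def)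
    have "0 \<le> (r - L *\<^sub>R ?e) \<bullet> (?A *v (r - L *\<^sub>R ?e))"
      using S_psd[OF z] by (simp add: pos_semidef_matrix_def)
    also have "\<dots> = r \<bullet> (?A *v r) - L * (r \<bullet> (?A *v ?e)) - L * (?e \<bullet> (?A *v r)) + L * (L * (?e \<bullet> (?A *v ?e)))"
      by (simp only: matrix_vector_mult_diff_distrib matrix_vector_mult_scaleR inner_diff_left inner_diff_right
          inner_scaleR_left inner_scaleR_right right_diff_distrib)
    also have "?e \<bullet> (?A *v r) = r \<bullet> (?A *v ?e)"
      using symmetric_inner[OF sym, of ?e r] by (simp add: inner_commute)
    finally show ?thesis using hess_upper[OF z, of r] by (simp add: power2_eq_square inner_diff_left)
  qed
  then have "(egrad f (x + 1 *\<^sub>R ?e) - egrad f x) \<bullet> ((2 * L) *\<^sub>R r - (L\<^sup>2) *\<^sub>R ?e) \<le> 1 * (L * (norm r)\<^sup>2)"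
    by (intro gradient_increment_le assms) auto
  then have "r \<bullet> ((2 * L) *\<^sub>R r - (L\<^sup>2) *\<^sub>R ?e) \<le> L * (norm r)\<^sup>2"
    by (simp add: r_def)
  then have "(2 * L) * (norm r)\<^sup>2 - L\<^sup>2 * (r \<bullet> ?e) \<le> L * (norm r)\<^sup>2"
    by (simp only: inner_diff_right inner_scaleR_right dot_square_norm)
  then have "L * (norm r)\<^sup>2 \<le> L * (L * (r \<bullet> ?e))" by (simp add: power2_eq_square mult_ac)
  then show ?thesis using L_pos by (simp add: r_def)
qed

end

section \<open>Decrease and gap along one step of the method\<close>

text \<open>Equivalent to \<open>ln (1 + l) \<le> l - l^2 / (2 (1 + l))\<close>.\<close>

lemma damped_decrease_scalar:
  fixes l :: real
  assumes "0 \<le> l"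
  shows "omega_star (l / (1 + l)) \<le> l\<^sup>2 / (1 + l) - l\<^sup>2 / (2 * (1 + l))"
proof -
  have "0 - 0\<^sup>2 / (2 * (1 + 0)) - ln (1 + 0) \<le> l - l\<^sup>2 / (2 * (1 + l)) - ln (1 + l)"
  proof (rule DERIV_nonneg_imp_nondecreasing[OF assms, of "\<lambda>l. l - l\<^sup>2 / (2 * (1 + l)) - ln (1 + l)"])
    fix s :: real assume s: "0 \<le> s" "s \<le> l"
    have "((\<lambda>l. l - l\<^sup>2 / (2 * (1 + l)) - ln (1 + l)) has_real_derivative
        1 - (2 * s * (2 * (1 + s)) - s\<^sup>2 * 2) / (2 * (1 + s))\<^sup>2 - 1 / (1 + s)) (at s)"
      using s by (auto intro!: derivative_eq_intros simp: power2_eq_square)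
    moreover have "1 - (2 * s * (2 * (1 + s)) - s\<^sup>2 * 2) / (2 * (1 + s))\<^sup>2 - 1 / (1 + s)
        = s\<^sup>2 / (2 * (1 + s)\<^sup>2)"
      using s by (simp add: divide_simps) (simp add: algebra_simps power2_eq_square)
    ultimately show "\<exists>y. ((\<lambda>l. l - l\<^sup>2 / (2 * (1 + l)) - ln (1 + l)) has_real_derivative y) (at s) \<and> 0 \<le> y"
      by (intro exI conjI) auto
  qed
  then have "ln (1 + l) \<le> l - l\<^sup>2 / (2 * (1 + l))" by simp
  moreover have "1 - l / (1 + l) = inverse (1 + l)" using assms by (simp add: field_simps)
  then have "omega_star (l / (1 + l)) = ln (1 + l) - l / (1 + l)"
    using assms by (simp add: omega_star_def ln_inverse)
  moreover have "l - l / (1 + l) = l\<^sup>2 / (1 + l)"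
    using assms by (simp add: field_simps power2_eq_square)
  ultimately show ?thesis by linarith
qed

locale rbpdn = composite_problem blk f g F x0 xstar S
  for blk :: "'n::finite \<Rightarrow> 'b::finite"
    and f :: "real^'n \<Rightarrow> ereal"
    and g :: "'b \<Rightarrow> real^'n \<Rightarrow> ereal"
    and F :: "real^'n \<Rightarrow> ereal"
    and x0 xstar :: "real^'n"
    and S :: "(real^'n) set" +
  fixes \<eta> Lg :: real and d :: "'b \<Rightarrow> real^'n \<Rightarrow> real^'n"
  assumes eta_range: "0 \<le> \<eta>" "\<eta> \<le> 1/4"
    and d_approx: "\<And>i x. x \<in> edom F \<Longrightarrow> approx_block_solution blk f g \<eta> i x (d i x)"
    and g_diff: "\<And>x. x \<in> S \<Longrightarrow> ediff_at (separable blk g) x"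
    and g_lipschitz: "Lg-lipschitz_on S (egrad (separable blk g))"
begin

abbreviation "G \<equiv> separable blk g"

lemma Lg_nonneg: "0 \<le> Lg"
  using g_lipschitz by (rule lipschitz_on_nonneg)

lemma G_has_derivative:
  "x \<in> S \<Longrightarrow> ((\<lambda>y. real_of_ereal (G y)) has_derivative (\<lambda>v. egrad G x \<bullet> v)) (at x)"
  using gradient_has_derivative[of "\<lambda>y. real_of_ereal (G y)" x] g_diff
  by (simp add: egrad_def ediff_at_def)

text \<open>By \<open>optimality_condition\<close>, adding the linear functional given by the gradient of \<open>f\<close> at
  \<open>xstar\<close> to the separable part gives a function with a local minimum at \<open>xstar\<close>.\<close>

lemma gradient_zero_at_xstar: "egrad f xstar + egrad G xstar = 0"
proof -
  let ?k = "\<lambda>y. egrad f xstar \<bullet> y + real_of_ereal (G y)"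
  have "xstar \<in> interior (edom G)" using g_diff[OF xstar_in_S] by (simp add: ediff_at_def)
  moreover have "?k xstar \<le> ?k y" if "y \<in> interior (edom G)" for y
  proof -
    have dom: "block_vec blk i y \<in> edom (g i)" for i
      using that interior_subset separable_finite_iff unfolding edom_def by blast
    have "block_vec blk i xstar \<in> edom (g i)" for i using xstar_dom by (simp add: edom_F_iff)
    then show ?thesis using optimality_condition[OF dom]
      by (simp add: separable_real dom inner_diff_right)
  qed
  moreover have "(?k has_derivative (\<lambda>v. egrad f xstar \<bullet> v + egrad G xstar \<bullet> v)) (at xstar)"
    by (intro has_derivative_add has_derivative_inner_right has_derivative_ident
        G_has_derivative xstar_in_S)
  ultimately have "(\<lambda>v. egrad f xstar \<bullet> v + egrad G xstar \<bullet> v) = (\<lambda>v. 0)"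
    by (intro differential_zero_maxmin[OF _ open_interior, of xstar "edom G" ?k]) auto
  from fun_cong[OF this, of "egrad f xstar + egrad G xstar"] show ?thesis
    by (simp add: inner_add_left[symmetric])
qed

text \<open>The derivative of \<open>F\<close> along the segment from \<open>xstar\<close> to \<open>x\<close> vanishes at \<open>xstar\<close> and grows at
  rate at most \<open>L + Lg\<close> times the squared length; the segment stays in \<open>S\<close>, where both constants
  are valid.\<close>

lemma F_gap_le_quadratic:
  assumes x: "x \<in> S"
  shows "Fr x - Fr xstar \<le> (L + Lg) / 2 * (norm (x - xstar))\<^sup>2"
proof -
  let ?w = "x - xstar"
  let ?z = "\<lambda>t. xstar + t *\<^sub>R ?w" and ?c = "(L + Lg) * (norm ?w)\<^sup>2"
  let ?h = "\<lambda>t. fr (?z t) + real_of_ereal (G (?z t))"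
  have h: "?h t = Fr (?z t)" if "?z t \<in> S" for t
  proof -
    have z: "?z t \<in> edom F" using that S_subset by blast
    then have "block_vec blk i (?z t) \<in> edom (g i)" for i by (simp add: edom_F_iff)
    then show ?thesis by (simp add: Fr_split[OF z] separable_real)
  qed
  have "?h 1 - ?c * 1\<^sup>2 / 2 \<le> ?h 0 - ?c * 0\<^sup>2 / 2"
  proof (rule DERIV_nonpos_imp_nonincreasing[of 0 1 "\<lambda>t. ?h t - ?c * t\<^sup>2 / 2"])
    fix t :: real assume t: "0 \<le> t" "t \<le> 1"
    have z: "?z t \<in> S" using t x xstar_in_S by (intro S_segment) auto
    then have zf: "?z t \<in> edom f" using S_subset by (auto simp: edom_F_iff)
    have "((\<lambda>t. real_of_ereal (G (?z t))) has_real_derivative egrad G (?z t) \<bullet> ?w) (at t)"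
      using has_derivative_compose[OF line_has_derivative G_has_derivative[OF z]]
      by (simp add: has_field_derivative_def mult.commute[of _ "_ \<bullet> _"])
    then have der: "((\<lambda>t. ?h t - ?c * t\<^sup>2 / 2) has_real_derivative
        egrad f (?z t) \<bullet> ?w + egrad G (?z t) \<bullet> ?w - ?c * t) (at t)"
      using line_first_derivative[OF f_C3 f_open zf] by (auto intro!: derivative_eq_intros)
    have "(egrad f (?z t) - egrad f xstar) \<bullet> ?w \<le> t * (L * (norm ?w)\<^sup>2)"
      using t x hess_upper by (intro gradient_increment_le xstar_in_S)
    moreover have "(egrad G (?z t) - egrad G xstar) \<bullet> ?w \<le> t * (Lg * (norm ?w)\<^sup>2)"
    proof -
      have "(egrad G (?z t) - egrad G xstar) \<bullet> ?w \<le> norm (egrad G (?z t) - egrad G xstar) * norm ?w"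
        by (rule norm_cauchy_schwarz)
      also have "\<dots> \<le> Lg * norm (t *\<^sub>R ?w) * norm ?w"
        using lipschitz_onD[OF g_lipschitz z xstar_in_S] by (intro mult_right_mono) (auto simp: dist_norm)
      finally show ?thesis using t by (simp add: power2_eq_square mult_ac)
    qed
    moreover have "egrad f xstar \<bullet> ?w + egrad G xstar \<bullet> ?w = 0"
      by (simp only: inner_add_left[symmetric] gradient_zero_at_xstar inner_zero_left)
    ultimately have "egrad f (?z t) \<bullet> ?w + egrad G (?z t) \<bullet> ?w - ?c * t \<le> 0"
      by (simp add: inner_diff_left algebra_simps)
    then show "\<exists>y. ((\<lambda>t. ?h t - ?c * t\<^sup>2 / 2) has_real_derivative y) (at t) \<and> y \<le> 0"
      using der by blast
  qed simp
  moreover have "?h 1 = Fr x" "?h 0 = Fr xstar" using h[of 1] h[of 0] x xstar_in_S by simp_all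
  ultimately show ?thesis by simp
qed

abbreviation "dec i x \<equiv> block_norm blk f x i (d i x)"

lemma decrement_nonneg: "x \<in> edom F \<Longrightarrow> 0 \<le> dec i x"
  using hess_pos_def pos_def_imp_semidef by (intro block_norm_nonneg) blast

lemma d_in_block: "x \<in> edom F \<Longrightarrow> d i x \<in> block_space blk i"
  using d_approx unfolding approx_block_solution_def by blast

text \<open>The definition of an approximate solution speaks of subgradients on the block subspace. Since
  these lie in the subspace, the subgradient inequality may be stated with full vectors.\<close>

lemma approx_solutionE:
  assumes x: "x \<in> edom F"
  obtains v s where
    "v \<in> block_space blk i" "s \<in> block_space blk i"
    "s = - v - block_vec blk i (egrad f x) - block_mat blk i (ehess f x) *v d i x"
    "block_dual_norm blk f x i v \<le> \<eta> * dec i x"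
    "block_vec blk i x + d i x \<in> edom (g i)"
    "\<And>y. block_vec blk i y \<in> edom (g i) \<Longrightarrow>
      gr i (x + d i x) + s \<bullet> (y - (x + d i x)) \<le> gr i y"
proof -
  let ?P = "block_vec blk i"
  obtain v s where v: "v \<in> block_space blk i"
    and s: "s \<in> subdiff (block_space blk i) (g i) (?P x + d i x)"
    and eq: "- v = ?P (egrad f x) + block_mat blk i (ehess f x) *v d i x + s"
    and le: "block_dual_norm blk f x i v \<le> \<eta> * dec i x"
    using d_approx[OF x, of i] unfolding approx_block_solution_def by blast
  have sV: "s \<in> block_space blk i" using s by (simp add: subdiff_def)
  have Pxd: "?P (x + d i x) = ?P x + d i x"
    using d_in_block[OF x, of i] by (simp add: block_vec_add block_vec_id)
  have sub: "g i (?P (x + d i x)) + ereal (s \<bullet> (y - (x + d i x))) \<le> g i (?P y)" for y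
  proof -
    have "s \<bullet> (?P y - ?P (x + d i x)) = ?P s \<bullet> (y - (x + d i x))"
      by (simp only: block_vec_diff[symmetric] block_vec_inner)
    then have "s \<bullet> (?P y - ?P (x + d i x)) = s \<bullet> (y - (x + d i x))"
      by (simp only: block_vec_id[OF sV])
    then show ?thesis using s unfolding subdiff_def Pxd[symmetric] by (metis (no_types, lifting)
          block_vec_in_block_space mem_Collect_eq)
  qed
  have px: "?P x \<in> edom (g i)" using x by (simp add: edom_F_iff)
  have dom: "?P (x + d i x) \<in> edom (g i)"
    using sub[of x] px unfolding edom_def by auto
  show thesis
  proof (rule that[OF v sV _ le])
    show "s = - v - ?P (egrad f x) - block_mat blk i (ehess f x) *v d i x"
      using eq by (simp add: algebra_simps)
    show "?P x + d i x \<in> edom (g i)" using dom by (simp add: Pxd)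
    fix y assume y: "?P y \<in> edom (g i)"
    show "gr i (x + d i x) + s \<bullet> (y - (x + d i x)) \<le> gr i y"
      using sub[of y] dom y g_not_minf[of i y] g_not_minf[of i "x + d i x"]
      by (cases "g i (?P y)"; cases "g i (?P (x + d i x))") (auto simp: edom_def)
  qed
qed

text \<open>With \<open>l\<close> the decrement and \<open>\<tau> = 1 / (1 + l)\<close>: convexity and the subgradient at \<open>x + d\<close> bound the
  change of \<open>g_i\<close> by \<open>\<tau> (s \<bullet> d)\<close>, where \<open>s \<bullet> d\<close> is at most \<open>(\<eta> - 1) l^2\<close> minus the slope of \<open>f\<close>.
  The slope cancels against the linear term of the self-concordant bound.\<close>

lemma step_decrease:
  fixes i :: 'b
  assumes x: "x \<in> edom F"
  defines "x' \<equiv> x + (1 / (1 + dec i x)) *\<^sub>R d i x"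
  shows "x' \<in> edom F" "Fr x' \<le> Fr x - (dec i x)\<^sup>2 / (4 * (1 + dec i x))"
proof -
  let ?P = "block_vec blk i" and ?d = "d i x"
  define l where "l = dec i x"
  define \<tau> where "\<tau> = 1 / (1 + l)"
  have l: "0 \<le> l" unfolding l_def by (rule decrement_nonneg[OF x])
  have \<tau>: "0 \<le> \<tau>" "\<tau> \<le> 1" "l * \<tau> < 1" using l by (auto simp: \<tau>_def field_simps)
  have xf: "x \<in> edom f" and xg: "\<And>j. block_vec blk j x \<in> edom (g j)"
    using x by (auto simp: edom_F_iff)
  have x': "x' = x + \<tau> *\<^sub>R ?d" by (simp add: x'_def \<tau>_def l_def)
  have dV: "?d \<in> block_space blk i" by (rule d_in_block[OF x])
  have l_eq: "l = sqrt (?d \<bullet> (ehess f x *v ?d))"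
    by (simp add: l_def block_norm_def block_mat_quadratic block_vec_id[OF dV])
  obtain v s where
    v: "v \<in> block_space blk i" and "s \<in> block_space blk i"
    and s: "s = - v - ?P (egrad f x) - block_mat blk i (ehess f x) *v ?d"
    and v_le: "block_dual_norm blk f x i v \<le> \<eta> * dec i x"
    and dom: "?P x + ?d \<in> edom (g i)"
    and sub: "\<And>y. ?P y \<in> edom (g i) \<Longrightarrow> gr i (x + ?d) + s \<bullet> (y - (x + ?d)) \<le> gr i y"
    by (rule approx_solutionE[OF x, where i = i], rule that)
  have P_other: "block_vec blk j (x + t *\<^sub>R ?d) = block_vec blk j x" if "j \<noteq> i" for j t
    using block_vec_other[OF dV that] by (simp add: block_vec_add block_vec_scaleR)
  have Pxd: "?P (x + ?d) \<in> edom (g i)" using dom by (simp add: block_vec_add block_vec_id[OF dV])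
  have seg: "block_vec blk j (x + t *\<^sub>R ?d) \<in> edom (g j)" if "0 \<le> t" "t \<le> 1" for j t
    using gr_convex(1)[OF xg Pxd that] P_other[of j t] xg[of j] by (cases "j = i") auto
  have step: "x' \<in> edom f \<and> fr x' \<le> fr x + \<tau> * (egrad f x \<bullet> ?d) + omega_star (l * \<tau>)"
  proof (cases "?d = 0")
    case True
    then show ?thesis using xf l_eq by (simp add: x' omega_star_def)
  next
    case False
    have "0 < ?d \<bullet> (ehess f (x + t *\<^sub>R ?d) *v ?d)" if "0 \<le> t" "t \<le> \<tau>" "x + t *\<^sub>R ?d \<in> edom f" for t
    proof -
      have "x + t *\<^sub>R ?d \<in> edom F" using that seg \<tau> by (simp add: edom_F_iff)
      from hess_pos_def[OF this] show ?thesis using False by (simp add: pos_def_matrix_def)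
    qed
    then show ?thesis unfolding x'
      using self_concordant_damped_step[OF f_sc f_not_minf xf l_eq \<tau>(1) \<tau>(3) l] by blast
  qed
  then show x'F: "x' \<in> edom F" using seg \<tau> by (simp add: x' edom_F_iff)
  have "Gr x' - Gr x = (\<Sum>j\<in>UNIV. gr j x' - gr j x)" by (simp add: sum_subtractf)
  also have "\<dots> = (\<Sum>j\<in>UNIV. if j = i then gr i x' - gr i x else 0)"
    by (intro sum.cong refl) (auto simp: x' P_other)
  also have "\<dots> = gr i x' - gr i x" by simp
  also have "\<dots> \<le> \<tau> * (gr i (x + ?d) - gr i x)"
    using gr_convex(2)[OF xg Pxd \<tau>(1,2)] by (simp add: x')
  also have "\<dots> \<le> \<tau> * (s \<bullet> ?d)"
    using sub[OF xg] \<tau> by (intro mult_left_mono) (auto simp: algebra_simps)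
  finally have g_le: "Gr x' - Gr x \<le> \<tau> * (s \<bullet> ?d)" .
  have "v \<bullet> (- ?d) \<le> block_dual_norm blk f x i v * block_norm blk f x i (- ?d)"
    by (rule block_dual_norm_inner[OF hess_pos_def[OF x] v])
  also have "block_norm blk f x i (- ?d) = l"
    by (simp add: l_def block_norm_def linear_neg[OF matrix_vector_mul_linear])
  also have "block_dual_norm blk f x i v * l \<le> \<eta> * l * l"
    using v_le l by (intro mult_right_mono) (auto simp: l_def)
  finally have "- (v \<bullet> ?d) \<le> \<eta> * l\<^sup>2" by (simp add: power2_eq_square mult.assoc)
  moreover have "(block_mat blk i (ehess f x) *v ?d) \<bullet> ?d = l\<^sup>2"
    using block_norm_sq[OF pos_def_imp_semidef[OF hess_pos_def[OF x]], of blk i ?d]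
    by (simp add: l_def inner_commute block_mat_quadratic)
  moreover have "?P (egrad f x) \<bullet> ?d = egrad f x \<bullet> ?d"
    by (simp add: block_vec_inner block_vec_id[OF dV])
  ultimately have "s \<bullet> ?d \<le> \<eta> * l\<^sup>2 - egrad f x \<bullet> ?d - l\<^sup>2"
    by (simp add: s inner_diff_left)
  then have "\<tau> * (s \<bullet> ?d) \<le> \<tau> * (\<eta> * l\<^sup>2 - egrad f x \<bullet> ?d - l\<^sup>2)"
    using \<tau> by (intro mult_left_mono) auto
  then have "Fr x' - Fr x \<le> \<tau> * (\<eta> * l\<^sup>2) - \<tau> * l\<^sup>2 + omega_star (l * \<tau>)"
    using step g_le by (simp add: Fr_split[OF x] Fr_split[OF x'F] right_diff_distrib)
  also have "omega_star (l * \<tau>) \<le> \<tau> * l\<^sup>2 - \<tau> * l\<^sup>2 / 2"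
    using damped_decrease_scalar[OF l] by (simp add: \<tau>_def mult.commute)
  also have "\<tau> * (\<eta> * l\<^sup>2) \<le> \<tau> * ((1/4) * l\<^sup>2)"
    using eta_range \<tau> by (intro mult_left_mono mult_right_mono) auto
  finally have "Fr x' - Fr x \<le> - (\<tau> * l\<^sup>2 / 4)" by simp
  then show "Fr x' \<le> Fr x - (dec i x)\<^sup>2 / (4 * (1 + dec i x))"
    unfolding l_def[symmetric] by (simp add: \<tau>_def mult.commute)
qed

end

section \<open>The gap is controlled by the block decrements\<close>

context rbpdn
begin

abbreviation "H x \<equiv> block_diag blk (ehess f x)"
abbreviation "qH x \<equiv> spectral_norm (matrix_sqrt (H x) ** matrix_inv (matrix_sqrt (ehess f x)))"
abbreviation "qA x \<equiv> spectral_norm (matrix_inv (matrix_sqrt (H x)) ** matrix_sqrt (ehess f x))"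
definition "K \<equiv> SUP x\<in>S. (1 + \<eta>) * qH x + qA x"

lemma c1_const_eq: "c1_const blk f \<eta> S = (1 - \<eta>) / (sqrt (real CARD('b)) * K)"
  by (simp add: c1_const_def K_def Let_def)

lemma H_pos_def: "x \<in> S \<Longrightarrow> pos_def_matrix (H x)"
  using S_subset hess_pos_def by (intro block_diag_pos_def) blast

text \<open>The forms of \<open>A\<close> and of its block diagonal both lie between \<open>\<sigma> |v|^2\<close> and \<open>L |v|^2\<close>.\<close>

lemma quotients_bounded:
  assumes x: "x \<in> S" and \<sigma>: "0 < \<sigma>"
  shows "qH x \<le> sqrt (L / \<sigma>)" "qA x \<le> sqrt (L / \<sigma>)"
proof -
  have A: "pos_def_matrix (ehess f x)" using x S_subset hess_pos_def by blast
  have sq: "(sqrt (L / \<sigma>))\<^sup>2 = L / \<sigma>" using L_nonneg \<sigma> by simp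
  have H_le: "v \<bullet> (H x *v v) \<le> L * (norm v)\<^sup>2" and H_ge: "\<sigma> * (norm v)\<^sup>2 \<le> v \<bullet> (H x *v v)" for v
    unfolding block_diag_quadratic norm_sum_blocks[of v blk] sum_distrib_left
    using hess_upper[OF x] hess_lower[OF x] by (auto intro!: sum_mono)
  have scale: "a \<le> L / \<sigma> * b" if "a \<le> L * n" "\<sigma> * n \<le> b" for a b n
  proof -
    have "L * n = L / \<sigma> * (\<sigma> * n)" using \<sigma> by simp
    also have "\<dots> \<le> L / \<sigma> * b" using that(2) L_nonneg \<sigma> by (intro mult_left_mono) auto
    finally show ?thesis using that(1) by simp
  qed
  show "qH x \<le> sqrt (L / \<sigma>)"
  proof (rule spectral_norm_sqrt_quotient_le[OF A pos_def_imp_semidef[OF H_pos_def[OF x]]])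
    show "v \<bullet> (H x *v v) \<le> (sqrt (L / \<sigma>))\<^sup>2 * (v \<bullet> (ehess f x *v v))" for v
      unfolding sq by (rule scale[OF H_le hess_lower[OF x]])
  qed (use L_nonneg \<sigma> in auto)
  show "qA x \<le> sqrt (L / \<sigma>)"
  proof (rule spectral_norm_inverse_sqrt_quotient_le[OF A H_pos_def[OF x]])
    show "v \<bullet> (ehess f x *v v) \<le> (sqrt (L / \<sigma>))\<^sup>2 * (v \<bullet> (H x *v v))" for v
      unfolding sq by (rule scale[OF hess_upper[OF x] H_ge])
  qed (use L_nonneg \<sigma> in auto)
qed

lemma K_upper:
  assumes "x \<in> S" "0 < \<sigma>"
  shows "(1 + \<eta>) * qH x + qA x \<le> K"
  unfolding K_def
proof (rule cSUP_upper[OF assms(1)])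
  show "bdd_above ((\<lambda>x. (1 + \<eta>) * qH x + qA x) ` S)"
    using quotients_bounded assms(2) eta_range
    by (intro bdd_aboveI2[where M = "(1 + \<eta>) * sqrt (L / \<sigma>) + sqrt (L / \<sigma>)"] add_mono mult_left_mono) auto
qed

lemma K_nonneg:
  assumes "0 < \<sigma>" shows "0 \<le> K"
proof -
  have "0 \<le> (1 + \<eta>) * qH x0 + qA x0"
    using eta_range by (intro add_nonneg_nonneg mult_nonneg_nonneg spectral_norm_nonneg) auto
  then show ?thesis using K_upper[OF x0_in_S assms] by linarith
qed

text \<open>The subgradient of \<open>g\<close> at \<open>x + d\<close> supplied by the method is
  \<open>s = - v - grad f x - H d\<close>, and minus the gradient of \<open>f\<close> at \<open>xstar\<close> is one at \<open>xstar\<close>. Monotonicity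
  reads \<open>(r - v - H d) \<bullet> (d - e) \<ge> 0\<close>. The contribution \<open>(v + H d) \<bullet> d\<close> is nonnegative because
  \<open>\<eta> \<le> 1\<close>, and is dropped.\<close>

lemma monotonicity_inequality:
  assumes x: "x \<in> S"
  defines "r \<equiv> egrad f xstar - egrad f x"
  shows "r \<bullet> (xstar - x) \<le> r \<bullet> (\<Sum>i\<in>UNIV. d i x)
    + (\<Sum>i\<in>UNIV. (1 + \<eta>) * dec i x * block_norm blk f x i (xstar - x))"
proof -
  let ?P = "\<lambda>i. block_vec blk i" and ?A = "ehess f x" and ?e = "xstar - x"
  let ?d = "\<Sum>i\<in>UNIV. d i x"
  have xF: "x \<in> edom F" using x S_subset by blast
  have A: "pos_def_matrix ?A" using hess_pos_def[OF xF] .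
  note psd = pos_def_imp_semidef[OF A]
  have dV: "d i x \<in> block_space blk i" for i by (rule d_in_block[OF xF])
  have Pd: "?P i ?d = d i x" for i by (rule sum_block_vec_selected[OF dV])
  define Q where "Q i v s \<longleftrightarrow> v \<in> block_space blk i \<and>
    s = - v - ?P i (egrad f x) - block_mat blk i ?A *v d i x \<and>
    block_dual_norm blk f x i v \<le> \<eta> * dec i x \<and> ?P i x + d i x \<in> edom (g i) \<and>
    gr i (x + d i x) + s \<bullet> (xstar - (x + d i x)) \<le> gr i xstar" for i v s
  have "\<exists>v s. Q i v s" for i
  proof -
    obtain v s where "v \<in> block_space blk i" "s \<in> block_space blk i"
      and "s = - v - ?P i (egrad f x) - block_mat blk i ?A *v d i x"
      and "block_dual_norm blk f x i v \<le> \<eta> * dec i x"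
      and "?P i x + d i x \<in> edom (g i)"
      and "\<And>y. ?P i y \<in> edom (g i) \<Longrightarrow> gr i (x + d i x) + s \<bullet> (y - (x + d i x)) \<le> gr i y"
      by (rule approx_solutionE[OF xF, where i = i], rule that)
    moreover have "?P i xstar \<in> edom (g i)" using xstar_dom by (simp add: edom_F_iff)
    ultimately have "Q i v s" unfolding Q_def by blast
    then show ?thesis by blast
  qed
  then obtain v s where "\<And>i. Q i (v i) (s i)" by metis
  then have v: "\<And>i. v i \<in> block_space blk i"
    and s: "\<And>i. s i = - v i - ?P i (egrad f x) - block_mat blk i ?A *v d i x"
    and v_le: "\<And>i. block_dual_norm blk f x i (v i) \<le> \<eta> * dec i x"
    and dom: "\<And>i. ?P i x + d i x \<in> edom (g i)"
    and sub: "\<And>i. gr i (x + d i x) + s i \<bullet> (xstar - (x + d i x)) \<le> gr i xstar"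
    unfolding Q_def by blast+
  have Pxd: "?P i (x + ?d) = ?P i x + d i x" "?P i (x + d i x) = ?P i x + d i x" for i
    by (simp_all add: block_vec_add Pd block_vec_id[OF dV])
  have "Gr xstar - egrad f xstar \<bullet> (x + ?d - xstar) \<le> Gr (x + ?d)"
    by (rule optimality_condition) (simp add: Pxd dom)
  moreover have "Gr (x + ?d) + (\<Sum>i\<in>UNIV. s i \<bullet> (xstar - (x + d i x))) \<le> Gr xstar"
    unfolding sum.distrib[symmetric] by (rule sum_mono) (use sub in \<open>simp add: Pxd\<close>)
  ultimately have 1: "(\<Sum>i\<in>UNIV. s i \<bullet> (xstar - (x + d i x))) + egrad f xstar \<bullet> (?e - ?d) \<le> 0"
    by (simp add: algebra_simps)
  have block_term: "s i \<bullet> (xstar - (x + d i x)) \<ge> - (?P i (egrad f x) \<bullet> (?e - ?d))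
      - (1 + \<eta>) * dec i x * block_norm blk f x i ?e" for i
  proof -
    let ?l = "dec i x"
    have l: "0 \<le> ?l" by (rule decrement_nonneg[OF xF])
    have ve: "v i \<bullet> ?e \<le> \<eta> * ?l * block_norm blk f x i ?e"
      by (rule order_trans[OF block_dual_norm_inner[OF A v] mult_right_mono[OF v_le block_norm_nonneg[OF psd]]])
    have "v i \<bullet> (- d i x) \<le> block_dual_norm blk f x i (v i) * block_norm blk f x i (- d i x)"
      by (rule block_dual_norm_inner[OF A v])
    also have "block_norm blk f x i (- d i x) = ?l"
      by (simp add: block_norm_def linear_neg[OF matrix_vector_mul_linear])
    also have "block_dual_norm blk f x i (v i) * ?l \<le> \<eta> * ?l * ?l"
      using v_le l by (intro mult_right_mono)
    finally have vd: "- (v i \<bullet> d i x) \<le> \<eta> * ?l\<^sup>2" by (simp add: power2_eq_square mult.assoc)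
    have He: "(block_mat blk i ?A *v d i x) \<bullet> ?e \<le> ?l * block_norm blk f x i ?e"
      by (rule block_norm_Cauchy_Schwarz[OF psd])
    have Hd: "(block_mat blk i ?A *v d i x) \<bullet> d i x = ?l\<^sup>2"
      using block_norm_sq[OF psd, of blk i "d i x"] by (simp add: inner_commute block_mat_quadratic)
    have "\<eta> * ?l\<^sup>2 \<le> 1 * ?l\<^sup>2" using eta_range by (intro mult_right_mono) auto
    then have "(v i + block_mat blk i ?A *v d i x) \<bullet> (?e - d i x) \<le> (1 + \<eta>) * ?l * block_norm blk f x i ?e"
      using ve vd He Hd by (simp add: inner_add_left inner_diff_right algebra_simps)
    moreover have "?P i (egrad f x) \<bullet> (?e - d i x) = ?P i (egrad f x) \<bullet> (?e - ?d)"
      by (simp add: block_vec_inner block_vec_diff Pd block_vec_id[OF dV])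
    moreover have "s i \<bullet> (xstar - (x + d i x)) = - (?P i (egrad f x) \<bullet> (?e - d i x))
        - (v i + block_mat blk i ?A *v d i x) \<bullet> (?e - d i x)"
      by (simp add: s inner_diff_left inner_add_left algebra_simps)
    ultimately show ?thesis by linarith
  qed
  have "(\<Sum>i\<in>UNIV. - (?P i (egrad f x) \<bullet> (?e - ?d)) - (1 + \<eta>) * dec i x * block_norm blk f x i ?e)
      \<le> (\<Sum>i\<in>UNIV. s i \<bullet> (xstar - (x + d i x)))"
    by (rule sum_mono) (rule block_term)
  moreover have "(\<Sum>i\<in>UNIV. ?P i (egrad f x) \<bullet> (?e - ?d)) = egrad f x \<bullet> (?e - ?d)"
    by (simp only: inner_sum_left[symmetric] sum_block_vec)
  ultimately have "- (egrad f x \<bullet> (?e - ?d)) - (\<Sum>i\<in>UNIV. (1 + \<eta>) * dec i x * block_norm blk f x i ?e)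
      \<le> (\<Sum>i\<in>UNIV. s i \<bullet> (xstar - (x + d i x)))"
    by (simp only: sum_subtractf sum_negf)
  then show ?thesis using 1 by (simp add: r_def inner_diff_left inner_diff_right)
qed

text \<open>Let \<open>\<rho> = r \<bullet> e\<close>, \<open>c = sqrt (L \<rho> / \<sigma>)\<close> and \<open>D\<close> the norm of \<open>d\<close> induced by the block diagonal \<open>H\<close>.
  By \<open>gradient_strongly_monotone\<close> the \<open>A\<close>-norm of \<open>e\<close> is at most \<open>sqrt L |e| \<le> c\<close>, and by
  \<open>gradient_cocoercive\<close> also \<open>|r| / sqrt \<sigma> \<le> c\<close>. So both terms of \<open>monotonicity_inequality\<close> are bounded with
  the same \<open>c\<close>, their sum is at most \<open>K D c\<close>, and \<open>\<rho> \<le> K D c\<close> can be divided by \<open>sqrt \<rho>\<close>.\<close>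

lemma distance_le_decrements:
  assumes x: "x \<in> S" and \<sigma>: "0 < \<sigma>"
  shows "\<sigma> * norm (xstar - x) \<le> K * sqrt L * (\<Sum>i\<in>UNIV. dec i x)"
proof (cases "xstar = x")
  case True
  show ?thesis using True K_nonneg[OF \<sigma>] L_nonneg decrement_nonneg x S_subset
    by (auto intro!: mult_nonneg_nonneg sum_nonneg)
next
  case False
  let ?e = "xstar - x" and ?A = "ehess f x"
  have xF: "x \<in> edom F" using x S_subset by blast
  have A: "pos_def_matrix ?A" using hess_pos_def[OF xF] .
  note psd = pos_def_imp_semidef[OF A]
  note Hpsd = pos_def_imp_semidef[OF H_pos_def[OF x]]
  define r where "r = egrad f xstar - egrad f x"
  define \<rho> where "\<rho> = r \<bullet> ?e"
  define D where "D = L2_set (\<lambda>i. dec i x) UNIV"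
  define dd where "dd = (\<Sum>i\<in>UNIV. d i x)"
  have mono: "\<sigma> * (norm ?e)\<^sup>2 \<le> \<rho>" unfolding \<rho>_def r_def
    by (rule gradient_strongly_monotone[OF x xstar_in_S])
  have cocoercive: "(norm r)\<^sup>2 \<le> L * \<rho>" unfolding \<rho>_def r_def
    by (rule gradient_cocoercive[OF x xstar_in_S])
  have "0 < \<sigma> * (norm ?e)\<^sup>2" using \<sigma> False by simp
  then have \<rho>: "0 < \<rho>" using mono by linarith
  have D0: "0 \<le> D" by (simp add: D_def)
  have L2_block: "L2_set (\<lambda>i. block_norm blk f x i y) UNIV = norm (matrix_sqrt (H x) *v y)" for y
  proof -
    have "(\<Sum>i\<in>UNIV. (block_norm blk f x i y)\<^sup>2) = (norm (matrix_sqrt (H x) *v y))\<^sup>2"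
      by (simp add: norm_matrix_sqrt[OF Hpsd] block_norm_sq[OF psd] block_diag_quadratic)
    then show ?thesis by (simp add: L2_set_def)
  qed
  have "block_norm blk f x i dd = dec i x" for i
    using sum_block_vec_selected[of "\<lambda>i. d i x" blk i] d_in_block[OF xF]
    by (simp add: dd_def block_norm_def block_mat_quadratic block_vec_id)
  then have D_eq: "D = norm (matrix_sqrt (H x) *v dd)" using L2_block[of dd] by (simp add: D_def)
  define c where "c = sqrt (L / \<sigma>) * sqrt \<rho>"
  have c_sq: "c\<^sup>2 = L / \<sigma> * \<rho>" using L_nonneg \<sigma> \<rho> by (simp add: c_def power_mult_distrib)
  have c0: "0 \<le> c" using L_nonneg \<sigma> \<rho> by (simp add: c_def)
  have "(\<Sum>i\<in>UNIV. dec i x * block_norm blk f x i ?e)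
      \<le> (\<Sum>i\<in>UNIV. \<bar>dec i x\<bar> * \<bar>block_norm blk f x i ?e\<bar>)"
    by (rule sum_mono) (simp add: abs_mult[symmetric])
  also have "\<dots> \<le> D * norm (matrix_sqrt (H x) *v ?e)"
    unfolding D_def L2_block[symmetric] by (rule L2_set_mult_ineq)
  also have "\<dots> \<le> D * (qH x * c)"
  proof (intro mult_left_mono D0)
    have "(norm (matrix_sqrt ?A *v ?e))\<^sup>2 \<le> c\<^sup>2"
    proof -
      have "(norm (matrix_sqrt ?A *v ?e))\<^sup>2 \<le> L * (norm ?e)\<^sup>2"
        using hess_upper[OF x] by (simp add: norm_matrix_sqrt[OF psd])
      also have "\<dots> \<le> L * (\<rho> / \<sigma>)"
        using mono \<sigma> L_nonneg by (intro mult_left_mono) (auto simp: field_simps)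
      finally show ?thesis by (simp add: c_sq)
    qed
    then have "norm (matrix_sqrt ?A *v ?e) \<le> c" using c0 by (rule power2_le_imp_le)
    then have "qH x * norm (matrix_sqrt ?A *v ?e) \<le> qH x * c"
      by (intro mult_left_mono spectral_norm_nonneg)
    then show "norm (matrix_sqrt (H x) *v ?e) \<le> qH x * c"
      using norm_sqrt_le_via_quotient[OF A, of "H x" ?e] by linarith
  qed
  finally have "(1 + \<eta>) * (\<Sum>i\<in>UNIV. dec i x * block_norm blk f x i ?e) \<le> (1 + \<eta>) * (D * (qH x * c))"
    using eta_range by (intro mult_left_mono) auto
  then have part1: "(\<Sum>i\<in>UNIV. (1 + \<eta>) * dec i x * block_norm blk f x i ?e) \<le> (1 + \<eta>) * (D * (qH x * c))"
    by (simp add: sum_distrib_left mult.assoc)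
  have part2: "r \<bullet> dd \<le> qA x * D * c"
  proof -
    have sd: "sqrt \<sigma> * norm dd \<le> norm (matrix_sqrt ?A *v dd)"
    proof (rule power2_le_imp_le)
      show "(sqrt \<sigma> * norm dd)\<^sup>2 \<le> (norm (matrix_sqrt ?A *v dd))\<^sup>2"
        using hess_lower[OF x, of dd] \<sigma> by (simp add: norm_matrix_sqrt[OF psd] power_mult_distrib)
    qed simp
    have rn: "norm r / sqrt \<sigma> \<le> c"
    proof (rule power2_le_imp_le[OF _ c0])
      show "(norm r / sqrt \<sigma>)\<^sup>2 \<le> c\<^sup>2"
        using cocoercive \<sigma> by (simp add: c_sq power_divide divide_right_mono)
    qed
    have "r \<bullet> dd \<le> norm r * norm dd" by (rule norm_cauchy_schwarz)
    also have "\<dots> = norm r / sqrt \<sigma> * (sqrt \<sigma> * norm dd)" using \<sigma> by simp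
    also have "\<dots> \<le> c * (qA x * D)"
    proof (rule mult_mono[OF rn _ c0])
      show "sqrt \<sigma> * norm dd \<le> qA x * D"
        unfolding D_eq using sd norm_sqrt_le_via_inverse_quotient[OF A H_pos_def[OF x], of dd] by linarith
    qed (use \<sigma> in simp)
    finally show ?thesis by (simp add: mult_ac)
  qed
  have "\<rho> \<le> r \<bullet> dd + (\<Sum>i\<in>UNIV. (1 + \<eta>) * dec i x * block_norm blk f x i ?e)"
    using monotonicity_inequality[OF x] by (simp add: \<rho>_def r_def dd_def)
  also have "\<dots> \<le> qA x * D * c + (1 + \<eta>) * (D * (qH x * c))" using part1 part2 by linarith
  also have "\<dots> = ((1 + \<eta>) * qH x + qA x) * (D * c)" by (simp add: algebra_simps)
  also have "\<dots> \<le> K * (D * c)" using D0 c0 by (intro mult_right_mono K_upper[OF x \<sigma>]) auto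
  finally have "sqrt \<rho> * sqrt \<rho> \<le> K * D * sqrt (L / \<sigma>) * sqrt \<rho>"
    using \<rho> by (simp add: c_def mult.assoc)
  then have "sqrt \<rho> \<le> K * D * sqrt (L / \<sigma>)"
    by (rule mult_right_le_imp_le) (use \<rho> in simp)
  moreover have "sqrt \<sigma> * norm ?e \<le> sqrt \<rho>"
    using real_sqrt_le_mono[OF mono] by (simp add: real_sqrt_mult)
  ultimately have "sqrt \<sigma> * norm ?e \<le> K * D * sqrt (L / \<sigma>)" by linarith
  then have "sqrt \<sigma> * (sqrt \<sigma> * norm ?e) \<le> sqrt \<sigma> * (K * D * sqrt (L / \<sigma>))"
    by (rule mult_left_mono) (use \<sigma> in simp)
  moreover have "sqrt \<sigma> * (sqrt \<sigma> * norm ?e) = \<sigma> * norm ?e"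
    using \<sigma> by (simp only: mult.assoc[symmetric] real_sqrt_mult_self abs_of_pos)
  moreover have "sqrt \<sigma> * (K * D * sqrt (L / \<sigma>)) = K * sqrt L * D"
    using \<sigma> by (simp add: real_sqrt_divide)
  ultimately have le: "\<sigma> * norm ?e \<le> K * sqrt L * D" by simp
  have "D \<le> (\<Sum>i\<in>UNIV. dec i x)" unfolding D_def
    by (rule L2_set_le_sum) (rule decrement_nonneg[OF xF])
  then have "K * sqrt L * D \<le> K * sqrt L * (\<Sum>i\<in>UNIV. dec i x)"
    using L_nonneg K_nonneg[OF \<sigma>] by (intro mult_left_mono) auto
  then show ?thesis using le by linarith
qed

definition "c4 \<equiv> sqrt (real CARD('b)) * c1_const blk f \<eta> S * sigma_const f S / ((1 - \<eta>) * (L_const f S + Lg))"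

lemma c4_eq: "c4 = \<sigma> / (K * (L + Lg))"
  using eta_range by (simp add: c4_def c1_const_eq)

text \<open>The distance to \<open>xstar\<close> is eliminated between \<open>distance_le_decrements\<close> and
  \<open>F_gap_le_quadratic\<close>. If \<open>\<sigma> = 0\<close> or \<open>K \<le> 0\<close>, then \<open>c4 \<le> 0\<close> and there is nothing to prove; this covers the case in which
  the supremum \<open>K\<close> is not known to be over a bounded set.\<close>

lemma gap_inverse_le_decrements:
  assumes x: "x \<in> S"
  shows "c4 * omega_star_inv (Fr x - Fr xstar) \<le> (\<Sum>i\<in>UNIV. dec i x)"
proof (cases "\<sigma> = 0")
  case True
  then show ?thesis using x S_subset decrement_nonneg by (auto simp: c4_eq intro!: sum_nonneg)
next
  case False
  then have \<sigma>: "0 < \<sigma>" using sigma_nonneg by simp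
  let ?t = "omega_star_inv (Fr x - Fr xstar)" and ?D = "\<Sum>i\<in>UNIV. dec i x"
  have gap: "0 \<le> Fr x - Fr xstar" using Fr_xstar_le x S_subset by auto
  have D0: "0 \<le> ?D" using x S_subset decrement_nonneg by (auto intro!: sum_nonneg)
  have "?t\<^sup>2 \<le> (sqrt (L + Lg) * norm (xstar - x))\<^sup>2"
    using omega_star_inv_sq_le[OF gap] F_gap_le_quadratic[OF x] L_nonneg Lg_nonneg
    by (simp add: power_mult_distrib norm_minus_commute)
  then have t: "?t \<le> sqrt (L + Lg) * norm (xstar - x)"
    by (rule power2_le_imp_le) (use L_nonneg Lg_nonneg in simp)
  show ?thesis
  proof (cases "0 < K")
    case False
    then have "c4 \<le> 0" using \<sigma> L_nonneg Lg_nonneg by (simp add: c4_eq divide_nonneg_nonpos mult_nonpos_nonneg)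
    from mult_nonpos_nonneg[OF this omega_star_inv_works(1)[OF gap]] show ?thesis using D0 by linarith
  next
    case True
    have LL: "0 < L + Lg" using L_pos Lg_nonneg by simp
    have "\<sigma> * ?t \<le> \<sigma> * (sqrt (L + Lg) * norm (xstar - x))"
      using t \<sigma> by (intro mult_left_mono) auto
    also have "\<dots> = sqrt (L + Lg) * (\<sigma> * norm (xstar - x))" by simp
    also have "\<dots> \<le> sqrt (L + Lg) * (K * sqrt L * ?D)"
      using distance_le_decrements[OF x \<sigma>] LL by (intro mult_left_mono) auto
    also have "\<dots> = K * ?D * (sqrt (L + Lg) * sqrt L)" by (simp add: mult_ac)
    also have "\<dots> \<le> K * ?D * (sqrt (L + Lg) * sqrt (L + Lg))"
      using True D0 LL Lg_nonneg by (intro mult_left_mono) auto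
    also have "\<dots> = K * (L + Lg) * ?D" using LL by (simp add: mult_ac)
    finally show ?thesis using True LL by (simp add: c4_eq divide_le_eq mult_ac)
  qed
qed

end

section \<open>Contraction of the expected gap\<close>

lemma damped_quotient_mono:
  fixes a b :: real
  assumes "0 \<le> a" "a \<le> b" shows "a\<^sup>2 / (1 + a) \<le> b\<^sup>2 / (1 + b)"
proof -
  have eq: "x\<^sup>2 / (1 + x) = x - 1 + 1 / (1 + x)" if "0 \<le> x" for x :: real
    using that by (simp add: field_simps power2_eq_square)
  have "1 / (1 + a) - 1 / (1 + b) = (b - a) / ((1 + a) * (1 + b))"
    using assms by (simp add: field_simps)
  also have "\<dots> \<le> (b - a) / 1"
  proof (rule divide_left_mono)
    have "1 * 1 \<le> (1 + a) * (1 + b)" using assms by (intro mult_mono) auto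
    then show "1 \<le> (1 + a) * (1 + b)" by simp
  qed (use assms in auto)
  finally show ?thesis using assms by (simp add: eq)
qed

text \<open>Jensen's inequality for \<open>t^2 / (1 + t)\<close>, by summing the tangent line inequality at the mean.\<close>

lemma damped_quotient_average:
  fixes p l :: "'b \<Rightarrow> real"
  assumes "finite I" and p: "\<And>i. i \<in> I \<Longrightarrow> 0 \<le> p i" "(\<Sum>i\<in>I. p i) = 1"
    and l: "\<And>i. i \<in> I \<Longrightarrow> 0 \<le> l i"
  defines "m \<equiv> \<Sum>i\<in>I. p i * l i"
  shows "m\<^sup>2 / (1 + m) \<le> (\<Sum>i\<in>I. p i * ((l i)\<^sup>2 / (1 + l i)))"
proof -
  have m0: "0 \<le> m" unfolding m_def using p l by (intro sum_nonneg) auto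
  have "m\<^sup>2 / (1 + m) = (\<Sum>i\<in>I. p i * (m\<^sup>2 / (1 + m) + (1 - 1 / (1 + m)\<^sup>2) * (l i - m)))"
  proof -
    have "(\<Sum>i\<in>I. p i * (m\<^sup>2 / (1 + m) + (1 - 1 / (1 + m)\<^sup>2) * (l i - m)))
        = (\<Sum>i\<in>I. (m\<^sup>2 / (1 + m)) * p i + (1 - 1 / (1 + m)\<^sup>2) * (p i * l i)
            - (1 - 1 / (1 + m)\<^sup>2) * m * p i)"
      by (intro sum.cong refl) (simp only: algebra_simps)
    also have "\<dots> = m\<^sup>2 / (1 + m) * (\<Sum>i\<in>I. p i) + (1 - 1 / (1 + m)\<^sup>2) * m
        - (1 - 1 / (1 + m)\<^sup>2) * m * (\<Sum>i\<in>I. p i)"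
      by (simp only: sum.distrib sum_subtractf sum_distrib_left[symmetric] m_def)
    finally show ?thesis by (simp add: p(2))
  qed
  also have "\<dots> \<le> (\<Sum>i\<in>I. p i * ((l i)\<^sup>2 / (1 + l i)))"
  proof (intro sum_mono mult_left_mono p(1))
    (* tangent line of the convex function t^2 / (1 + t) = t - 1 + 1 / (1 + t) at m *)
    fix i assume i: "i \<in> I"
    have eq: "x\<^sup>2 / (1 + x) = x - 1 + 1 / (1 + x)" if "0 \<le> x" for x :: real
      using that by (simp add: field_simps power2_eq_square)
    have "1 / (1 + l i) - 1 / (1 + m) + (l i - m) / (1 + m)\<^sup>2 = (l i - m)\<^sup>2 / ((1 + l i) * (1 + m)\<^sup>2)"
      using m0 l[OF i] by (simp add: divide_simps) (simp add: algebra_simps power2_eq_square)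
    also have "\<dots> \<ge> 0" using m0 l[OF i] by simp
    finally have "0 \<le> 1 / (1 + l i) - 1 / (1 + m) + (l i - m) / (1 + m)\<^sup>2" .
    then show "m\<^sup>2 / (1 + m) + (1 - 1 / (1 + m)\<^sup>2) * (l i - m) \<le> (l i)\<^sup>2 / (1 + l i)"
      unfolding eq[OF m0] eq[OF l[OF i]] by (simp add: algebra_simps diff_divide_distrib)
  qed
  finally show ?thesis .
qed

context rbpdn
begin

lemma F_minus:
  assumes "x \<in> edom F" "y \<in> edom F" shows "F x - F y = ereal (Fr x - Fr y)"
proof -
  obtain a b where "F x = ereal a" "F y = ereal b" using assms[THEN F_real] by blast
  then show ?thesis by simp
qed

lemma c4_nonneg: "0 \<le> c4"
proof (cases "\<sigma> = 0")
  case False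
  then have "0 < \<sigma>" using sigma_nonneg by simp
  then show ?thesis unfolding c4_eq using K_nonneg L_nonneg Lg_nonneg
    by (intro divide_nonneg_nonneg mult_nonneg_nonneg add_nonneg_nonneg) auto
qed (simp add: c4_eq)

definition step :: "'b \<Rightarrow> real^'n \<Rightarrow> real^'n" where
  "step i x = x + (1 / (1 + dec i x)) *\<^sub>R d i x"

definition rate :: "('b \<Rightarrow> real) \<Rightarrow> real" where
  "rate p = 1 - c4\<^sup>2 * (Min (range p))\<^sup>2 * (1 - omega_star_inv (Fr x0 - Fr xstar)) /
    (2 * (1 + c4 * Min (range p) * omega_star_inv (Fr x0 - Fr xstar)))"

lemma step_in_S:
  assumes "x \<in> S" shows "step i x \<in> S"
proof -
  have x: "x \<in> edom F" "Fr x \<le> Fr x0" using assms by (auto simp: S_iff)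
  have "0 \<le> (dec i x)\<^sup>2 / (4 * (1 + dec i x))" using decrement_nonneg[OF x(1), of i] by simp
  then have "Fr (step i x) \<le> Fr x0"
    using step_decrease(2)[OF x(1), of i] x(2) unfolding step_def by linarith
  moreover have "step i x \<in> edom F" unfolding step_def by (rule step_decrease(1)[OF x(1)])
  ultimately show ?thesis unfolding S_iff by blast
qed

lemma gap_nonneg: "x \<in> S \<Longrightarrow> 0 \<le> Fr x - Fr xstar"
  using Fr_xstar_le S_subset by auto

lemma expected_step_contraction:
  assumes p_pos: "\<And>i. 0 < p i" and p_sum: "(\<Sum>i\<in>UNIV. p i) = 1" and x: "x \<in> S"
  shows "(\<Sum>i\<in>UNIV. p i * (Fr (step i x) - Fr xstar)) \<le> rate p * (Fr x - Fr xstar)"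
proof -
  let ?\<delta> = "Fr x - Fr xstar"
  define t t0 a where "t = omega_star_inv ?\<delta>" and "t0 = omega_star_inv (Fr x0 - Fr xstar)"
    and "a = c4 * Min (range p)"
  define m where "m = (\<Sum>i\<in>UNIV. p i * dec i x)"
  have xF: "x \<in> edom F" using x S_subset by blast
  have \<delta>: "0 \<le> ?\<delta>" "?\<delta> \<le> Fr x0 - Fr xstar" using gap_nonneg[OF x] x by (auto simp: S_iff)
  have t: "0 \<le> t" "t < 1" "omega_star t = ?\<delta>" "t \<le> t0"
    using omega_star_inv_works[OF \<delta>(1)] omega_star_inv_mono[OF \<delta>] by (auto simp: t_def t0_def)
  have t0: "t0 < 1" unfolding t0_def using \<delta> by (intro omega_star_inv_works) auto
  have pmin: "0 < Min (range p)" "\<And>i. Min (range p) \<le> p i" using p_pos by auto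
  then have a: "0 \<le> a" unfolding a_def by (intro mult_nonneg_nonneg c4_nonneg less_imp_le)
  have "a * t \<le> Min (range p) * (\<Sum>i\<in>UNIV. dec i x)"
    using mult_left_mono[OF gap_inverse_le_decrements[OF x] less_imp_le[OF pmin(1)]]
    by (simp only: a_def t_def mult_ac)
  also have "\<dots> \<le> m" unfolding m_def sum_distrib_left
    using pmin decrement_nonneg[OF xF] by (intro sum_mono mult_right_mono)
  finally have z: "(a * t)\<^sup>2 / (1 + a * t) \<le> m\<^sup>2 / (1 + m)"
    using a t by (intro damped_quotient_mono) auto
  have "m\<^sup>2 / (1 + m) \<le> (\<Sum>i\<in>UNIV. p i * ((dec i x)\<^sup>2 / (1 + dec i x)))"
    unfolding m_def using p_pos p_sum decrement_nonneg[OF xF]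
    by (intro damped_quotient_average) (auto intro: less_imp_le)
  with z have z': "(a * t)\<^sup>2 / (1 + a * t) \<le> (\<Sum>i\<in>UNIV. p i * ((dec i x)\<^sup>2 / (1 + dec i x)))" by linarith
  have "a\<^sup>2 * (1 - t0) * (2 * ?\<delta>) / (1 + a * t0) \<le> (a * t)\<^sup>2 / (1 + a * t)"
  proof (rule frac_le)
    have "(1 - t0) * (2 * ?\<delta>) \<le> (1 - t) * (2 * ?\<delta>)" using t \<delta> by (intro mult_right_mono) auto
    also have "\<dots> = ?\<delta> * (2 * (1 - t))" by (simp only: mult_ac)
    also have "\<dots> \<le> t\<^sup>2"
    proof -
      have "0 < 2 * (1 - t)" using t(2) by simp
      then show ?thesis using omega_star_upper[OF t(1,2)] unfolding t(3) by (simp only: pos_le_divide_eq)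
    qed
    finally have "a\<^sup>2 * ((1 - t0) * (2 * ?\<delta>)) \<le> a\<^sup>2 * t\<^sup>2" by (intro mult_left_mono) auto
    then show "a\<^sup>2 * (1 - t0) * (2 * ?\<delta>) \<le> (a * t)\<^sup>2" by (simp add: power_mult_distrib mult.assoc)
    show "0 < 1 + a * t" using a t by (simp add: add_pos_nonneg)
    show "1 + a * t \<le> 1 + a * t0" using a t by (simp add: mult_left_mono)
  qed simp
  then have "a\<^sup>2 * (1 - t0) * (2 * ?\<delta>) / (1 + a * t0) / 4 \<le> (a * t)\<^sup>2 / (1 + a * t) / 4"
    by (rule divide_right_mono) simp
  moreover have "A / (2 * B) * D = A * (2 * D) / B / 4" for A B D :: real by simp
  ultimately have key: "a\<^sup>2 * (1 - t0) / (2 * (1 + a * t0)) * ?\<delta> \<le> (a * t)\<^sup>2 / (1 + a * t) / 4"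
    by (simp only:)
  have "(\<Sum>i\<in>UNIV. p i * (Fr (step i x) - Fr xstar))
      \<le> (\<Sum>i\<in>UNIV. p i * ?\<delta> - p i * ((dec i x)\<^sup>2 / (1 + dec i x)) / 4)"
  proof (rule sum_mono)
    fix i
    have "Fr (step i x) - Fr xstar \<le> ?\<delta> - (dec i x)\<^sup>2 / (1 + dec i x) / 4"
      using step_decrease(2)[OF xF, of i] by (simp add: step_def mult.commute)
    from mult_left_mono[OF this less_imp_le[OF p_pos[of i]]]
    show "p i * (Fr (step i x) - Fr xstar) \<le> p i * ?\<delta> - p i * ((dec i x)\<^sup>2 / (1 + dec i x)) / 4"
      by (simp only: right_diff_distrib times_divide_eq_right)
  qed
  also have "\<dots> = ?\<delta> - (\<Sum>i\<in>UNIV. p i * ((dec i x)\<^sup>2 / (1 + dec i x))) / 4"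
    by (simp only: sum_subtractf sum_distrib_right[symmetric] sum_divide_distrib[symmetric] p_sum mult_1)
  also have "\<dots> \<le> ?\<delta> - a\<^sup>2 * (1 - t0) / (2 * (1 + a * t0)) * ?\<delta>"
    by (intro diff_left_mono order_trans[OF key] divide_right_mono z') simp
  also have "\<dots> = rate p * ?\<delta>"
    by (simp add: rate_def a_def t0_def power_mult_distrib left_diff_distrib)
  finally show ?thesis .
qed

text \<open>The expected gap after one step from \<open>x0\<close> is nonnegative and at most the rate times a positive
  gap.\<close>

lemma rate_nonneg:
  assumes "\<And>i. 0 < p i" "(\<Sum>i\<in>UNIV. p i) = 1" "0 < Fr x0 - Fr xstar"
  shows "0 \<le> rate p"
proof -
  have "0 \<le> (\<Sum>i\<in>UNIV. p i * (Fr (step i x0) - Fr xstar))"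
    using assms(1) gap_nonneg[OF step_in_S[OF x0_in_S]]
    by (intro sum_nonneg mult_nonneg_nonneg) (auto intro: less_imp_le)
  also have "\<dots> \<le> rate p * (Fr x0 - Fr xstar)"
    by (rule expected_step_contraction[OF assms(1,2) x0_in_S])
  finally show ?thesis using assms(3) by (simp add: zero_le_mult_iff)
qed

lemma iterate_Suc: "rbpdn_iterate blk f d x0 js (Suc k) = step (js k) (rbpdn_iterate blk f d x0 js k)"
  by (simp add: Let_def step_def)

lemma iterate_in_S: "rbpdn_iterate blk f d x0 js k \<in> S"
  by (induction k) (simp_all only: iterate_Suc step_in_S rbpdn_iterate.simps(1) x0_in_S)

lemma iterate_cong:
  assumes "\<And>m. m < k \<Longrightarrow> js m = js' m"
  shows "rbpdn_iterate blk f d x0 js k = rbpdn_iterate blk f d x0 js' k"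
  using assms
proof (induction k)
  case (Suc k)
  then have "js k = js' k" "rbpdn_iterate blk f d x0 js k = rbpdn_iterate blk f d x0 js' k"
    by simp_all
  then show ?case by (simp only: iterate_Suc)
qed simp

end

section \<open>Random choices of blocks\<close>

lemma sum_PiE_lessThan_Suc:
  fixes w :: "(nat \<Rightarrow> 'b::finite) \<Rightarrow> 'c::comm_monoid_add"
  shows "(\<Sum>js\<in>PiE {..<Suc k} (\<lambda>_. UNIV). w js) =
    (\<Sum>js\<in>PiE {..<k} (\<lambda>_. UNIV). \<Sum>i\<in>UNIV. w (js(k := i)))"
proof -
  have "(\<Sum>js\<in>PiE {..<Suc k} (\<lambda>_. UNIV). w js) =
      (\<Sum>(i, js)\<in>UNIV \<times> PiE {..<k} (\<lambda>_. UNIV). w (js(k := i)))"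
  proof -
    have "inj_on (\<lambda>(i, js). js(k := i)) (UNIV \<times> PiE {..<k} (\<lambda>_. UNIV :: 'b set))"
      by (rule inj_combinator) simp
    from sum.reindex[OF this, of w] show ?thesis
      by (simp only: lessThan_Suc PiE_insert_eq o_def case_prod_unfold)
  qed
  also have "\<dots> = (\<Sum>i\<in>UNIV. \<Sum>js\<in>PiE {..<k} (\<lambda>_. UNIV). w (js(k := i)))"
    by (rule sum.cartesian_product[symmetric])
  also have "\<dots> = (\<Sum>js\<in>PiE {..<k} (\<lambda>_. UNIV). \<Sum>i\<in>UNIV. w (js(k := i)))"
    by (rule sum.swap)
  finally show ?thesis .
qed

lemma (in prob_space) prob_choices:
  fixes \<iota> :: "nat \<Rightarrow> 'a \<Rightarrow> 'b::finite"
  assumes indep: "indep_vars (\<lambda>_. count_space UNIV) \<iota> UNIV"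
    and distr: "\<And>m i. prob {\<omega> \<in> space M. \<iota> m \<omega> = i} = p i"
  shows "{\<omega> \<in> space M. \<forall>m<k. \<iota> m \<omega> = js m} \<in> events"
    "prob {\<omega> \<in> space M. \<forall>m<k. \<iota> m \<omega> = js m} = (\<Prod>m<k. p (js m))"
proof -
  have rv [measurable]: "\<iota> m \<in> measurable M (count_space UNIV)" for m
    using indep by (auto simp: indep_vars_def)
  show "{\<omega> \<in> space M. \<forall>m<k. \<iota> m \<omega> = js m} \<in> events"
    by measurable
  have single: "\<iota> m -` {js m} \<inter> space M = {\<omega> \<in> space M. \<iota> m \<omega> = js m}" for m by auto
  show "prob {\<omega> \<in> space M. \<forall>m<k. \<iota> m \<omega> = js m} = (\<Prod>m<k. p (js m))"
  proof (cases "k = 0")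
    case False
    then have "prob (\<Inter>m\<in>{..<k}. \<iota> m -` {js m} \<inter> space M) = (\<Prod>m<k. prob (\<iota> m -` {js m} \<inter> space M))"
      by (intro indep_varsD[OF indep]) auto
    moreover have "(\<Inter>m\<in>{..<k}. \<iota> m -` {js m} \<inter> space M) = {\<omega> \<in> space M. \<forall>m<k. \<iota> m \<omega> = js m}"
      using False by auto
    ultimately show ?thesis by (simp add: single distr)
  qed (simp add: prob_space)
qed

text \<open>The expectation is a finite sum: a function of the first \<open>k\<close> choices is constant on each of the
  events that fix these choices.\<close>

lemma (in prob_space) nn_integral_choices:
  fixes \<iota> :: "nat \<Rightarrow> 'a \<Rightarrow> 'b::finite" and h :: "(nat \<Rightarrow> 'b) \<Rightarrow> ennreal"
  assumes indep: "indep_vars (\<lambda>_. count_space UNIV) \<iota> UNIV"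
    and distr: "\<And>m i. prob {\<omega> \<in> space M. \<iota> m \<omega> = i} = p i"
    and cong: "\<And>js js'. (\<And>m. m < k \<Longrightarrow> js m = js' m) \<Longrightarrow> h js = h js'"
  shows "(\<integral>\<^sup>+\<omega>. h (\<lambda>m. \<iota> m \<omega>) \<partial>M) =
    (\<Sum>js\<in>PiE {..<k} (\<lambda>_. UNIV). h js * ennreal (\<Prod>m<k. p (js m)))"
proof -
  let ?\<Omega> = "PiE {..<k} (\<lambda>_. UNIV) :: (nat \<Rightarrow> 'b) set"
  define A where "A js = {\<omega> \<in> space M. \<forall>m<k. \<iota> m \<omega> = js m}" for js
  note A = prob_choices[OF indep distr, of k, folded A_def]
  have fin: "finite ?\<Omega>" by (intro finite_PiE) auto
  have "h (\<lambda>m. \<iota> m \<omega>) = (\<Sum>js\<in>?\<Omega>. h js * indicator (A js) \<omega>)" if \<omega>: "\<omega> \<in> space M" for \<omega>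
  proof -
    define js0 where "js0 = restrict (\<lambda>m. \<iota> m \<omega>) {..<k}"
    have js0: "js0 \<in> ?\<Omega>" by (simp add: js0_def)
    have "h js * indicator (A js) \<omega> = (if js = js0 then h js0 else 0)" if "js \<in> ?\<Omega>" for js
    proof -
      have "\<omega> \<in> A js \<longleftrightarrow> js = js0"
      proof
        assume "\<omega> \<in> A js"
        then have "js m = js0 m" if "m \<in> {..<k}" for m using that by (simp add: A_def js0_def)
        then show "js = js0" by (rule PiE_ext[OF that js0])
      next
        assume "js = js0"
        then show "\<omega> \<in> A js" using \<omega> by (simp add: A_def js0_def)
      qed
      then show ?thesis by (simp add: indicator_def)
    qed
    then have "(\<Sum>js\<in>?\<Omega>. h js * indicator (A js) \<omega>) = h js0"
      using fin js0 by simp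
    also have "\<dots> = h (\<lambda>m. \<iota> m \<omega>)" by (rule cong) (simp add: js0_def)
    finally show ?thesis ..
  qed
  then have "(\<integral>\<^sup>+\<omega>. h (\<lambda>m. \<iota> m \<omega>) \<partial>M) = (\<integral>\<^sup>+\<omega>. (\<Sum>js\<in>?\<Omega>. h js * indicator (A js) \<omega>) \<partial>M)"
    by (rule nn_integral_cong)
  also have "\<dots> = (\<Sum>js\<in>?\<Omega>. \<integral>\<^sup>+\<omega>. h js * indicator (A js) \<omega> \<partial>M)"
    using A(1) by (intro nn_integral_sum) auto
  also have "\<dots> = (\<Sum>js\<in>?\<Omega>. h js * ennreal (\<Prod>m<k. p (js m)))"
    using A by (intro sum.cong refl) (simp add: nn_integral_cmult_indicator emeasure_eq_measure)
  finally show ?thesis .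
qed

context rbpdn
begin

text \<open>Written as a sum over histories, so that one iteration splits off the last choice
  (\<open>sum_PiE_lessThan_Suc\<close>) without conditional expectations.\<close>

definition expected_gap :: "('b \<Rightarrow> real) \<Rightarrow> nat \<Rightarrow> real" where
  "expected_gap p k = (\<Sum>js\<in>PiE {..<k} (\<lambda>_. UNIV).
    (\<Prod>m<k. p (js m)) * (Fr (rbpdn_iterate blk f d x0 js k) - Fr xstar))"

lemma expected_gap_Suc_le:
  assumes p_pos: "\<And>i. 0 < p i" and p_sum: "(\<Sum>i\<in>UNIV. p i) = 1"
  shows "expected_gap p (Suc k) \<le> rate p * expected_gap p k"
proof -
  let ?X = "\<lambda>js. rbpdn_iterate blk f d x0 js k"
  have upd: "rbpdn_iterate blk f d x0 (js(k := i)) (Suc k) = step i (?X js)" for js i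
    unfolding iterate_Suc using iterate_cong[of k "js(k := i)" js] by simp
  have prod: "(\<Prod>m<Suc k. p ((js(k := i)) m)) = (\<Prod>m<k. p (js m)) * p i" for js i
    by (simp add: lessThan_Suc mult.commute)
  have "expected_gap p (Suc k) = (\<Sum>js\<in>PiE {..<k} (\<lambda>_. UNIV). \<Sum>i\<in>UNIV.
      (\<Prod>m<k. p (js m)) * p i * (Fr (step i (?X js)) - Fr xstar))"
    unfolding expected_gap_def sum_PiE_lessThan_Suc upd prod ..
  also have "\<dots> = (\<Sum>js\<in>PiE {..<k} (\<lambda>_. UNIV). (\<Prod>m<k. p (js m)) *
      (\<Sum>i\<in>UNIV. p i * (Fr (step i (?X js)) - Fr xstar)))"
    by (simp only: sum_distrib_left mult.assoc)
  also have "\<dots> \<le> (\<Sum>js\<in>PiE {..<k} (\<lambda>_. UNIV). (\<Prod>m<k. p (js m)) *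
      (rate p * (Fr (?X js) - Fr xstar)))"
    by (intro sum_mono mult_left_mono expected_step_contraction p_pos p_sum iterate_in_S prod_nonneg)
      (auto intro: less_imp_le p_pos)
  also have "\<dots> = rate p * expected_gap p k"
    by (simp add: expected_gap_def sum_distrib_left mult_ac)
  finally show ?thesis .
qed

lemma expected_gap_nonneg:
  assumes "\<And>i. 0 < p i" shows "0 \<le> expected_gap p k"
  unfolding expected_gap_def using assms gap_nonneg[OF iterate_in_S]
  by (intro sum_nonneg mult_nonneg_nonneg prod_nonneg) (auto intro: less_imp_le)

text \<open>The induction multiplies by the rate, which needs to be nonnegative; this can only fail when the
  initial gap is zero, and then all iterates are optimal.\<close>

lemma expected_gap_le:
  assumes p: "\<And>i. 0 < p i" "(\<Sum>i\<in>UNIV. p i) = 1"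
  shows "expected_gap p k \<le> rate p ^ k * (Fr x0 - Fr xstar)"
proof (induction k)
  case 0
  show ?case by (simp add: expected_gap_def)
next
  case (Suc k)
  show ?case
  proof (cases "Fr x0 - Fr xstar = 0")
    case True
    then have "Fr (rbpdn_iterate blk f d x0 js (Suc k)) - Fr xstar = 0" for js
      using iterate_in_S[of js "Suc k"] gap_nonneg[OF iterate_in_S, of js "Suc k"] by (simp add: S_iff)
    then show ?thesis using True by (simp only: expected_gap_def) simp
  next
    case False
    then have "0 \<le> rate p" using gap_nonneg[OF x0_in_S] by (intro rate_nonneg p) auto
    have "expected_gap p (Suc k) \<le> rate p * expected_gap p k" by (rule expected_gap_Suc_le[OF p])
    also have "\<dots> \<le> rate p * (rate p ^ k * (Fr x0 - Fr xstar))"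
      using Suc.IH \<open>0 \<le> rate p\<close> by (rule mult_left_mono)
    finally show ?thesis by (simp add: mult.assoc)
  qed
qed

lemma expectation_eq_expected_gap:
  assumes M: "prob_space M" and indep: "prob_space.indep_vars M (\<lambda>_. count_space UNIV) \<iota> UNIV"
    and distr: "\<And>m i. measure M {\<omega> \<in> space M. \<iota> m \<omega> = i} = p i" and p: "\<And>i. 0 < p i"
  shows "(\<integral>\<^sup>+\<omega>. e2ennreal (F (rbpdn_iterate blk f d x0 (\<lambda>m. \<iota> m \<omega>) k) - F xstar) \<partial>M)
    = ennreal (expected_gap p k)"
proof -
  interpret prob_space M by (rule M)
  let ?X = "\<lambda>js. rbpdn_iterate blk f d x0 js k"
  have gap: "e2ennreal (F (?X js) - F xstar) = ennreal (Fr (?X js) - Fr xstar)" for js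
  proof -
    have "?X js \<in> edom F" using iterate_in_S S_subset by blast
    from F_minus[OF this xstar_dom]
    show ?thesis by (simp only: e2ennreal_ereal)
  qed
  have "(\<integral>\<^sup>+\<omega>. e2ennreal (F (?X (\<lambda>m. \<iota> m \<omega>)) - F xstar) \<partial>M) =
    (\<Sum>js\<in>PiE {..<k} (\<lambda>_. UNIV). e2ennreal (F (?X js) - F xstar) * ennreal (\<Prod>m<k. p (js m)))"
  proof (rule nn_integral_choices[OF indep distr, where h = "\<lambda>js. e2ennreal (F (?X js) - F xstar)"])
    fix js js' :: "nat \<Rightarrow> 'b" assume "\<And>m. m < k \<Longrightarrow> js m = js' m"
    then have "?X js = ?X js'" by (rule iterate_cong)
    then show "e2ennreal (F (?X js) - F xstar) = e2ennreal (F (?X js') - F xstar)" by (simp only:)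
  qed
  also have "\<dots> = (\<Sum>js\<in>PiE {..<k} (\<lambda>_. UNIV). ennreal ((\<Prod>m<k. p (js m)) * (Fr (?X js) - Fr xstar)))"
  proof (intro sum.cong refl)
    fix js
    have "0 \<le> (\<Prod>m<k. p (js m))" using p by (intro prod_nonneg) (auto intro: less_imp_le)
    then show "e2ennreal (F (?X js) - F xstar) * ennreal (\<Prod>m<k. p (js m))
        = ennreal ((\<Prod>m<k. p (js m)) * (Fr (?X js) - Fr xstar))"
      unfolding gap by (subst mult.commute) (simp only: ennreal_mult')
  qed
  also have "\<dots> = ennreal (expected_gap p k)"
    unfolding expected_gap_def using gap_nonneg[OF iterate_in_S] p
    by (intro sum_ennreal mult_nonneg_nonneg prod_nonneg) (auto intro: less_imp_le)
  finally show ?thesis .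
qed

end

section \<open>The convergence rate\<close>

theorem corollary1:
  fixes blk :: "'n::finite \<Rightarrow> 'b::finite"
    and f :: "real^'n \<Rightarrow> ereal"
    and g :: "'b \<Rightarrow> real^'n \<Rightarrow> ereal"
    and x0 xstar :: "real^'n"
    and \<eta> Lg :: real
    and p :: "'b \<Rightarrow> real"
    and d :: "'b \<Rightarrow> real^'n \<Rightarrow> real^'n"
    and M :: "'w measure"
    and \<iota> :: "nat \<Rightarrow> 'w \<Rightarrow> 'b"
    and k :: nat
    and F :: "real^'n \<Rightarrow> ereal"
    and X :: "nat \<Rightarrow> 'w \<Rightarrow> real^'n"
    and S :: "(real^'n) set"
    and pmin \<delta>0 c4 :: real
  defines "F \<equiv> \<lambda>x. f x + separable blk g x"
    and "X \<equiv> \<lambda>k \<omega>. rbpdn_iterate blk f d x0 (\<lambda>m. \<iota> m \<omega>) k"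
    and "S \<equiv> {x. F x \<le> F x0}"
    and "pmin \<equiv> Min (range p)"
    and "\<delta>0 \<equiv> real_of_ereal (F x0 - F xstar)"
    and "c4 \<equiv> sqrt (real CARD('b)) * c1_const blk f \<eta> S * sigma_const f S /
                 ((1 - \<eta>) * (L_const f S + Lg))"
  assumes blocks_nonempty: "surj blk"
    and f_not_minf: "\<And>x. f x \<noteq> -\<infinity>"
    and f_sc: "standard_self_concordant f"
    and g_proper: "\<And>i. proper_fun (block_space blk i) (g i)"
    and g_closed_convex: "\<And>i. closed_convex_fun (block_space blk i) (g i)"
    and hess_cont: "continuous_on (edom F) (ehess f)"
    and hess_pos_def: "\<And>x. x \<in> edom F \<Longrightarrow> pos_def_matrix (ehess f x)"
    and unique_solution: "\<And>z. (\<forall>y. F z \<le> F y) \<longleftrightarrow> z = xstar"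
    and x0_dom: "x0 \<in> edom F"
    and eta_range: "0 \<le> \<eta>" "\<eta> \<le> 1/4"
    and p_pos: "\<And>i. 0 < p i"
    and p_sum: "(\<Sum>i\<in>UNIV. p i) = 1"
    and d_approx: "\<And>i x. x \<in> edom F \<Longrightarrow> approx_block_solution blk f g \<eta> i x (d i x)"
    and prob: "prob_space M"
    and choice_indep: "prob_space.indep_vars M (\<lambda>_. count_space UNIV) \<iota> UNIV"
    and choice_distr: "\<And>m i. measure M {\<omega> \<in> space M. \<iota> m \<omega> = i} = p i"
    and g_diff: "\<And>x. x \<in> S \<Longrightarrow> ediff_at (separable blk g) x"
    and g_lipschitz: "Lg-lipschitz_on S (egrad (separable blk g))"
  shows "enn2ereal (\<integral>\<^sup>+\<omega>. e2ennreal (F (X k \<omega>) - F xstar) \<partial>M)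
           \<le> ereal ((1 - c4\<^sup>2 * pmin\<^sup>2 * (1 - omega_star_inv \<delta>0) /
                       (2 * (1 + c4 * pmin * omega_star_inv \<delta>0))) ^ k * \<delta>0)"
proof -
  interpret R: rbpdn blk f g F x0 xstar S \<eta> Lg d
    by unfold_locales (fact f_not_minf f_sc g_proper g_closed_convex hess_cont hess_pos_def
        unique_solution x0_dom eta_range d_approx g_diff g_lipschitz | simp add: F_def S_def)+
  have \<delta>0: "\<delta>0 = R.Fr x0 - R.Fr xstar"
    unfolding \<delta>0_def R.F_minus[OF x0_dom R.xstar_dom] by simp
  have "c4 = R.c4" by (simp only: c4_def R.c4_def)
  then have rate: "1 - c4\<^sup>2 * pmin\<^sup>2 * (1 - omega_star_inv \<delta>0) /
      (2 * (1 + c4 * pmin * omega_star_inv \<delta>0)) = R.rate p"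
    by (simp only: R.rate_def pmin_def \<delta>0)
  have "enn2ereal (\<integral>\<^sup>+\<omega>. e2ennreal (F (X k \<omega>) - F xstar) \<partial>M) = ereal (R.expected_gap p k)"
    unfolding X_def R.expectation_eq_expected_gap[OF prob choice_indep choice_distr p_pos]
    by (rule enn2ereal_ennreal[OF R.expected_gap_nonneg[OF p_pos]])
  also have "\<dots> \<le> ereal (R.rate p ^ k * \<delta>0)"
    unfolding \<delta>0 ereal_less_eq by (rule R.expected_gap_le[OF p_pos p_sum])
  finally show ?thesis unfolding rate .
qed

end
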